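(* In the setting described in the context, suppose that the following three assumptions hold. Cauchy problem: for every $\mu>0$ there is $T(\mu)>0$ such that for all $u_0\in X$ with $\|u_0\|_X\le\mu$ there is a solution $u$ of $\frac{du}{dt}=\tilde JE'(u)$ on $[0,T(\mu))$ with $u(0)=u_0$, satisfying $E(u(t))=E(u_0)$, $Q(u(t))=Q(u_0)$ for $t\in(0,T(\mu))$. Bound states: $\omega_1<\omega_2$ and there is a $C^3$ map $(\omega_1,\omega_2)\to X$, $\omega\mapsto\phi_\omega$, such that (i) $T(\omega t)\phi_\omega$ is a bound state; (ii) $\phi_\omega\in D(T'(0)^3)$, $\partial_\omega\phi_\omega\in D(T'(0)^2)$, $\partial_\omega^2\phi_\omega\in D(T'(0))$, and $T'(0)\phi_\omega,\partial_\omega\phi_\omega,T'(0)\partial_\omega\phi_\omega,\partial^2_\omega\phi_\omega\in Y$; (iii) $T'(0)\phi_\omega\ne0$, $\partial_\omega\phi_\omega\neq0$, $\langle T'(0)\phi_\omega,\partial_\omega\phi_\omega\rangle=0$. Spectrum: for every $\omega\in(\omega_1,\omega_2)$, (i) $\ker S_\omega''(\phi_\omega)=\mathrm{span}\{T'(0)\phi_\omega\}$; (ii) $S''_\omega(\phi_\omega)$ has only one simple negative eigenvalue $-\mu<0$; (iii) $\inf\{s>0: s\in\sigma(S''_\omega(\phi_\omega))\}>0$, where $\sigma(S_\omega''(\phi_\omega))\subset\mathbb R$ is the spectrum. Let $\omega\in(\omega_1,\omega_2)$ and suppose that, as $\lambda\to0$, $$d(\omega+\lambda)-d(\omega)-\lambda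 d'(\omega)\ \sim\ \lambda\,(d'(\omega+\lambda)-d'(\omega)).$$ Assume that $d$ is strictly convex in an open neighborhood of $\omega$. Then the bound state $T(\omega t)\phi_\omega$ is stable.
   Context: **Spaces and operators.** $X,Y,H$ are real Hilbert spaces with dense continuous embeddings $X\hookrightarrow H\simeq H^*\hookrightarrow X^*$ and $Y\hookrightarrow H\simeq H^*\hookrightarrow Y^*$ ($H$ is identified with $H^*$). $\langle\cdot,\cdot\rangle$ denotes the inner product of $H$, the pairing of $X$ and $X^*$, and the pairing of $Y$ and $Y^*$. $J:H\to H$ is skew-symmetric, $\langle Ju,v\rangle=-\langle u,Jv\rangle$, and $J|_X:X\to Y$, $J|_Y:Y\to X$ are bijective and bounded. $J$ is extended to $\tilde J:X^*\to Y^*$ by $\langle\tilde Ju,v\rangle=-\langle u,Jv\rangle$ ($u\in X^*,v\in Y$). $T(s)$, $s\in\mathbb R$, is a one-parameter unitary group on $X$ with generator $T'(0)$ of domain $D(T'(0))\subset X$; it extends to $X^*$ by $\langle T(s)u,v\rangle=\langle u,T(-s)v\rangle$ ($u\in X^*,v\in X$), $T(s)Y\subset Y$ for all $s$, and $J$ and $T(s)$ commute. $E\in C^2(X,\mathbb R)$ satisfies $E(T(s)u)=E(u)$. There is a bounded operator $B:X\to X^*$ with $B^*=B$ which extends $J^{-1}T'(0)$; put $Q(u)=\frac12\langle Bu,u\rangle$, $u\in X$. **Equation.** The equation is $\frac{du}{dt}=\tilde JE'(u)$; a solution on an interval $I$ is $u\in C(I,X)\cap C^1(I,Y^* )$ satisfying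 it in $Y^*$ for all $t\in I$. **Bound states.** A bound state is a solution on $\mathbb R$ of the form $T(\omega t)\phi$, $\omega\in\mathbb R$, $\phi\in X$; equivalently $E'(\phi)-\omega Q'(\phi)=0$. It is *stable* if for all $\varepsilon>0$ there is $\delta>0$ such that whenever $\|u_0-\phi\|_X<\delta$ and $u$ is the local solution with $u(0)=u_0$, conserving $E$ and $Q$, whose existence is part of the Cauchy problem hypothesis in the claim, $u$ can be continued to a solution on $[0,\infty)$ and $\sup_{t>0}\inf_{s\in\mathbb R}\|u(t)-T(s)\phi\|_X<\varepsilon$; otherwise it is *unstable*. **The functions $S_\omega$ and $d$.** Put $S_\omega(u)=E(u)-\omega Q(u)$ and, for the family $\omega\mapsto\phi_\omega$ of the claim, $d(\omega)=S_\omega(\phi_\omega)$. Here $S_\omega''(\phi_\omega):X\to X^*$ is a bounded symmetric operator, and its eigenvalues and spectrum are understood via the Riesz isomorphism $X\to X^*$. **Notation.** $f(\lambda)\sim g(\lambda)$ means $0<\liminf_{|\lambda|\to0}f(\lambda)/g(\lambda)\le\limsup_{|\lambda|\to0}f(\lambda)/g(\lambda)<\infty$.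
   Formalization: "Only one simple negative eigenvalue" is taken to mean that the whole negative part of the spectrum is {-μ} with -μ simple (else the claim fails); in the definition of stable, local solutions are all conserving solutions on compact intervals [0,r], no uniqueness being assumed. *)

theory Defs
  imports "HOL-Analysis.Analysis"
begin

text \<open>The spaces \<open>X\<close>, \<open>Y\<close>, \<open>H\<close> are types \<open>'x\<close>, \<open>'y\<close>, \<open>'h\<close>; the inclusions of \<open>X\<close> and \<open>Y\<close> in \<open>H\<close> are
  injective bounded operators \<open>iX\<close>, \<open>iY\<close>. The dual of \<open>X\<close> is the type of bounded
  functionals \<open>'x \<Rightarrow>\<^sub>L real\<close>, and the duality pairing is application.\<close>


section \<open>Calculus\<close>

definition fderiv ::
  "('a::real_normed_vector \<Rightarrow> 'b::real_normed_vector) \<Rightarrow> 'a \<Rightarrow> 'a \<Rightarrow>\<^sub>L 'b"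
  where "fderiv f u = Blinfun (frechet_derivative f (at u))"

lemma fderiv_eqI:
  assumes "(f has_derivative blinfun_apply D) (at u)"
  shows "fderiv f u = D"
  unfolding fderiv_def frechet_derivative_at[OF assms, symmetric] by (rule blinfun_apply_inverse)

definition C2 :: "('a::real_normed_vector \<Rightarrow> 'b::real_normed_vector) \<Rightarrow> bool"
  where "C2 f \<longleftrightarrow>
    (\<forall>u. f differentiable (at u)) \<and>
    (\<forall>u. fderiv f differentiable (at u)) \<and>
    continuous_on UNIV (fderiv (fderiv f))"

definition vderiv :: "(real \<Rightarrow> 'a::real_normed_vector) \<Rightarrow> real \<Rightarrow> 'a"
  where "vderiv f = (\<lambda>t. vector_derivative f (at t))"

text \<open>The derivatives are two-sided, so this is meant for open \<open>S\<close>.\<close>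

definition Ck_curve_on :: "nat \<Rightarrow> real set \<Rightarrow> (real \<Rightarrow> 'a::real_normed_vector) \<Rightarrow> bool"
  where "Ck_curve_on k S f \<longleftrightarrow>
    (\<forall>j<k. \<forall>t\<in>S. (vderiv ^^ j) f differentiable (at t)) \<and>
    continuous_on S ((vderiv ^^ k) f)"

definition strictly_convex_on :: "'a::real_vector set \<Rightarrow> ('a \<Rightarrow> real) \<Rightarrow> bool"
  where "strictly_convex_on S f \<longleftrightarrow>
    convex S \<and>
    (\<forall>x\<in>S. \<forall>y\<in>S. \<forall>t. x \<noteq> y \<longrightarrow> 0 < t \<longrightarrow> t < 1 \<longrightarrow>
      f ((1 - t) *\<^sub>R x + t *\<^sub>R y) < (1 - t) * f x + t * f y)"

definition same_order_at_0 :: "(real \<Rightarrow> real) \<Rightarrow> (real \<Rightarrow> real) \<Rightarrow> bool"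
  where "same_order_at_0 f g \<longleftrightarrow>
    0 < Liminf (at 0) (\<lambda>l. ereal (f l / g l)) \<and>
    Liminf (at 0) (\<lambda>l. ereal (f l / g l)) \<le> Limsup (at 0) (\<lambda>l. ereal (f l / g l)) \<and>
    Limsup (at 0) (\<lambda>l. ereal (f l / g l)) < \<infinity>"


section \<open>Symmetric operators from a space to its dual\<close>

text \<open>The Riesz isomorphism is \<open>blinfun_inner_right\<close>. Writing \<open>L\<close> for the composition of its inverse
  with \<open>A\<close>, the following are the eigenspaces and the spectrum of \<open>L\<close>: the operator \<open>L - s\<close>
  has a bounded inverse iff \<open>A - s *\<^sub>R riesz\<close> has one.\<close>

definition riesz :: "'a::real_inner \<Rightarrow>\<^sub>L ('a \<Rightarrow>\<^sub>L real)"
  where "riesz = Blinfun blinfun_inner_right"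

lemma riesz_apply [simp]: "riesz u = blinfun_inner_right u"
  by (simp add: riesz_def bounded_linear_Blinfun_apply bounded_linear_blinfun_inner_right)

definition eigenspace :: "('a::real_inner \<Rightarrow>\<^sub>L ('a \<Rightarrow>\<^sub>L real)) \<Rightarrow> real \<Rightarrow> 'a set"
  where "eigenspace A s = {u. A u = s *\<^sub>R riesz u}"

definition spectrum :: "('a::real_inner \<Rightarrow>\<^sub>L ('a \<Rightarrow>\<^sub>L real)) \<Rightarrow> real set"
  where "spectrum A = {s. \<not> (\<exists>R :: ('a \<Rightarrow>\<^sub>L real) \<Rightarrow>\<^sub>L 'a.
    R o\<^sub>L (A - s *\<^sub>R riesz) = id_blinfun \<and> (A - s *\<^sub>R riesz) o\<^sub>L R = id_blinfun)}"


section \<open>Groups and their generators\<close>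

definition gen_dom :: "(real \<Rightarrow> 'x::real_normed_vector \<Rightarrow>\<^sub>L 'x) \<Rightarrow> 'x set"
  where "gen_dom T = {u. (\<lambda>s. T s u) differentiable (at 0)}"

definition gen :: "(real \<Rightarrow> 'x::real_normed_vector \<Rightarrow>\<^sub>L 'x) \<Rightarrow> 'x \<Rightarrow> 'x"
  where "gen T u = vector_derivative (\<lambda>s. T s u) (at 0)"

text \<open>\<open>gen_dom_pow T k\<close> is the domain of the \<open>k\<close>-th power of the generator.\<close>

primrec gen_dom_pow :: "(real \<Rightarrow> 'x::real_normed_vector \<Rightarrow>\<^sub>L 'x) \<Rightarrow> nat \<Rightarrow> 'x set"
  where
    "gen_dom_pow T 0 = UNIV"
  | "gen_dom_pow T (Suc k) = {u \<in> gen_dom T. gen T u \<in> gen_dom_pow T k}"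

definition unitary_group :: "(real \<Rightarrow> 'x::real_inner \<Rightarrow>\<^sub>L 'x) \<Rightarrow> bool"
  where "unitary_group T \<longleftrightarrow>
    T 0 = id_blinfun \<and>
    (\<forall>s t. T (s + t) = T s o\<^sub>L T t) \<and>
    (\<forall>s u v. T s u \<bullet> T s v = u \<bullet> v) \<and>
    (\<forall>u. continuous_on UNIV (\<lambda>s. T s u))"


section \<open>The Hamiltonian system\<close>

text \<open>The embedding of \<open>H\<close> in the dual of \<open>X\<close> (or \<open>Y\<close>) sends \<open>h\<close> to the functional \<open>v \<mapsto> h \<bullet> i v\<close>.\<close>

definition to_dual ::
  "('x::real_normed_vector \<Rightarrow>\<^sub>L 'h::real_inner) \<Rightarrow> 'h \<Rightarrow> 'x \<Rightarrow>\<^sub>L real"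
  where "to_dual i h = blinfun_inner_right h o\<^sub>L i"

definition T_dual ::
  "(real \<Rightarrow> 'x::real_normed_vector \<Rightarrow>\<^sub>L 'x) \<Rightarrow> real \<Rightarrow> ('x \<Rightarrow>\<^sub>L real) \<Rightarrow> 'x \<Rightarrow>\<^sub>L real"
  where "T_dual T s f = f o\<^sub>L T (- s)"

definition J_dual ::
  "('y::real_normed_vector \<Rightarrow>\<^sub>L 'x::real_normed_vector) \<Rightarrow> ('x \<Rightarrow>\<^sub>L real) \<Rightarrow> 'y \<Rightarrow>\<^sub>L real"
  where "J_dual JY f = - (f o\<^sub>L JY)"

text \<open>\<open>JX\<close> and \<open>JY\<close> are the restrictions of \<open>J\<close> to \<open>X\<close> and \<open>Y\<close>. Boundedness of \<open>J\<close> on \<open>H\<close> is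
  not assumed separately. The assumption \<open>T_extends\<close> says that \<open>T_dual\<close> is an extension of \<open>T\<close>,
  and \<open>J_T_commute\<close> is stated on the dense subspace \<open>X\<close>.\<close>

locale hamiltonian_system =
  fixes iX :: "'x::{real_inner,banach} \<Rightarrow>\<^sub>L 'h::{real_inner,banach}"
    and iY :: "'y::{real_inner,banach} \<Rightarrow>\<^sub>L 'h"
    and J :: "'h \<Rightarrow> 'h"
    and JX :: "'x \<Rightarrow>\<^sub>L 'y"
    and JY :: "'y \<Rightarrow>\<^sub>L 'x"
    and T :: "real \<Rightarrow> 'x \<Rightarrow>\<^sub>L 'x"
    and E :: "'x \<Rightarrow> real"
    and B :: "'x \<Rightarrow>\<^sub>L ('x \<Rightarrow>\<^sub>L real)"
  assumes inj_iX: "inj (blinfun_apply iX)"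
    and inj_iY: "inj (blinfun_apply iY)"
    and dense_iX: "closure (range (blinfun_apply iX)) = UNIV"
    and dense_iY: "closure (range (blinfun_apply iY)) = UNIV"
    and J_linear: "linear J"
    and J_skew: "J u \<bullet> v = - (u \<bullet> J v)"
    and JX_restricts: "iY (JX x) = J (iX x)"
    and JY_restricts: "iX (JY y) = J (iY y)"
    and bij_JX: "bij (blinfun_apply JX)"
    and bij_JY: "bij (blinfun_apply JY)"
    and T_unitary_group: "unitary_group T"
    and T_extends: "T_dual T s (to_dual iX (iX x)) = to_dual iX (iX (T s x))"
    and T_Y: "\<exists>y'. T_dual T s (to_dual iX (iY y)) = to_dual iX (iY y')"
    and J_T_commute: "to_dual iX (J (iX (T s x))) = T_dual T s (to_dual iX (J (iX x)))"
    and E_C2: "C2 E"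
    and E_invariant: "E (T s x) = E x"
    and B_symmetric: "B x x' = B x' x"
    and B_extends: "x \<in> gen_dom T \<Longrightarrow> B x = to_dual iX (iY (inv (blinfun_apply JY) (gen T x)))"

definition Q :: "('x::real_normed_vector \<Rightarrow>\<^sub>L ('x \<Rightarrow>\<^sub>L real)) \<Rightarrow> 'x \<Rightarrow> real"
  where "Q B u = B u u / 2"

definition S ::
  "('x::real_normed_vector \<Rightarrow> real) \<Rightarrow> ('x \<Rightarrow>\<^sub>L ('x \<Rightarrow>\<^sub>L real)) \<Rightarrow> real \<Rightarrow> 'x \<Rightarrow> real"
  where "S E B \<omega> u = E u - \<omega> * Q B u"

definition S'' ::
  "('x::real_normed_vector \<Rightarrow> real) \<Rightarrow> ('x \<Rightarrow>\<^sub>L ('x \<Rightarrow>\<^sub>L real)) \<Rightarrow> real \<Rightarrow> 'x \<Rightarrow>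
    'x \<Rightarrow>\<^sub>L ('x \<Rightarrow>\<^sub>L real)"
  where "S'' E B \<omega> = fderiv (fderiv (S E B \<omega>))"

text \<open>Membership in \<open>C(I, X) \<inter> C\<^sup>1(I, Y\<^sup>*)\<close>, with one-sided derivatives at endpoints of \<open>I\<close> lying in
  \<open>I\<close>, and the equation in the dual of \<open>Y\<close>.\<close>

definition is_solution ::
  "('x::real_normed_vector \<Rightarrow>\<^sub>L 'h::real_inner) \<Rightarrow> ('y::real_normed_vector \<Rightarrow>\<^sub>L 'h) \<Rightarrow>
    ('y \<Rightarrow>\<^sub>L 'x) \<Rightarrow> ('x \<Rightarrow> real) \<Rightarrow> real set \<Rightarrow> (real \<Rightarrow> 'x) \<Rightarrow> bool"
  where "is_solution iX iY JY E I u \<longleftrightarrow>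
    continuous_on I u \<and>
    (\<forall>t\<in>I. ((\<lambda>t. to_dual iY (iX (u t))) has_vector_derivative J_dual JY (fderiv E (u t)))
      (at t within I)) \<and>
    continuous_on I (\<lambda>t. J_dual JY (fderiv E (u t)))"

definition bound_state ::
  "('x::real_normed_vector \<Rightarrow>\<^sub>L 'h::real_inner) \<Rightarrow> ('y::real_normed_vector \<Rightarrow>\<^sub>L 'h) \<Rightarrow>
    ('y \<Rightarrow>\<^sub>L 'x) \<Rightarrow> (real \<Rightarrow> 'x \<Rightarrow>\<^sub>L 'x) \<Rightarrow> ('x \<Rightarrow> real) \<Rightarrow> real \<Rightarrow> 'x \<Rightarrow> bool"
  where "bound_state iX iY JY T E \<omega> \<phi> \<longleftrightarrow> is_solution iX iY JY E UNIV (\<lambda>t. T (\<omega> * t) \<phi>)"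

text \<open>Solutions of the Cauchy problem are not assumed to be unique, so stability is required of
  every local solution that conserves \<open>E\<close> and \<open>Q\<close>. Local solutions are taken on compact
  intervals: a solution on \<open>[0, r)\<close> need not have a limit in \<open>X\<close> at \<open>r\<close>, and without uniqueness it is
  only its restrictions to \<open>[0, r']\<close>, \<open>r' < r\<close>, that a local existence theory can continue.
  The supremum is taken in the extended reals, so that it is meaningful without a boundedness
  assumption.\<close>

definition bound_state_stable ::
  "('x::real_normed_vector \<Rightarrow>\<^sub>L 'h::real_inner) \<Rightarrow> ('y::real_normed_vector \<Rightarrow>\<^sub>L 'h) \<Rightarrow>
    ('y \<Rightarrow>\<^sub>L 'x) \<Rightarrow> (real \<Rightarrow> 'x \<Rightarrow>\<^sub>L 'x) \<Rightarrow> ('x \<Rightarrow> real) \<Rightarrow> ('x \<Rightarrow>\<^sub>L ('x \<Rightarrow>\<^sub>L real)) \<Rightarrow> 'x \<Rightarrow> bool"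
  where "bound_state_stable iX iY JY T E B \<phi> \<longleftrightarrow>
    (\<forall>\<epsilon>>0. \<exists>\<delta>>0. \<forall>u\<^sub>0. norm (u\<^sub>0 - \<phi>) < \<delta> \<longrightarrow>
      (\<forall>r>0. \<forall>u. is_solution iX iY JY E {0..r} u \<and> u 0 = u\<^sub>0 \<and>
          (\<forall>t\<in>{0..r}. E (u t) = E u\<^sub>0 \<and> Q B (u t) = Q B u\<^sub>0) \<longrightarrow>
        (\<exists>w. is_solution iX iY JY E {0..} w \<and> (\<forall>t\<in>{0..r}. w t = u t) \<and>
          (SUP t\<in>{0<..}. ereal (INF s. norm (w t - T s \<phi>))) < ereal \<epsilon>)))"

end

theory Submission
  imports Defs
begin

text \<open>Write \<open>\<tau>\<close> for the generator applied to \<open>\<phi> \<omega>\<close>, \<open>\<xi>\<close> for the derivative of \<open>\<phi>\<close> at \<open>\<omega>\<close> and \<open>A\<close> for the second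
  derivative of the action at \<open>\<phi> \<omega>\<close>. Differentiating \<open>E' = \<nu> B\<close> along the family gives \<open>A \<xi> = B (\<phi> \<omega>)\<close>, and
  \<open>A \<xi> \<xi> = - d''(\<omega>) \<le> 0\<close>. As \<open>A\<close> has one negative direction, it is coercive on the vectors \<open>r\<close> with
  \<open>A \<xi> r = 0\<close> that are orthogonal to \<open>\<tau>\<close> and, if \<open>d''(\<omega>) = 0\<close>, also to \<open>\<xi>\<close>.

  A state \<open>v\<close> near the orbit is written, after a shift along the group, as \<open>\<phi> (\<omega> + \<theta>) + r\<close> with \<open>r\<close>
  orthogonal to these vectors; \<open>\<theta> = 0\<close> if \<open>d''(\<omega>) > 0\<close>. With \<open>D = d (\<omega> + \<theta>) - d \<omega> - \<theta> d'(\<omega>)\<close> and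
  \<open>g = d'(\<omega> + \<theta>) - d'(\<omega>)\<close>, a Taylor expansion of the action at \<open>\<phi> (\<omega> + \<theta>)\<close> gives
  \<open>D + c |r|\<^sup>2 \<le> K (\<eta> + g\<^sup>2)\<close>, where \<open>\<eta>\<close> bounds the deviation of \<open>E\<close> and \<open>Q\<close> from their values at \<open>\<phi> \<omega>\<close>. In
  the degenerate case \<open>g = o(\<theta>)\<close>, so the hypothesis on \<open>d\<close> yields \<open>g\<^sup>2 = o(\<theta> g) = o(D)\<close>, and \<open>g\<^sup>2\<close> is absorbed.
  Since \<open>D > 0\<close> off \<open>\<theta> = 0\<close> by strict convexity, small \<open>\<eta>\<close> forces \<open>v\<close> to be close to the orbit.
  This traps conservative solutions, which can then be continued by steps of uniform length.\<close>

text \<open>The differential of the charge \<open>Q\<close> at \<open>\<phi> \<omega>\<close> is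
  \<open>A \<xi>\<close>, and conservation of charge is meant to remove the one negative direction.
  The obstacle is that for \<open>A \<xi> \<xi> = 0\<close> the vector \<open>\<xi>\<close> itself
  satisfies this linear constraint and the form vanishes on it, so no second-order argument at
  \<open>\<phi> \<omega>\<close> bounds the motion along the family. That motion is therefore made a
  parameter, and the strict minimum of \<open>D\<close> at 0 bounds it. The price is that
  \<open>\<phi> (\<omega> + \<theta>)\<close> has a charge different from that of
  \<open>\<phi> \<omega>\<close>, so the constraint on \<open>r\<close> holds only up to
  \<open>g\<close>; this is where its square comes from. Coercivity is drawn from the gaps of the
  spectrum by variational arguments: gradient descent for a nonnegative form takes the place of the
  spectral theorem. Invariance of \<open>Q\<close> under the group is not among the hypotheses and
  is derived from the commutation of \<open>J\<close> with the group. Solutions may fail to be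
  unique, so the continuation carries the conservation laws from step to step.\<close>

section \<open>Quadratic forms of symmetric operators\<close>

text \<open>Least squares: \<open>q\<close> is bounded below, the parallelogram identity makes a
  minimising sequence Cauchy, and its limit represents \<open>f\<close>, since a mismatch in any
  direction would let \<open>q\<close> decrease further.\<close>

lemma riesz_representation:
  fixes f :: "'a::{real_inner,banach} \<Rightarrow>\<^sub>L real"
  obtains z where "\<And>x. f x = z \<bullet> x"
proof -
  define q where "q x = x \<bullet> x - 2 * f x" for x
  have q_lower: "- ((norm f)\<^sup>2) \<le> q x" for x
  proof -
    have "f x \<le> norm f * norm x"
      using norm_blinfun[of f x] by simp
    moreover have "0 \<le> (norm x - norm f)\<^sup>2"
      by simp
    ultimately show ?thesis
      unfolding q_def power2_norm_eq_inner[symmetric] power2_diff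
      by (simp add: mult.commute[of "norm x"] mult.assoc)
  qed
  define m where "m = Inf (range q)"
  have bdd: "bdd_below (range q)"
    using q_lower by (intro bdd_belowI[of _ "- (norm f)\<^sup>2"]) auto
  have m_le: "m \<le> q x" for x
    unfolding m_def by (rule cInf_lower) (auto simp: bdd)
  have "\<exists>x. q x < m + inverse (real (Suc n))" for n
    using cInf_lessD[of "range q" "m + inverse (real (Suc n))"] by (auto simp: m_def)
  then obtain x where x: "\<And>n. q (x n) < m + inverse (real (Suc n))"
    by metis
  have parallelogram: "(norm (u - v))\<^sup>2 = 2 * q u + 2 * q v - 4 * q ((1/2) *\<^sub>R (u + v))" for u v
    by (simp add: q_def power2_norm_eq_inner blinfun.bilinear_simps inner_simps inner_commute algebra_simps)
  have dist_x: "(norm (x i - x j))\<^sup>2 \<le> 2 * inverse (real (Suc i)) + 2 * inverse (real (Suc j))" for i j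
    using parallelogram[of "x i" "x j"] x[of i] x[of j] m_le[of "(1/2) *\<^sub>R (x i + x j)"] by linarith
  have "Cauchy x"
  proof (rule CauchyI)
    fix e :: real assume e: "0 < e"
    obtain n where n: "inverse (real (Suc n)) < e\<^sup>2 / 4"
      using reals_Archimedean[of "e\<^sup>2 / 4"] e by auto
    have "norm (x i - x j) < e" if "n \<le> i" "n \<le> j" for i j
    proof -
      have "inverse (real (Suc i)) \<le> inverse (real (Suc n))" "inverse (real (Suc j)) \<le> inverse (real (Suc n))"
        using that by (auto intro!: le_imp_inverse_le)
      with dist_x[of i j] n have "(norm (x i - x j))\<^sup>2 < e\<^sup>2"
        by linarith
      then show ?thesis
        using e by (meson less_imp_le power2_less_imp_less)
    qed
    then show "\<exists>M. \<forall>i\<ge>M. \<forall>j\<ge>M. norm (x i - x j) < e"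
      by blast
  qed
  then obtain z where z: "x \<longlonglongrightarrow> z"
    using Cauchy_convergent convergent_def by blast
  have "(\<lambda>n. q (x n)) \<longlonglongrightarrow> q z"
    unfolding q_def by (intro tendsto_intros z)
  moreover have "(\<lambda>n. m + inverse (real (Suc n))) \<longlonglongrightarrow> m + 0"
    by (intro tendsto_intros LIMSEQ_inverse_real_of_nat)
  ultimately have "q z \<le> m + 0"
    by (rule LIMSEQ_le) (use x less_imp_le in blast)
  then have min: "q z \<le> q v" for v
    using m_le[of v] by simp
  have "f v = z \<bullet> v" for v
  proof (rule ccontr)
    assume "f v \<noteq> z \<bullet> v"
    define b where "b = f v - z \<bullet> v"
    have "b \<noteq> 0" "v \<noteq> 0"
      using \<open>f v \<noteq> z \<bullet> v\<close> by (auto simp: b_def)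
    then have vv: "v \<bullet> v > 0" by simp
    \<comment> \<open>\<open>b / (v \<bullet> v)\<close> minimises
      \<open>q (z + t *\<^sub>R v)\<close> over \<open>t\<close>.\<close>
    have "q (z + (b / (v \<bullet> v)) *\<^sub>R v) = q z - b\<^sup>2 / (v \<bullet> v)"
      using vv by (simp add: q_def b_def blinfun.bilinear_simps inner_simps inner_commute
          power2_eq_square field_simps)
    with min[of "z + (b / (v \<bullet> v)) *\<^sub>R v"] have "b\<^sup>2 / (v \<bullet> v) \<le> 0"
      by simp
    moreover have "b\<^sup>2 / (v \<bullet> v) > 0"
      using vv \<open>b \<noteq> 0\<close> by simp
    ultimately show False by simp
  qed
  then show thesis by (rule that)
qed

text \<open>The operator stays on the whole space and only its form is restricted to
  \<open>Z\<close>: resolvent bounds are known on the whole space and apply to vectors of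
  \<open>Z\<close> directly, without a type for the subspace.\<close>

locale symmetric_on =
  fixes N :: "'a::{real_inner,banach} \<Rightarrow>\<^sub>L 'a" and Z :: "'a set"
  assumes symmetric: "N x \<bullet> y = x \<bullet> N y"
    and subspace_Z: "subspace Z"
    and invariant: "x \<in> Z \<Longrightarrow> N x \<in> Z"
begin

lemma symmetric_on_shift: "symmetric_on (N - s *\<^sub>R id_blinfun) Z"
  by unfold_locales
    (auto simp: blinfun.bilinear_simps inner_simps symmetric subspace_Z invariant
      intro!: subspace_diff[OF subspace_Z] subspace_scale[OF subspace_Z])

lemma symmetric_on_square: "symmetric_on (N o\<^sub>L N) Z"
  by unfold_locales (auto simp: symmetric subspace_Z invariant)

text \<open>A gradient step for the form \<open>N x \<bullet> x\<close>. As the form is still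
  nonnegative at the new point, the decrease cannot exceed the initial value, which is the second
  claim.\<close>

lemma descent:
  assumes nonneg: "\<And>x. x \<in> Z \<Longrightarrow> 0 \<le> N x \<bullet> x"
    and K: "0 < K" "norm N \<le> K"
    and x: "x \<in> Z"
  shows "N (x - (1 / K) *\<^sub>R N x) \<bullet> (x - (1 / K) *\<^sub>R N x) \<le> N x \<bullet> x - (norm (N x))\<^sup>2 / K"
    and "(norm (N x))\<^sup>2 \<le> K * (N x \<bullet> x)"
proof -
  let ?y = "x - (1 / K) *\<^sub>R N x"
  have y: "?y \<in> Z"
    using x by (intro subspace_diff[OF subspace_Z] subspace_scale[OF subspace_Z] invariant)
  have "N (N x) \<bullet> N x \<le> norm (N (N x)) * norm (N x)"
    by (rule norm_cauchy_schwarz)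
  also have "\<dots> \<le> (K * norm (N x)) * norm (N x)"
    using norm_blinfun[of N "N x"] K
    by (intro mult_right_mono order_trans[OF norm_blinfun] mult_right_mono) auto
  finally have NN: "N (N x) \<bullet> N x \<le> K * (norm (N x))\<^sup>2"
    by (simp add: power2_eq_square mult.assoc)
  have "N ?y \<bullet> ?y = N x \<bullet> x - 2 / K * (norm (N x))\<^sup>2 + (1 / K)\<^sup>2 * (N (N x) \<bullet> N x)"
    using symmetric[of "N x" x]
    unfolding power2_norm_eq_inner
    by (simp add: blinfun.bilinear_simps inner_simps inner_commute power2_eq_square algebra_simps)
  also have "\<dots> \<le> N x \<bullet> x - 2 / K * (norm (N x))\<^sup>2 + (1 / K)\<^sup>2 * (K * (norm (N x))\<^sup>2)"
    using NN by (intro add_left_mono mult_left_mono) auto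
  also have "\<dots> = N x \<bullet> x - (norm (N x))\<^sup>2 / K"
    using K by (simp add: power2_eq_square field_simps)
  finally show *: "N ?y \<bullet> ?y \<le> N x \<bullet> x - (norm (N x))\<^sup>2 / K" .
  with nonneg[OF y] have "(norm (N x))\<^sup>2 / K \<le> N x \<bullet> x"
    by linarith
  then show "(norm (N x))\<^sup>2 \<le> K * (N x \<bullet> x)"
    using K by (simp add: field_simps)
qed

text \<open>The form of \<open>N - m\<close> is nonnegative on \<open>Z\<close>, so the second claim
  of \<open>descent\<close> bounds the square of the residual by a multiple of the excess
  \<open>N x \<bullet> x - m\<close>.\<close>

lemma approximate_eigenvector:
  assumes lower: "\<And>x. x \<in> Z \<Longrightarrow> m * (norm x)\<^sup>2 \<le> N x \<bullet> x"
    and sharp: "\<And>e. 0 < e \<Longrightarrow> \<exists>x\<in>Z. norm x = 1 \<and> N x \<bullet> x < m + e"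
    and e: "0 < e"
  shows "\<exists>x\<in>Z. norm x = 1 \<and> norm (N x - m *\<^sub>R x) < e"
proof -
  interpret M: symmetric_on "N - m *\<^sub>R id_blinfun" Z
    by (rule symmetric_on_shift)
  define K where "K = norm (N - m *\<^sub>R id_blinfun) + 1"
  have K: "0 < K" "norm (N - m *\<^sub>R id_blinfun) \<le> K"
    by (auto simp: K_def add_nonneg_pos)
  obtain x where x: "x \<in> Z" "norm x = 1" "N x \<bullet> x < m + e\<^sup>2 / K"
    using sharp[of "e\<^sup>2 / K"] e K by auto
  have "(norm (N x - m *\<^sub>R x))\<^sup>2 \<le> K * (N x \<bullet> x - m)"
    using M.descent(2)[OF _ K x(1)] lower x(2)
    by (simp add: blinfun.bilinear_simps inner_simps power2_norm_eq_inner[symmetric])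
  also have "\<dots> < K * (e\<^sup>2 / K)"
    using x(3) K by (intro mult_strict_left_mono) auto
  finally have "(norm (N x - m *\<^sub>R x))\<^sup>2 < e\<^sup>2"
    using K by simp
  then have "norm (N x - m *\<^sub>R x) < e"
    using e by (meson less_imp_le power2_less_imp_less)
  with x show ?thesis by blast
qed

text \<open>The vector \<open>x\<close> ensures both that \<open>Z\<close> has a unit vector and
  that the infimum is below \<open>a\<close>.\<close>

lemma infimum_on_sphere:
  assumes lower: "\<And>x. x \<in> Z \<Longrightarrow> k * (norm x)\<^sup>2 \<le> N x \<bullet> x"
    and x: "x \<in> Z" "N x \<bullet> x < a * (norm x)\<^sup>2"
  obtains m where "k \<le> m" "m < a" "\<And>x. x \<in> Z \<Longrightarrow> m * (norm x)\<^sup>2 \<le> N x \<bullet> x"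
    "\<And>e. 0 < e \<Longrightarrow> \<exists>x\<in>Z. norm x = 1 \<and> N x \<bullet> x < m + e"
proof -
  let ?U = "{x\<in>Z. norm x = 1}"
  let ?f = "\<lambda>x. N x \<bullet> x"
  define m where "m = Inf (?f ` ?U)"
  have x0: "x \<noteq> 0" using x by auto
  have norm_sgn: "sgn y \<in> ?U" "?f (sgn y) = ?f y / (norm y)\<^sup>2" if "y \<in> Z" "y \<noteq> 0" for y
    using that subspace_scale[OF subspace_Z, of y]
    by (auto simp: sgn_div_norm blinfun.bilinear_simps power2_eq_square field_simps)
  have bdd: "bdd_below (?f ` ?U)"
    using lower by (intro bdd_belowI[of _ k]) force
  have nonempty: "?f ` ?U \<noteq> {}"
    using norm_sgn[OF x(1) x0] by blast
  have m_le: "m \<le> ?f y" if "y \<in> ?U" for y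
    unfolding m_def using that by (intro cInf_lower bdd) auto
  show thesis
  proof
    show "k \<le> m"
      unfolding m_def using lower by (intro cInf_greatest nonempty) force
    show "m < a"
      using m_le[OF norm_sgn(1)[OF x(1) x0]] norm_sgn(2)[OF x(1) x0] x(2) x0
      by (smt (verit) divide_less_eq zero_less_norm_iff zero_less_power)
    show "m * (norm y)\<^sup>2 \<le> N y \<bullet> y" if "y \<in> Z" for y
    proof (cases "y = 0")
      case False
      then show ?thesis
        using m_le[OF norm_sgn(1)[OF that False]] norm_sgn(2)[OF that False]
        by (simp add: field_simps)
    qed simp
    show "\<exists>x\<in>Z. norm x = 1 \<and> N x \<bullet> x < m + e" if "0 < e" for e
      using cInf_lessD[OF nonempty, of "m + e"] that by (auto simp: m_def)
  qed
qed

text \<open>The minimum of \<open>(N - e/2)\<^sup>2\<close> on the unit sphere is an approximate eigenvalue; if it were less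
  than \<open>(e/2)\<^sup>2\<close>, factoring would give an approximate eigenvalue of \<open>N\<close> in the gap.\<close>

lemma gap_gradient_bound:
  assumes e0: "0 < e"
    and gap: "\<And>s. 0 < s \<Longrightarrow> s < e \<Longrightarrow> \<exists>c>0. \<forall>x. c * norm x \<le> norm (N x - s *\<^sub>R x)"
    and x: "x \<in> Z"
  shows "e * (N x \<bullet> x) \<le> (norm (N x))\<^sup>2"
proof (rule ccontr)
  assume contr: "\<not> ?thesis"
  define a where "a = e / 2"
  define M where "M = N - a *\<^sub>R id_blinfun"
  have M: "M y = N y - a *\<^sub>R y" for y
    by (simp add: M_def blinfun.bilinear_simps)
  interpret M: symmetric_on M Z
    unfolding M_def by (rule symmetric_on_shift)
  interpret M2: symmetric_on "M o\<^sub>L M" Z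
    by (rule M.symmetric_on_square)
  have form: "(M o\<^sub>L M) y \<bullet> y = (norm (M y))\<^sup>2" for y
    using M.symmetric[of "M y" y] by (simp add: power2_norm_eq_inner)
  have "(norm (M x))\<^sup>2 = (norm (N x))\<^sup>2 - e * (N x \<bullet> x) + a\<^sup>2 * (norm x)\<^sup>2"
    unfolding power2_norm_eq_inner
    by (simp add: M inner_simps inner_commute a_def power2_eq_square field_simps)
  with contr have "(M o\<^sub>L M) x \<bullet> x < a\<^sup>2 * (norm x)\<^sup>2"
    unfolding form by simp
  moreover have "0 * (norm y)\<^sup>2 \<le> (M o\<^sub>L M) y \<bullet> y" for y
    unfolding form by simp
  ultimately obtain m where m: "0 \<le> m" "m < a\<^sup>2"
    "\<And>x. x \<in> Z \<Longrightarrow> m * (norm x)\<^sup>2 \<le> (M o\<^sub>L M) x \<bullet> x"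
    "\<And>e. 0 < e \<Longrightarrow> \<exists>x\<in>Z. norm x = 1 \<and> (M o\<^sub>L M) x \<bullet> x < m + e"
    using M2.infimum_on_sphere x by blast
  define k where "k = sqrt m"
  have k: "0 \<le> k" "k\<^sup>2 = m"
    using m(1) by (auto simp: k_def)
  have "k < a"
    using m(2) e0 unfolding k(2)[symmetric] by (elim power2_less_imp_less) (simp add: a_def)
  then have gaps: "0 < a - k" "a - k < e" "0 < a + k" "a + k < e"
    using k(1) e0 unfolding a_def by linarith+
  obtain c1 where c1: "0 < c1" "\<And>y. c1 * norm y \<le> norm (N y - (a - k) *\<^sub>R y)"
    using gap[OF gaps(1,2)] by blast
  obtain c2 where c2: "0 < c2" "\<And>y. c2 * norm y \<le> norm (N y - (a + k) *\<^sub>R y)"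
    using gap[OF gaps(3,4)] by blast
  obtain y where y: "y \<in> Z" "norm y = 1" "norm ((M o\<^sub>L M) y - m *\<^sub>R y) < c1 * c2"
    using M2.approximate_eigenvector[OF m(3,4) mult_pos_pos[OF c1(1) c2(1)]] by blast
  \<comment> \<open>As \<open>M\<close> is \<open>N - a\<close> and \<open>m\<close> is the square
    of \<open>k\<close>, \<open>M o\<^sub>L M - m\<close> factors into \<open>N\<close> shifted by
    \<open>a + k\<close> and by \<open>a - k\<close>. Both shifts lie in the gap, so the product is
    bounded below by \<open>c1 * c2\<close>.\<close>
  define w where "w = N y - (a + k) *\<^sub>R y"
  have "(M o\<^sub>L M) y - m *\<^sub>R y = N w - (a - k) *\<^sub>R w"
    by (simp add: M w_def blinfun.bilinear_simps algebra_simps flip: k(2))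
      (simp add: power2_eq_square)
  moreover have "c2 \<le> norm w"
    using c2(2)[of y] y(2) by (simp add: w_def)
  then have "c1 * c2 \<le> norm (N w - (a - k) *\<^sub>R w)"
    using c1 by (meson order_trans less_imp_le mult_left_mono)
  ultimately show False
    using y(3) by simp
qed

text \<open>Iterate gradient steps from \<open>x\<close>. By \<open>descent\<close> and
  \<open>gap_gradient_bound\<close> the form decays geometrically, so the path has length at most a
  constant times the root of \<open>N x \<bullet> x\<close>. Its limit is annihilated by
  \<open>N\<close>, hence 0, and \<open>norm x\<close> is at most the length of the path.\<close>

lemma bounded_below_of_gap:
  assumes Z: "closed Z" and e0: "0 < e"
    and nonneg: "\<And>x. x \<in> Z \<Longrightarrow> 0 \<le> N x \<bullet> x"
    and gap: "\<And>s. 0 < s \<Longrightarrow> s < e \<Longrightarrow> \<exists>c>0. \<forall>x. c * norm x \<le> norm (N x - s *\<^sub>R x)"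
    and no_kernel: "\<And>x. x \<in> Z \<Longrightarrow> N x = 0 \<Longrightarrow> x = 0"
  shows "\<exists>c>0. \<forall>x\<in>Z. c * (norm x)\<^sup>2 \<le> N x \<bullet> x"
proof -
  \<comment> \<open>The summand \<open>e\<close> gives \<open>e \<le> K\<close>, so that the
    contraction factor \<open>1 - e / K\<close> is nonnegative.\<close>
  define K where "K = norm N + e"
  have K: "0 < K" "norm N \<le> K" "e \<le> K"
    using e0 by (auto simp: K_def add_nonneg_pos)
  define q where "q = 1 - e / K"
  have q: "0 \<le> q" "q < 1"
    using K e0 by (auto simp: q_def)
  have sq: "0 \<le> sqrt q" "sqrt q < 1"
    using q by auto
  define step where "step y = y - (1 / K) *\<^sub>R N y" for y
  have bound: "K * (1 - sqrt q)\<^sup>2 * (norm x)\<^sup>2 \<le> N x \<bullet> x" if x: "x \<in> Z" for x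
  proof -
    define it where "it n = (step ^^ n) x" for n
    define r where "r = sqrt (N x \<bullet> x / K)"
    have it_Suc: "it (Suc n) = it n - (1 / K) *\<^sub>R N (it n)" for n
      by (simp add: it_def step_def)
    have it_Z: "it n \<in> Z" for n
      by (induction n)
        (auto simp: it_Suc intro!: subspace_diff[OF subspace_Z] subspace_scale[OF subspace_Z] invariant,
          simp add: it_def x)
    have decay: "N (it n) \<bullet> it n \<le> q ^ n * (N x \<bullet> x)" for n
    proof (induction n)
      case 0
      show ?case by (simp add: it_def)
    next
      case (Suc n)
      have "N (it (Suc n)) \<bullet> it (Suc n) \<le> N (it n) \<bullet> it n - (norm (N (it n)))\<^sup>2 / K"
        unfolding it_Suc by (rule descent(1)[OF nonneg K(1,2) it_Z])
      also have "\<dots> \<le> N (it n) \<bullet> it n - e * (N (it n) \<bullet> it n) / K"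
        using gap_gradient_bound[OF e0 gap it_Z] K(1) by (simp add: divide_right_mono)
      also have "\<dots> = q * (N (it n) \<bullet> it n)"
        by (simp add: q_def algebra_simps)
      also have "\<dots> \<le> q * (q ^ n * (N x \<bullet> x))"
        using Suc q by (intro mult_left_mono) auto
      finally show ?case by simp
    qed
    have step_norm: "norm (it (Suc n) - it n) \<le> r * sqrt q ^ n" for n
    proof -
      have "(norm (it (Suc n) - it n))\<^sup>2 = (norm (N (it n)))\<^sup>2 / K\<^sup>2"
        using K by (simp add: it_Suc power_divide)
      also have "\<dots> \<le> K * (q ^ n * (N x \<bullet> x)) / K\<^sup>2"
        using descent(2)[OF nonneg K(1,2) it_Z[of n]] decay[of n] K
        by (intro divide_right_mono order_trans[OF _ mult_left_mono[OF decay]]) auto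
      also have "\<dots> = q ^ n * (N x \<bullet> x / K)"
        using K by (simp add: power2_eq_square)
      finally have "norm (it (Suc n) - it n) \<le> sqrt (q ^ n * (N x \<bullet> x / K))"
        by (rule real_le_rsqrt)
      also have "\<dots> = r * sqrt q ^ n"
        by (simp only: r_def real_sqrt_mult real_sqrt_power mult.commute)
      finally show ?thesis .
    qed
    have geometric: "(\<lambda>n. r * sqrt q ^ n) sums (r * (1 / (1 - sqrt q)))"
      using sq by (intro sums_mult geometric_sums) auto
    have "summable (\<lambda>n. norm (it (Suc n) - it n))"
      by (rule summable_comparison_test'[OF sums_summable[OF geometric], of 0]) (use step_norm in auto)
    then have summable: "summable (\<lambda>n. it (Suc n) - it n)"
      by (rule summable_norm_cancel)
    define y where "y = x + (\<Sum>n. it (Suc n) - it n)"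
    have "(\<lambda>n. x + (\<Sum>i<n. it (Suc i) - it i)) \<longlonglongrightarrow> y"
      unfolding y_def by (intro tendsto_intros summable_LIMSEQ summable)
    moreover have "x + (\<Sum>i<n. it (Suc i) - it i) = it n" for n
      by (simp add: sum_lessThan_telescope) (simp add: it_def)
    ultimately have lim: "it \<longlonglongrightarrow> y"
      by simp
    have y: "y \<in> Z"
      using closed_sequentially[OF Z] it_Z lim by blast
    have "(\<lambda>n. N (it n) \<bullet> it n) \<longlonglongrightarrow> N y \<bullet> y"
      by (intro tendsto_intros lim)
    moreover have "(\<lambda>n. q ^ n * (N x \<bullet> x)) \<longlonglongrightarrow> 0 * (N x \<bullet> x)"
      using q by (intro tendsto_intros LIMSEQ_realpow_zero) auto
    ultimately have "N y \<bullet> y \<le> 0"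
      using LIMSEQ_le decay by fastforce
    with descent(2)[OF nonneg K(1,2) y] K(1) have "(norm (N y))\<^sup>2 \<le> 0"
      by (meson mult_nonneg_nonpos less_imp_le order_trans)
    then have "y = 0"
      using no_kernel[OF y] by simp
    then have "norm x = norm (\<Sum>n. it (Suc n) - it n)"
      unfolding y_def by (simp add: eq_neg_iff_add_eq_0[symmetric])
    also have "\<dots> \<le> (\<Sum>n. r * sqrt q ^ n)"
      by (rule norm_suminf_le[OF step_norm sums_summable[OF geometric]])
    also have "\<dots> = r / (1 - sqrt q)"
      using sums_unique[OF geometric] by simp
    finally have "norm x * (1 - sqrt q) \<le> r"
      using sq by (simp add: field_simps)
    then have "(norm x * (1 - sqrt q))\<^sup>2 \<le> r\<^sup>2"
      using sq by (intro power_mono) auto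
    also have "r\<^sup>2 = N x \<bullet> x / K"
      using nonneg[OF x] K by (simp add: r_def)
    finally show ?thesis
      unfolding power_mult_distrib using K by (simp add: field_simps)
  qed
  then show ?thesis
    using K sq by (intro exI[of _ "K * (1 - sqrt q)\<^sup>2"]) auto
qed

text \<open>Without an eigenvector at \<open>a\<close>, \<open>bounded_below_of_gap\<close> for
  \<open>N - a\<close> lifts the bound strictly above \<open>a\<close>. If the infimum
  \<open>m\<close> were still below \<open>b\<close>, it would lie in the gap and yet have
  approximate eigenvectors.\<close>

lemma coercive_of_gap:
  assumes Z: "closed Z" and "a < b"
    and lower: "\<And>x. x \<in> Z \<Longrightarrow> a * (norm x)\<^sup>2 \<le> N x \<bullet> x"
    and gap: "\<And>s. a < s \<Longrightarrow> s < b \<Longrightarrow> \<exists>c>0. \<forall>x. c * norm x \<le> norm (N x - s *\<^sub>R x)"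
    and no_eigenvector: "\<And>x. x \<in> Z \<Longrightarrow> N x = a *\<^sub>R x \<Longrightarrow> x = 0"
    and x: "x \<in> Z"
  shows "b * (norm x)\<^sup>2 \<le> N x \<bullet> x"
proof (rule ccontr)
  assume contr: "\<not> ?thesis"
  define M where "M = N - a *\<^sub>R id_blinfun"
  interpret M: symmetric_on M Z
    unfolding M_def by (rule symmetric_on_shift)
  have M: "M y = N y - a *\<^sub>R y" "M y \<bullet> y = N y \<bullet> y - a * (norm y)\<^sup>2" for y
    by (simp_all add: M_def blinfun.bilinear_simps inner_simps power2_norm_eq_inner)
  have "\<exists>c>0. \<forall>y. c * norm y \<le> norm (M y - s *\<^sub>R y)" if "0 < s" "s < b - a" for s
    using gap[of "a + s"] that by (auto simp: M algebra_simps)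
  moreover have "0 \<le> M y \<bullet> y" if "y \<in> Z" for y
    using lower[OF that] by (simp add: M(2))
  moreover have "y = 0" if "y \<in> Z" "M y = 0" for y
    using no_eigenvector[OF that(1)] that(2) by (simp add: M(1))
  ultimately obtain c where c: "c > 0" "\<And>y. y \<in> Z \<Longrightarrow> c * (norm y)\<^sup>2 \<le> M y \<bullet> y"
    using M.bounded_below_of_gap[OF Z, of "b - a"] \<open>a < b\<close> by auto
  have "(c + a) * (norm y)\<^sup>2 \<le> N y \<bullet> y" if "y \<in> Z" for y
    using c(2)[OF that] by (simp add: M(2) algebra_simps)
  moreover have "N x \<bullet> x < b * (norm x)\<^sup>2"
    using contr by simp
  ultimately obtain m where m: "c + a \<le> m" "m < b" "\<And>x. x \<in> Z \<Longrightarrow> m * (norm x)\<^sup>2 \<le> N x \<bullet> x"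
    "\<And>e. 0 < e \<Longrightarrow> \<exists>x\<in>Z. norm x = 1 \<and> N x \<bullet> x < m + e"
    using infimum_on_sphere x by blast
  obtain k where k: "k > 0" "\<And>y. k * norm y \<le> norm (N y - m *\<^sub>R y)"
    using gap[of m] m c by auto
  obtain y where "norm y = 1" "norm (N y - m *\<^sub>R y) < k"
    using approximate_eigenvector[OF m(3,4) k(1)] by blast
  with k(2)[of y] show False by simp
qed

end

section \<open>From the spectral hypotheses to coercivity\<close>

lemma bounded_below_of_not_in_spectrum:
  assumes "s \<notin> spectrum A"
  shows "\<exists>c>0. \<forall>x. c * norm x \<le> norm (A x - s *\<^sub>R riesz x)"
proof -
  obtain R where R: "R o\<^sub>L (A - s *\<^sub>R riesz) = id_blinfun"
    using assms by (auto simp: spectrum_def)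
  have "norm x \<le> (norm R + 1) * norm (A x - s *\<^sub>R riesz x)" for x
  proof -
    have "x = R (A x - s *\<^sub>R riesz x)"
      using arg_cong[OF R, of "\<lambda>F. blinfun_apply F x"] by (simp add: blinfun.bilinear_simps)
    then have "norm x \<le> norm R * norm (A x - s *\<^sub>R riesz x)"
      by (metis norm_blinfun)
    also have "\<dots> \<le> (norm R + 1) * norm (A x - s *\<^sub>R riesz x)"
      by (intro mult_right_mono) auto
    finally show ?thesis .
  qed
  moreover have "norm R + 1 > 0"
    by (simp add: add_nonneg_pos)
  ultimately show ?thesis
    by (intro exI[of _ "1 / (norm R + 1)"]) (auto simp: field_simps)
qed

text \<open>On the vectors orthogonal to \<open>\<eta>\<close> and \<open>\<tau>\<close> the lower
  bound climbs over the gaps of the spectrum: from \<open>a\<close> to \<open>- \<mu>\<close>, then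
  to 0, then to \<open>c\<close>. Orthogonality to \<open>\<eta>\<close> excludes an eigenvector at
  \<open>- \<mu>\<close>, orthogonality to \<open>\<tau>\<close> one at 0.\<close>

lemma coercive_off_eigenvectors:
  fixes A :: "'a::{real_inner,banach} \<Rightarrow>\<^sub>L ('a \<Rightarrow>\<^sub>L real)"
  assumes sym: "\<And>x y. A x y = A y x"
    and kernel: "{u. A u = 0} = span {\<tau>}"
    and \<mu>: "0 < \<mu>" and negative: "spectrum A \<inter> {..<0} = {- \<mu>}"
    and eigenspace: "eigenspace A (- \<mu>) = span {\<eta>}"
    and positive: "0 < Inf (ereal ` {s. 0 < s \<and> s \<in> spectrum A})"
  shows "\<exists>c>0. \<forall>x. x \<bullet> \<eta> = 0 \<longrightarrow> x \<bullet> \<tau> = 0 \<longrightarrow> c * (norm x)\<^sup>2 \<le> A x x"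
proof -
  have "\<exists>l. \<forall>y. A x y = l \<bullet> y" for x
    using riesz_representation[of "A x"] by blast
  then obtain l where l: "\<And>x y. A x y = l x \<bullet> y"
    by metis
  have norm_l: "norm (l x) \<le> norm x * norm A" for x
  proof -
    have "(norm (l x))\<^sup>2 = A x (l x)"
      by (simp add: l power2_norm_eq_inner)
    also have "\<dots> \<le> norm (A x) * norm (l x)"
      using norm_blinfun[of "A x" "l x"] by simp
    also have "\<dots> \<le> norm x * norm A * norm (l x)"
      using norm_blinfun[of A x] by (intro mult_right_mono) (auto simp: mult.commute)
    finally show ?thesis
      by (cases "l x = 0") (auto simp: power2_eq_square)
  qed
  have "bounded_linear l"
  proof (rule bounded_linear_intro[where K = "norm A"])
    show "l (x + y) = l x + l y" for x y
      by (rule vector_eq_rdot[THEN iffD1])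
        (simp add: inner_add_left blinfun.bilinear_simps flip: l)
    show "l (r *\<^sub>R x) = r *\<^sub>R l x" for r x
      by (rule vector_eq_rdot[THEN iffD1])
        (simp add: blinfun.bilinear_simps flip: l)
  qed (rule norm_l)
  define L where "L = Blinfun l"
  have L: "A x y = L x \<bullet> y" for x y
    by (simp add: L_def l bounded_linear_Blinfun_apply \<open>bounded_linear l\<close>)
  have A_eq: "A x = s *\<^sub>R riesz x \<longleftrightarrow> L x = s *\<^sub>R x" for x s
  proof
    assume "A x = s *\<^sub>R riesz x"
    then have "L x \<bullet> y = (s *\<^sub>R x) \<bullet> y" for y
      unfolding L[symmetric] by (simp add: blinfun.bilinear_simps)
    then show "L x = s *\<^sub>R x"
      using vector_eq_rdot by blast
  qed (auto intro!: blinfun_eqI simp: L blinfun.bilinear_simps)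
  have resolvent: "\<exists>c>0. \<forall>x. c * norm x \<le> norm (L x - s *\<^sub>R x)" if s: "s \<notin> spectrum A" for s
  proof -
    have "norm (A x - s *\<^sub>R riesz x) \<le> norm (L x - s *\<^sub>R x)" for x
    proof (rule norm_blinfun_bound)
      fix y
      have "(A x - s *\<^sub>R riesz x) y = (L x - s *\<^sub>R x) \<bullet> y"
        by (simp add: L blinfun.bilinear_simps inner_simps)
      then show "norm ((A x - s *\<^sub>R riesz x) y) \<le> norm (L x - s *\<^sub>R x) * norm y"
        by (simp add: Cauchy_Schwarz_ineq2)
    qed simp
    then show ?thesis
      using bounded_below_of_not_in_spectrum[OF s] order_trans by blast
  qed
  define Z where "Z = {x. x \<bullet> \<eta> = 0 \<and> x \<bullet> \<tau> = 0}"
  have eig: "L x = - \<mu> *\<^sub>R x \<longleftrightarrow> x \<in> span {\<eta>}" "L x = 0 \<longleftrightarrow> x \<in> span {\<tau>}" for x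
    using eigenspace A_eq[of x "- \<mu>"] kernel A_eq[of x 0] by (auto simp: eigenspace_def)
  have L_sym: "L x \<bullet> y = x \<bullet> L y" for x y
    using sym[of x y] by (simp add: L inner_commute)
  interpret L: symmetric_on L Z
  proof
    have "L \<eta> = - \<mu> *\<^sub>R \<eta>" "L \<tau> = 0"
      using eig by (simp_all add: span_base)
    then show "L x \<in> Z" if "x \<in> Z" for x
      using that by (simp add: Z_def L_sym)
  qed (auto simp: L_sym Z_def subspace_def inner_simps)
  have closed_Z: "closed Z"
    unfolding Z_def by (intro closed_Collect_conj closed_Collect_eq continuous_intros)
  have orth: "x = 0" if "x \<in> span {v}" "x \<bullet> v = 0" for x v :: 'a
    using that by (auto simp: span_singleton)
  \<comment> \<open>The infimum is extended real, and infinite if there is no positive spectrum; any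
    real number strictly between 0 and it serves.\<close>
  obtain c where c: "0 < c" "\<And>s. 0 < s \<Longrightarrow> s < c \<Longrightarrow> s \<notin> spectrum A"
  proof -
    obtain c where c: "0 < c" "ereal c < Inf (ereal ` {s. 0 < s \<and> s \<in> spectrum A})"
      using ereal_dense2[OF positive] by auto
    have "s \<notin> spectrum A" if "0 < s" "s < c" for s
    proof
      assume "s \<in> spectrum A"
      then have "Inf (ereal ` {s. 0 < s \<and> s \<in> spectrum A}) \<le> ereal s"
        using that by (intro Inf_lower) auto
      with c(2) have "ereal c < ereal s"
        by (rule less_le_trans)
      with that show False by simp
    qed
    with c that show thesis by blast
  qed
  have not_spec: "s \<notin> spectrum A" if "s < 0" "s \<noteq> - \<mu>" for s
    using negative that by auto
  have form: "- norm L * (norm x)\<^sup>2 \<le> L x \<bullet> x" for x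
  proof -
    have "\<bar>L x \<bullet> x\<bar> \<le> norm (L x) * norm x"
      by (rule Cauchy_Schwarz_ineq2)
    also have "\<dots> \<le> norm L * norm x * norm x"
      by (intro mult_right_mono norm_blinfun) auto
    finally show ?thesis by (simp add: power2_eq_square mult.assoc)
  qed
  \<comment> \<open>A start below \<open>- norm L\<close>, so that the form is above
    \<open>a\<close> and \<open>a\<close> is no eigenvalue, and also below
    \<open>- \<mu>\<close>.\<close>
  define a where "a = - norm L - \<mu> - 1"
  have below: "- \<mu> * (norm x)\<^sup>2 \<le> L x \<bullet> x" if "x \<in> Z" for x
  proof (rule L.coercive_of_gap[OF closed_Z, of a])
    show "a < - \<mu>"
      using norm_ge_zero[of L] unfolding a_def by linarith
    show le: "a * (norm x)\<^sup>2 \<le> L x \<bullet> x" for x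
      by (rule order_trans[OF mult_right_mono form]) (use \<mu> in \<open>auto simp: a_def\<close>)
    show "\<exists>c>0. \<forall>x. c * norm x \<le> norm (L x - s *\<^sub>R x)" if "a < s" "s < - \<mu>" for s
      using that \<mu> by (intro resolvent not_spec) auto
    show "x = 0" if "L x = a *\<^sub>R x" for x
    proof (rule ccontr)
      assume "x \<noteq> 0"
      have "a * (norm x)\<^sup>2 = L x \<bullet> x"
        by (simp add: that power2_norm_eq_inner)
      with form[of x] have "(- norm L - a) * (norm x)\<^sup>2 \<le> 0"
        by (simp add: algebra_simps)
      moreover have "0 < (- norm L - a) * (norm x)\<^sup>2"
        using \<mu> \<open>x \<noteq> 0\<close> by (intro mult_pos_pos) (auto simp: a_def)
      ultimately show False by simp
    qed
  qed (rule that)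
  have middle: "0 * (norm x)\<^sup>2 \<le> L x \<bullet> x" if "x \<in> Z" for x
  proof (rule L.coercive_of_gap[OF closed_Z _ below _ _ that])
    show "\<exists>c>0. \<forall>x. c * norm x \<le> norm (L x - s *\<^sub>R x)" if "- \<mu> < s" "s < 0" for s
      using that by (intro resolvent not_spec) auto
    show "x = 0" if "x \<in> Z" "L x = - \<mu> *\<^sub>R x" for x
      using that eig(1) by (intro orth[of _ \<eta>]) (auto simp: Z_def)
  qed (use \<mu> in auto)
  have "c * (norm x)\<^sup>2 \<le> L x \<bullet> x" if "x \<in> Z" for x
  proof (rule L.coercive_of_gap[OF closed_Z _ middle _ _ that])
    show "\<exists>c>0. \<forall>x. c * norm x \<le> norm (L x - s *\<^sub>R x)" if "0 < s" "s < c" for s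
      using that by (intro resolvent c(2))
    show "x = 0" if "x \<in> Z" "L x = 0 *\<^sub>R x" for x
      using that eig(2) by (intro orth[of _ \<tau>]) (auto simp: Z_def)
  qed (use c in auto)
  then show ?thesis
    using c(1) unfolding Z_def L by blast
qed

text \<open>The charge constraint will hold only approximately, so coercivity on the kernel of
  \<open>f\<close> is traded for coercivity with a penalty. Split \<open>r\<close> into a kernel
  vector and \<open>f r\<close> times a fixed \<open>g\<close> with \<open>f g = 1\<close>; Young's
  inequality absorbs the cross terms.\<close>

lemma coercive_penalised:
  fixes A :: "'a::real_inner \<Rightarrow>\<^sub>L ('a \<Rightarrow>\<^sub>L real)" and f :: "'a \<Rightarrow>\<^sub>L real"
  assumes c: "0 < c" and coercive: "\<And>r. r \<in> V \<Longrightarrow> f r = 0 \<Longrightarrow> c * (norm r)\<^sup>2 \<le> A r r"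
    and V: "subspace V" and e: "e \<in> V" "f e \<noteq> 0"
  shows "\<exists>c>0. \<exists>C\<ge>0. \<forall>r\<in>V. c * (norm r)\<^sup>2 - C * (f r)\<^sup>2 \<le> A r r"
proof -
  define g where "g = (1 / f e) *\<^sub>R e"
  have g: "g \<in> V" "f g = 1"
    using e V by (auto simp: g_def subspace_scale blinfun.bilinear_simps)
  define M where "M = norm A * norm g"
  \<comment> \<open>The summands pay for passing from \<open>norm r0\<close> to
    \<open>norm r\<close>, for the cross terms, and for \<open>A g g\<close>.\<close>
  define C where "C = c / 2 * (norm g)\<^sup>2 + 2 / c * M\<^sup>2 + M * norm g"
  have AM: "\<bar>A x y\<bar> \<le> norm A * norm x * norm y" for x y
  proof -
    have "\<bar>A x y\<bar> \<le> norm (A x) * norm y"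
      using norm_blinfun[of "A x" y] by simp
    also have "\<dots> \<le> norm A * norm x * norm y"
      by (intro mult_right_mono norm_blinfun) auto
    finally show ?thesis .
  qed
  have "c / 4 * (norm r)\<^sup>2 - C * (f r)\<^sup>2 \<le> A r r" if r: "r \<in> V" for r
  proof -
    define t where "t = f r"
    define r0 where "r0 = r - t *\<^sub>R g"
    have r0: "r0 \<in> V" "f r0 = 0" "r = r0 + t *\<^sub>R g"
      using r g V by (auto simp: r0_def t_def subspace_diff subspace_scale blinfun.bilinear_simps)
    have "A r r = A r0 r0 + t * (A r0 g + A g r0) + t\<^sup>2 * A g g"
      by (simp add: r0(3) blinfun.bilinear_simps power2_eq_square algebra_simps)
    moreover have "\<bar>t * (A r0 g + A g r0)\<bar> \<le> \<bar>t\<bar> * (2 * (M * norm r0))"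
      unfolding abs_mult using AM[of r0 g] AM[of g r0]
      by (intro mult_left_mono) (auto simp: M_def ac_simps)
    moreover have "\<bar>t\<^sup>2 * A g g\<bar> \<le> t\<^sup>2 * (M * norm g)"
      unfolding abs_mult using mult_left_mono[OF AM[of g g], of "t\<^sup>2"] by (simp add: M_def ac_simps)
    moreover have "\<bar>t\<bar> * (2 * (M * norm r0)) \<le> c / 2 * (norm r0)\<^sup>2 + 2 / c * M\<^sup>2 * t\<^sup>2"
    proof -
      have "0 \<le> c / 2 * (norm r0 - 2 / c * M * \<bar>t\<bar>)\<^sup>2"
        using c by simp
      also have "\<dots> = c / 2 * (norm r0)\<^sup>2 - \<bar>t\<bar> * (2 * (M * norm r0)) + 2 / c * M\<^sup>2 * t\<^sup>2"
        using c by (simp add: power2_eq_square field_simps)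
      finally show ?thesis by simp
    qed
    moreover have "c / 2 * ((norm r)\<^sup>2 / 2 - t\<^sup>2 * (norm g)\<^sup>2) \<le> c / 2 * (norm r0)\<^sup>2"
    proof -
      have "norm r \<le> norm r0 + \<bar>t\<bar> * norm g"
        unfolding r0(3) using norm_triangle_ineq[of r0 "t *\<^sub>R g"] by simp
      then have "(norm r)\<^sup>2 \<le> (norm r0 + \<bar>t\<bar> * norm g)\<^sup>2"
        by (rule power_mono) simp
      also have "\<dots> \<le> 2 * (norm r0)\<^sup>2 + 2 * (\<bar>t\<bar> * norm g)\<^sup>2"
        using zero_le_power2[of "norm r0 - \<bar>t\<bar> * norm g"] by (simp add: power2_eq_square algebra_simps)
      finally have "(norm r)\<^sup>2 / 2 - t\<^sup>2 * (norm g)\<^sup>2 \<le> (norm r0)\<^sup>2"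
        by (simp add: power_mult_distrib)
      then show ?thesis
        using c by (intro mult_left_mono) auto
    qed
    moreover have "c * (norm r0)\<^sup>2 \<le> A r0 r0"
      using coercive[OF r0(1,2)] .
    ultimately show ?thesis
      unfolding t_def[symmetric] C_def by (simp add: algebra_simps)
  qed
  moreover have "0 \<le> C"
    using c by (simp add: C_def M_def)
  ultimately show ?thesis
    using c by (intro exI[of _ "c / 4"] conjI exI[of _ C]) auto
qed

section \<open>Coercivity under the charge constraint\<close>

lemma norm_le_norm_diff_orthogonal:
  fixes r :: "'a::real_inner"
  assumes "r \<bullet> y = 0"
  shows "norm r \<le> norm (r - y)"
proof -
  have "(norm (r - y))\<^sup>2 = (norm r)\<^sup>2 + (norm y)\<^sup>2"
    using assms by (simp add: power2_norm_eq_inner inner_simps inner_commute)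
  then show ?thesis
    by (metis le_add_same_cancel1 norm_ge_zero power2_le_imp_le zero_le_power2)
qed

text \<open>The constraint \<open>A \<xi> r = 0\<close> together with \<open>A \<xi> \<xi> \<le> 0\<close> replaces the negative eigenvector: subtracting
  the multiple of \<open>\<xi>\<close> that makes \<open>r\<close> orthogonal to \<open>\<eta>\<close> does not increase the form.\<close>

lemma coercive_modulo_constraint:
  fixes A :: "'a::{real_inner,banach} \<Rightarrow>\<^sub>L ('a \<Rightarrow>\<^sub>L real)"
  assumes sym: "\<And>x y. A x y = A y x"
    and coercive: "0 < c" "\<And>x. x \<bullet> \<eta> = 0 \<Longrightarrow> x \<bullet> \<tau> = 0 \<Longrightarrow> c * (norm x)\<^sup>2 \<le> A x x"
    and orth: "\<tau> \<bullet> \<eta> = 0" and \<tau>: "A \<tau> = 0" "\<tau> \<noteq> 0"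
    and \<xi>: "A \<xi> \<noteq> 0" "A \<xi> \<xi> \<le> 0"
    and r: "A \<xi> r = 0"
  shows "\<exists>k b. c * (norm (r - k *\<^sub>R \<xi> - b *\<^sub>R \<tau>))\<^sup>2 - k\<^sup>2 * A \<xi> \<xi> \<le> A r r"
proof -
  have A\<tau>: "A x \<tau> = 0" for x
    using sym[of x \<tau>] \<tau> by simp
  \<comment> \<open>Since \<open>A \<tau> = 0\<close>, subtracting a multiple of
    \<open>\<tau>\<close> leaves the form unchanged and achieves orthogonality to
    \<open>\<tau>\<close>.\<close>
  have coercive': "\<exists>b. c * (norm (x - b *\<^sub>R \<tau>))\<^sup>2 \<le> A x x" if "x \<bullet> \<eta> = 0" for x
  proof -
    define b where "b = (x \<bullet> \<tau>) / (\<tau> \<bullet> \<tau>)"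
    have "c * (norm (x - b *\<^sub>R \<tau>))\<^sup>2 \<le> A (x - b *\<^sub>R \<tau>) (x - b *\<^sub>R \<tau>)"
      using that orth \<tau>(2) by (intro coercive(2)) (auto simp: inner_simps b_def)
    also have "\<dots> = A x x"
      by (simp add: blinfun.bilinear_simps \<tau>(1) A\<tau>)
    finally show ?thesis by blast
  qed
  \<comment> \<open>Otherwise coercivity and \<open>A \<xi> \<xi> \<le> 0\<close> would make
    \<open>\<xi>\<close> a multiple of \<open>\<tau>\<close>, so that
    \<open>A \<xi> = 0\<close>.\<close>
  have "\<xi> \<bullet> \<eta> \<noteq> 0"
  proof
    assume "\<xi> \<bullet> \<eta> = 0"
    then obtain b where "c * (norm (\<xi> - b *\<^sub>R \<tau>))\<^sup>2 \<le> A \<xi> \<xi>"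
      using coercive' by blast
    with \<xi>(2) have "c * (norm (\<xi> - b *\<^sub>R \<tau>))\<^sup>2 \<le> 0"
      by linarith
    with coercive(1) have "\<xi> = b *\<^sub>R \<tau>"
      by (simp add: mult_le_0_iff)
    then show False
      using \<xi>(1) \<tau>(1) by (simp add: blinfun.bilinear_simps)
  qed
  define k where "k = (r \<bullet> \<eta>) / (\<xi> \<bullet> \<eta>)"
  have "(r - k *\<^sub>R \<xi>) \<bullet> \<eta> = 0"
    using \<open>\<xi> \<bullet> \<eta> \<noteq> 0\<close> by (simp add: inner_simps k_def)
  then obtain b where "c * (norm (r - k *\<^sub>R \<xi> - b *\<^sub>R \<tau>))\<^sup>2 \<le> A (r - k *\<^sub>R \<xi>) (r - k *\<^sub>R \<xi>)"
    using coercive' by blast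
  moreover have "A (r - k *\<^sub>R \<xi>) (r - k *\<^sub>R \<xi>) = A r r + k\<^sup>2 * A \<xi> \<xi>"
    using r sym[of r \<xi>] by (simp add: blinfun.bilinear_simps power2_eq_square algebra_simps)
  ultimately show ?thesis
    by (intro exI[of _ k] exI[of _ b]) linarith
qed

text \<open>With \<open>A \<xi> \<xi> = 0\<close> the constraint leaves \<open>\<xi>\<close> as a
  null direction, so orthogonality to \<open>\<xi>\<close> has to be imposed. Subtracting multiples
  of \<open>\<xi>\<close> and \<open>\<tau>\<close> from such an \<open>r\<close> can only lengthen
  it, which turns the bound of \<open>coercive_modulo_constraint\<close> into one on
  \<open>norm r\<close>.\<close>

lemma coercive_degenerate:
  fixes A :: "'a::{real_inner,banach} \<Rightarrow>\<^sub>L ('a \<Rightarrow>\<^sub>L real)"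
  assumes sym: "\<And>x y. A x y = A y x"
    and coercive: "0 < c" "\<And>x. x \<bullet> \<eta> = 0 \<Longrightarrow> x \<bullet> \<tau> = 0 \<Longrightarrow> c * (norm x)\<^sup>2 \<le> A x x"
    and orth: "\<tau> \<bullet> \<eta> = 0" and \<tau>: "A \<tau> = 0" "\<tau> \<noteq> 0"
    and \<xi>: "A \<xi> \<noteq> 0" "A \<xi> \<xi> = 0"
  shows "\<exists>c>0. \<exists>C\<ge>0. \<forall>r\<in>{r. r \<bullet> \<tau> = 0 \<and> r \<bullet> \<xi> = 0}. c * (norm r)\<^sup>2 - C * (A \<xi> r)\<^sup>2 \<le> A r r"
proof -
  have A\<tau>: "A x \<tau> = 0" for x
    using sym[of x \<tau>] \<tau> by simp
  define \<xi>' where "\<xi>' = \<xi> - ((\<xi> \<bullet> \<tau>) / (\<tau> \<bullet> \<tau>)) *\<^sub>R \<tau>"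
  have \<xi>': "\<xi>' \<bullet> \<tau> = 0" "\<xi> = \<xi>' + ((\<xi> \<bullet> \<tau>) / (\<tau> \<bullet> \<tau>)) *\<^sub>R \<tau>"
    using \<tau>(2) by (auto simp: \<xi>'_def inner_simps)
  have "\<xi>' \<noteq> 0"
    using \<xi>' \<xi>(1) \<tau>(1) by (metis add_0 blinfun.scaleR_right scaleR_zero_right)
  obtain x where x: "A \<xi> x \<noteq> 0"
    using \<xi>(1) by (metis blinfun_eqI blinfun.zero_left)
  \<comment> \<open>Gram-Schmidt: removing the parts along \<open>\<tau>\<close> and
    \<open>\<xi>'\<close> brings \<open>x\<close> into the subspace, and \<open>A \<xi>\<close>
    vanishes on both.\<close>
  define e where "e = x - ((x \<bullet> \<tau>) / (\<tau> \<bullet> \<tau>)) *\<^sub>R \<tau> - ((x \<bullet> \<xi>') / (\<xi>' \<bullet> \<xi>')) *\<^sub>R \<xi>'"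
  have e\<tau>: "e \<bullet> \<tau> = 0" "e \<bullet> \<xi>' = 0"
    using \<xi>'(1) \<tau>(2) \<open>\<xi>' \<noteq> 0\<close> by (auto simp: e_def inner_simps inner_commute[of \<tau> \<xi>'])
  then have e: "e \<in> {r. r \<bullet> \<tau> = 0 \<and> r \<bullet> \<xi> = 0}"
    by (subst \<xi>'(2)) (simp add: inner_simps)
  have "A \<xi> e \<noteq> 0"
    using x \<xi>(2) by (simp add: e_def \<xi>'_def blinfun.bilinear_simps A\<tau>)
  show ?thesis
  proof (rule coercive_penalised[OF coercive(1) _ _ e \<open>A \<xi> e \<noteq> 0\<close>])
    fix r assume r: "r \<in> {r. r \<bullet> \<tau> = 0 \<and> r \<bullet> \<xi> = 0}" "A \<xi> r = 0"
    obtain k b where kb: "c * (norm (r - k *\<^sub>R \<xi> - b *\<^sub>R \<tau>))\<^sup>2 - k\<^sup>2 * A \<xi> \<xi> \<le> A r r"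
      using coercive_modulo_constraint[OF sym coercive orth \<tau> \<xi>(1) _ r(2)] \<xi>(2) by auto
    have "norm r \<le> norm (r - k *\<^sub>R \<xi> - b *\<^sub>R \<tau>)"
      using norm_le_norm_diff_orthogonal[of r "k *\<^sub>R \<xi> + b *\<^sub>R \<tau>"] r(1)
      by (simp add: inner_simps diff_diff_eq)
    then have "c * (norm r)\<^sup>2 \<le> c * (norm (r - k *\<^sub>R \<xi> - b *\<^sub>R \<tau>))\<^sup>2"
      using coercive(1) by (intro mult_left_mono power_mono) auto
    with kb \<xi>(2) show "c * (norm r)\<^sup>2 \<le> A r r"
      by simp
  qed (auto simp: subspace_def inner_simps)
qed

text \<open>Here \<open>- A \<xi> \<xi>\<close> is positive, so the term with
  \<open>k\<^sup>2\<close> in \<open>coercive_modulo_constraint\<close> controls the component of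
  \<open>r\<close> along \<open>\<xi>\<close>, and orthogonality to \<open>\<tau>\<close>
  suffices.\<close>

lemma coercive_nondegenerate:
  fixes A :: "'a::{real_inner,banach} \<Rightarrow>\<^sub>L ('a \<Rightarrow>\<^sub>L real)"
  assumes sym: "\<And>x y. A x y = A y x"
    and coercive: "0 < c" "\<And>x. x \<bullet> \<eta> = 0 \<Longrightarrow> x \<bullet> \<tau> = 0 \<Longrightarrow> c * (norm x)\<^sup>2 \<le> A x x"
    and orth: "\<tau> \<bullet> \<eta> = 0" and \<tau>: "A \<tau> = 0" "\<tau> \<noteq> 0"
    and \<xi>: "A \<xi> \<xi> < 0"
  shows "\<exists>c>0. \<exists>C\<ge>0. \<forall>r\<in>{r. r \<bullet> \<tau> = 0}. c * (norm r)\<^sup>2 - C * (A \<xi> r)\<^sup>2 \<le> A r r"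
proof -
  have A\<tau>: "A x \<tau> = 0" for x
    using sym[of x \<tau>] \<tau> by simp
  define \<beta> where "\<beta> = (\<xi> \<bullet> \<tau>) / (\<tau> \<bullet> \<tau>)"
  define \<xi>' where "\<xi>' = \<xi> - \<beta> *\<^sub>R \<tau>"
  have e: "\<xi>' \<in> {r. r \<bullet> \<tau> = 0}"
    using \<tau>(2) by (auto simp: \<xi>'_def \<beta>_def inner_simps)
  have A\<xi>': "A \<xi> \<xi>' \<noteq> 0"
    using \<xi> by (simp add: \<xi>'_def blinfun.bilinear_simps A\<tau>)
  have "A \<xi> \<noteq> 0"
    using \<xi> by auto
  define p where "p = - A \<xi> \<xi>"
  \<comment> \<open>Below, \<open>(norm r)\<^sup>2\<close> is split into twice the squares of
    \<open>r - k *\<^sub>R \<xi>'\<close> and of \<open>k *\<^sub>R \<xi>'\<close>; the first is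
    paid for by \<open>c\<close>, the second by \<open>p\<close>.\<close>
  define c' where "c' = min (c / 2) (p / (2 * ((norm \<xi>')\<^sup>2 + 1)))"
  have pos: "0 < (norm \<xi>')\<^sup>2 + 1"
    by (simp add: add_nonneg_pos)
  have p: "0 < p"
    using \<xi> by (simp add: p_def)
  have c': "0 < c'"
    using coercive(1) p pos by (simp add: c'_def)
  have c'1: "2 * c' \<le> c"
    using min.cobounded1[of "c / 2"] unfolding c'_def by (simp add: mult.commute)
  have "c' \<le> p / (2 * ((norm \<xi>')\<^sup>2 + 1))"
    by (simp add: c'_def)
  then have c'2: "2 * c' * ((norm \<xi>')\<^sup>2 + 1) \<le> p"
    using pos by (simp add: field_simps)
  show ?thesis
  proof (rule coercive_penalised[OF c' _ _ e A\<xi>'])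
    fix r assume r: "r \<in> {r. r \<bullet> \<tau> = 0}" "A \<xi> r = 0"
    obtain k b where kb: "c * (norm (r - k *\<^sub>R \<xi> - b *\<^sub>R \<tau>))\<^sup>2 - k\<^sup>2 * A \<xi> \<xi> \<le> A r r"
      using coercive_modulo_constraint[OF sym coercive orth \<tau> \<open>A \<xi> \<noteq> 0\<close> _ r(2)] \<xi> by auto
    have "norm (r - k *\<^sub>R \<xi>') \<le> norm (r - k *\<^sub>R \<xi>' - (b + k * \<beta>) *\<^sub>R \<tau>)"
      using r(1) e by (intro norm_le_norm_diff_orthogonal) (auto simp: inner_simps)
    also have "r - k *\<^sub>R \<xi>' - (b + k * \<beta>) *\<^sub>R \<tau> = r - k *\<^sub>R \<xi> - b *\<^sub>R \<tau>"
      by (simp add: \<xi>'_def algebra_simps)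
    finally have le: "(norm (r - k *\<^sub>R \<xi>'))\<^sup>2 \<le> (norm (r - k *\<^sub>R \<xi> - b *\<^sub>R \<tau>))\<^sup>2"
      by (intro power_mono) auto
    have "norm r \<le> norm (r - k *\<^sub>R \<xi>') + \<bar>k\<bar> * norm \<xi>'"
      using norm_triangle_ineq[of "r - k *\<^sub>R \<xi>'" "k *\<^sub>R \<xi>'"] by simp
    then have "(norm r)\<^sup>2 \<le> (norm (r - k *\<^sub>R \<xi>') + \<bar>k\<bar> * norm \<xi>')\<^sup>2"
      by (rule power_mono) simp
    also have "\<dots> \<le> 2 * (norm (r - k *\<^sub>R \<xi>'))\<^sup>2 + 2 * (\<bar>k\<bar> * norm \<xi>')\<^sup>2"
      using zero_le_power2[of "norm (r - k *\<^sub>R \<xi>') - \<bar>k\<bar> * norm \<xi>'"]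
      by (simp add: power2_eq_square algebra_simps)
    also have "\<dots> \<le> 2 * (norm (r - k *\<^sub>R \<xi> - b *\<^sub>R \<tau>))\<^sup>2 + 2 * k\<^sup>2 * ((norm \<xi>')\<^sup>2 + 1)"
      unfolding power_mult_distrib power2_abs distrib_left mult_1_right mult.assoc
      using le zero_le_power2[of k] by linarith
    finally have "c' * (norm r)\<^sup>2 \<le> c' * (2 * (norm (r - k *\<^sub>R \<xi> - b *\<^sub>R \<tau>))\<^sup>2 + 2 * k\<^sup>2 * ((norm \<xi>')\<^sup>2 + 1))"
      using c' by (intro mult_left_mono) auto
    also have "\<dots> = 2 * c' * (norm (r - k *\<^sub>R \<xi> - b *\<^sub>R \<tau>))\<^sup>2 + k\<^sup>2 * (2 * c' * ((norm \<xi>')\<^sup>2 + 1))"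
      by (simp add: algebra_simps)
    also have "\<dots> \<le> c * (norm (r - k *\<^sub>R \<xi> - b *\<^sub>R \<tau>))\<^sup>2 + k\<^sup>2 * p"
      using c'1 c'2 by (intro add_mono mult_right_mono mult_left_mono) auto
    also have "\<dots> \<le> A r r"
      using kb by (simp add: p_def)
    finally show "c' * (norm r)\<^sup>2 \<le> A r r" .
  qed (auto simp: subspace_def inner_simps)
qed

section \<open>Second-order Taylor expansion\<close>

lemma fderiv_works:
  assumes "f differentiable (at u)"
  shows "(f has_derivative blinfun_apply (fderiv f u)) (at u)"
proof -
  have *: "(f has_derivative frechet_derivative f (at u)) (at u)"
    using assms frechet_derivative_works by blast
  then have "bounded_linear (frechet_derivative f (at u))"
    by (rule has_derivative_bounded_linear)
  then show ?thesis
    using * by (simp add: fderiv_def bounded_linear_Blinfun_apply)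
qed

lemma C2_has_derivative:
  assumes "C2 f"
  shows "(f has_derivative blinfun_apply (fderiv f u)) (at u)"
    and "(fderiv f has_derivative blinfun_apply (fderiv (fderiv f) u)) (at u)"
  using assms by (auto simp: C2_def intro: fderiv_works)

text \<open>The second derivative is frozen at \<open>u\<close> while the base point
  \<open>y\<close> moves: the expansion will be made at points of the family, but coercivity is
  known only at the given bound state.\<close>

lemma C2_taylor:
  fixes f :: "'a::real_normed_vector \<Rightarrow> real"
  assumes f: "C2 f" and \<kappa>: "0 < \<kappa>"
  shows "\<exists>\<delta>>0. \<forall>y z. norm (y - u) < \<delta> \<longrightarrow> norm (z - u) < \<delta> \<longrightarrow>
    norm (fderiv f z - fderiv f y - fderiv (fderiv f) u (z - y)) \<le> \<kappa> * norm (z - y) \<and>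
    \<bar>f z - f y - fderiv f y (z - y) - fderiv (fderiv f) u (z - y) (z - y) / 2\<bar> \<le> \<kappa> * (norm (z - y))\<^sup>2"
proof -
  have "isCont (fderiv (fderiv f)) u"
    using f by (simp add: C2_def continuous_on_eq_continuous_at)
  then obtain \<delta> where \<delta>: "0 < \<delta>"
    "\<And>x. norm (x - u) < \<delta> \<Longrightarrow> norm (fderiv (fderiv f) x - fderiv (fderiv f) u) < \<kappa>"
    using \<kappa> unfolding continuous_at_eps_delta dist_norm by meson
  have seg: "y + t *\<^sub>R (z - y) \<in> ball u \<delta>" if "y \<in> ball u \<delta>" "z \<in> ball u \<delta>" "t \<in> {0..1}" for y z t
  proof -
    have "y + t *\<^sub>R (z - y) = (1 - t) *\<^sub>R y + t *\<^sub>R z"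
      by (simp add: algebra_simps)
    then show ?thesis
      using convexD[OF convex_ball that(1,2), of "1 - t" t] that(3) by simp
  qed
  have lin: "norm (fderiv f z - fderiv f y - fderiv (fderiv f) u (z - y)) \<le> \<kappa> * norm (z - y)"
    if "y \<in> ball u \<delta>" "z \<in> ball u \<delta>" for y z
  proof -
    have "norm (fderiv f z - fderiv f y - fderiv (fderiv f) u (z - y)) \<le> norm (z - y) * \<kappa>"
    proof (rule differentiable_bound_linearization[where S = "ball u \<delta>"])
      show "y + t *\<^sub>R (z - y) \<in> ball u \<delta>" if "t \<in> {0..1}" for t
        using seg that \<open>y \<in> ball u \<delta>\<close> \<open>z \<in> ball u \<delta>\<close> by blast
      show "(fderiv f has_derivative blinfun_apply (fderiv (fderiv f) x)) (at x within ball u \<delta>)" for x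
        using C2_has_derivative(2)[OF f] by (rule has_derivative_at_withinI)
      show "onorm (blinfun_apply (fderiv (fderiv f) x) - blinfun_apply (fderiv (fderiv f) u)) \<le> \<kappa>"
        if "x \<in> ball u \<delta>" for x
        using \<delta>(2)[of x] that
        by (simp add: norm_blinfun.rep_eq minus_blinfun.rep_eq fun_diff_def dist_norm norm_minus_commute)
    qed (use \<delta> in auto)
    then show ?thesis by (simp add: mult.commute)
  qed
  have "\<bar>f z - f y - fderiv f y (z - y) - fderiv (fderiv f) u (z - y) (z - y) / 2\<bar> \<le> \<kappa> * (norm (z - y))\<^sup>2"
    if yz: "y \<in> ball u \<delta>" "z \<in> ball u \<delta>" for y z
  proof -
    define h where "h = z - y"
    \<comment> \<open>The remainder is \<open>g 1 - g 0\<close>, and the derivative of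
      \<open>g\<close> is the first-order error along the segment applied to \<open>h\<close>, which
      \<open>lin\<close> bounds; the mean value theorem joins the two.\<close>
    define g where "g t = f (y + t *\<^sub>R h) - t * fderiv f y h - t\<^sup>2 / 2 * fderiv (fderiv f) u h h" for t
    define g' where "g' t = fderiv f (y + t *\<^sub>R h) h - fderiv f y h - t * fderiv (fderiv f) u h h" for t
    have "(g has_real_derivative g' t) (at t)" for t
      unfolding g_def g'_def has_field_derivative_def
      by (rule derivative_eq_intros has_derivative_compose[OF _ C2_has_derivative(1)[OF f]] refl)+
        (auto simp: fun_eq_iff blinfun.bilinear_simps algebra_simps)
    then obtain t where t: "0 < t" "t < 1" "g 1 - g 0 = g' t"
      using MVT2[of 0 1 g g'] by auto
    have "g' t = (fderiv f (y + t *\<^sub>R h) - fderiv f y - fderiv (fderiv f) u (t *\<^sub>R h)) h"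
      by (simp add: g'_def blinfun.bilinear_simps)
    also have "\<bar>\<dots>\<bar> \<le> norm (fderiv f (y + t *\<^sub>R h) - fderiv f y - fderiv (fderiv f) u (t *\<^sub>R h)) * norm h"
      using norm_blinfun by (metis real_norm_def)
    also have "\<dots> \<le> \<kappa> * norm (t *\<^sub>R h) * norm h"
      using lin[OF yz(1) seg[OF yz], of t] t by (intro mult_right_mono) (auto simp: h_def)
    also have "\<dots> \<le> \<kappa> * norm h * norm h"
      using t \<kappa> by (intro mult_right_mono mult_left_mono) (auto intro: mult_left_le_one_le)
    finally have "\<bar>g 1 - g 0\<bar> \<le> \<kappa> * (norm h)\<^sup>2"
      using t(3) by (simp add: power2_eq_square mult.assoc)
    then show ?thesis
      by (simp add: g_def h_def)
  qed
  with \<delta>(1) lin show ?thesis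
    by (intro exI[of _ \<delta>]) (auto simp: dist_norm norm_minus_commute)
qed

text \<open>Expand \<open>f\<close> over the triangle \<open>u\<close>,
  \<open>u + t *\<^sub>R x\<close>, \<open>u + t *\<^sub>R (x + y)\<close>, directly and along its
  two legs. What remains of the comparison is the difference of \<open>A x y\<close> and
  \<open>A y x\<close>, up to an error that \<open>\<kappa>\<close> makes arbitrarily small.\<close>

lemma C2_symmetric:
  fixes f :: "'a::real_normed_vector \<Rightarrow> real"
  assumes f: "C2 f"
  shows "fderiv (fderiv f) u x y = fderiv (fderiv f) u y x"
proof -
  define A where "A = fderiv (fderiv f) u"
  define M where "M = (norm x + norm y + 1)\<^sup>2"
  have M: "0 < M" "norm x * norm y \<le> M" "(norm x)\<^sup>2 \<le> M" "(norm y)\<^sup>2 \<le> M" "(norm (x + y))\<^sup>2 \<le> M"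
  proof -
    show "0 < M" unfolding M_def by (intro zero_less_power add_nonneg_pos) auto
    show "norm x * norm y \<le> M" "(norm x)\<^sup>2 \<le> M" "(norm y)\<^sup>2 \<le> M"
      unfolding M_def power2_eq_square by (intro mult_mono; simp)+
    show "(norm (x + y))\<^sup>2 \<le> M"
      unfolding M_def by (intro power_mono) (auto intro: order_trans[OF norm_triangle_ineq])
  qed
  have "\<bar>A x y - A y x\<bar> \<le> 8 * M * \<kappa>" if \<kappa>: "0 < \<kappa>" for \<kappa>
  proof -
    obtain \<delta> where \<delta>: "0 < \<delta>" and lin: "\<And>y z. norm (y - u) < \<delta> \<Longrightarrow> norm (z - u) < \<delta> \<Longrightarrow>
      norm (fderiv f z - fderiv f y - A (z - y)) \<le> \<kappa> * norm (z - y)"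
      and taylor: "\<And>y z. norm (y - u) < \<delta> \<Longrightarrow> norm (z - u) < \<delta> \<Longrightarrow>
      \<bar>f z - f y - fderiv f y (z - y) - A (z - y) (z - y) / 2\<bar> \<le> \<kappa> * (norm (z - y))\<^sup>2"
      using C2_taylor[OF f \<kappa>, of u] unfolding A_def by blast
    define t where "t = \<delta> / (2 * (norm x + norm y + 1))"
    have "0 < norm x + norm y + 1"
      by (simp add: add_nonneg_pos)
    then have t: "0 < t" and t_eq: "t * (2 * (norm x + norm y + 1)) = \<delta>"
      using \<delta> by (auto simp: t_def)
    have t_small: "norm (t *\<^sub>R w) < \<delta>" if "norm w \<le> norm x + norm y" for w
    proof -
      have "norm w < 2 * (norm x + norm y + 1)"
        using that norm_ge_zero[of x] norm_ge_zero[of y] unfolding distrib_left by linarith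
      then have "t * norm w < t * (2 * (norm x + norm y + 1))"
        using t by (rule mult_strict_left_mono)
      also have "\<dots> = \<delta>"
        by (rule t_eq)
      finally show ?thesis using t by simp
    qed
    let ?p = "u + t *\<^sub>R x" and ?q = "u + t *\<^sub>R (x + y)"
    have near: "norm (u - u) < \<delta>" "norm (?p - u) < \<delta>" "norm (?q - u) < \<delta>"
      using \<delta> t_small[of x] t_small[of "x + y"] norm_triangle_ineq[of x y] by auto
    have pq: "?p + t *\<^sub>R y = ?q"
      by (simp add: algebra_simps)
    have sc: "\<kappa> * (norm (t *\<^sub>R w))\<^sup>2 \<le> t\<^sup>2 * (M * \<kappa>)" if "(norm w)\<^sup>2 \<le> M" for w
      using mult_left_mono[OF that, of "t\<^sup>2 * \<kappa>"] \<kappa> by (simp add: power_mult_distrib ac_simps)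
    have taylor_t: "\<bar>f (p + t *\<^sub>R w) - f p - t * fderiv f p w - t\<^sup>2 * A w w / 2\<bar> \<le> t\<^sup>2 * (M * \<kappa>)"
      if "norm (p - u) < \<delta>" "norm (p + t *\<^sub>R w - u) < \<delta>" "(norm w)\<^sup>2 \<le> M" for p w
      using taylor[OF that(1,2)] sc[OF that(3)] by (simp add: blinfun.bilinear_simps power2_eq_square mult.assoc)
    note 1 = taylor_t[OF near(1,3) M(5)]
    note 2 = taylor_t[OF near(1,2) M(3)]
    note 3 = taylor_t[of ?p y, unfolded pq, OF near(2,3) M(4)]
    have 4: "\<bar>t * fderiv f ?p y - t * fderiv f u y - t\<^sup>2 * A x y\<bar> \<le> t\<^sup>2 * (M * \<kappa>)"
    proof -
      have "t * fderiv f ?p y - t * fderiv f u y - t\<^sup>2 * A x y = t * ((fderiv f ?p - fderiv f u - A (t *\<^sub>R x)) y)"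
        by (simp add: blinfun.bilinear_simps power2_eq_square algebra_simps)
      also have "\<bar>\<dots>\<bar> = t * \<bar>(fderiv f ?p - fderiv f u - A (t *\<^sub>R x)) y\<bar>"
        using t by (simp add: abs_mult)
      also have "\<dots> \<le> t * (norm (fderiv f ?p - fderiv f u - A (t *\<^sub>R x)) * norm y)"
        using t norm_blinfun[of "fderiv f ?p - fderiv f u - A (t *\<^sub>R x)" y] by (intro mult_left_mono) auto
      also have "\<dots> \<le> t * ((\<kappa> * norm (t *\<^sub>R x)) * norm y)"
        using t lin[OF near(1,2)] by (intro mult_left_mono mult_right_mono) auto
      also have "\<dots> = t\<^sup>2 * \<kappa> * (norm x * norm y)"
        using t by (simp add: power2_eq_square)
      also have "\<dots> \<le> t\<^sup>2 * \<kappa> * M"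
        using M(2) \<kappa> by (intro mult_left_mono) auto
      finally show ?thesis by (simp add: ac_simps)
    qed
    have "t\<^sup>2 * A (x + y) (x + y) / 2 = t\<^sup>2 * A x x / 2 + t\<^sup>2 * A y y / 2 + t\<^sup>2 * A x y / 2 + t\<^sup>2 * A y x / 2"
      "t * fderiv f u (x + y) = t * fderiv f u x + t * fderiv f u y"
      by (simp_all add: blinfun.bilinear_simps algebra_simps add_divide_distrib)
    \<comment> \<open>Four errors bound half of the difference, hence the factor 8.\<close>
    with 1 2 3 4 have "\<bar>t\<^sup>2 * A x y - t\<^sup>2 * A y x\<bar> \<le> 8 * (t\<^sup>2 * (M * \<kappa>))"
      by linarith
    moreover have "\<bar>t\<^sup>2 * A x y - t\<^sup>2 * A y x\<bar> = t\<^sup>2 * \<bar>A x y - A y x\<bar>"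
      by (simp add: right_diff_distrib[symmetric] abs_mult)
    ultimately have "t\<^sup>2 * \<bar>A x y - A y x\<bar> \<le> t\<^sup>2 * (8 * M * \<kappa>)"
      by (simp add: ac_simps)
    then show ?thesis
      using t by simp
  qed
  then have "\<bar>A x y - A y x\<bar> \<le> 0 + e" if "0 < e" for e
    using that M(1) by (elim meta_allE[of _ "e / (8 * M)"]) auto
  then have "\<bar>A x y - A y x\<bar> \<le> 0"
    by (rule field_le_epsilon)
  then show ?thesis
    by (simp add: A_def)
qed

section \<open>Modulation\<close>

lemma vector_derivative_linear_bound:
  fixes f :: "real \<Rightarrow> 'a::real_normed_vector"
  assumes "(f has_vector_derivative f') (at 0)" and "0 < \<kappa>"
  shows "\<exists>\<rho>>0. \<forall>s. \<bar>s\<bar> \<le> \<rho> \<longrightarrow> norm (f s - f 0 - s *\<^sub>R f') \<le> \<kappa> * \<bar>s\<bar>"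
proof -
  obtain \<rho> where "0 < \<rho>" "\<And>s. norm (s - 0) < \<rho> \<Longrightarrow>
      norm (f s - f 0 - (s - 0) *\<^sub>R f') \<le> \<kappa> * norm (s - 0)"
    using assms unfolding has_vector_derivative_def has_derivative_at_alt by blast
  then show ?thesis
    by (intro exI[of _ "\<rho> / 2"]) auto
qed

locale unitary =
  fixes T :: "real \<Rightarrow> 'x::{real_inner,banach} \<Rightarrow>\<^sub>L 'x"
  assumes unitary_group: "unitary_group T"
begin

lemma T_0 [simp]: "T 0 u = u"
  using unitary_group by (simp add: unitary_group_def)

lemma T_add: "T (s + t) u = T s (T t u)"
  using unitary_group by (simp add: unitary_group_def)

lemma T_minus [simp]: "T (- s) (T s u) = u" "T s (T (- s) u) = u"
  using T_add[of "- s" s u] T_add[of s "- s" u] by simp_all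

lemma T_inner [simp]: "T s u \<bullet> T s v = u \<bullet> v"
  using unitary_group by (simp add: unitary_group_def)

lemma T_norm [simp]: "norm (T s u) = norm u"
  by (simp add: norm_eq_sqrt_inner)

lemma T_continuous: "continuous_on A (\<lambda>s. T s u)"
  using unitary_group by (auto simp: unitary_group_def intro: continuous_on_subset)

lemma T_norm_diff: "norm (T s u - v) = norm (u - T (- s) v)"
proof -
  have "T s u - v = T s (u - T (- s) v)"
    by (simp add: blinfun.bilinear_simps)
  then show ?thesis by simp
qed

text \<open>As a function of \<open>s\<close>, \<open>(T s v - \<phi>) \<bullet> \<tau>\<close> is
  close to \<open>s * (norm \<tau>)\<^sup>2\<close>, so it changes sign near 0.\<close>

lemma modulation_1:
  assumes deriv: "((\<lambda>s. T s \<phi>) has_vector_derivative \<tau>) (at 0)" and \<tau>: "\<tau> \<noteq> 0" and \<rho>: "0 < \<rho>"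
  shows "\<exists>\<delta>>0. \<forall>v. norm (v - \<phi>) < \<delta> \<longrightarrow>
    (\<exists>s. norm (T s v - \<phi>) \<le> \<rho> \<and> (T s v - \<phi>) \<bullet> \<tau> = 0)"
proof -
  obtain \<rho>1 where \<rho>1: "0 < \<rho>1" "\<And>s. \<bar>s\<bar> \<le> \<rho>1 \<Longrightarrow> norm (T s \<phi> - \<phi> - s *\<^sub>R \<tau>) \<le> norm \<tau> / 2 * \<bar>s\<bar>"
    using vector_derivative_linear_bound[OF deriv, of "norm \<tau> / 2"] \<tau> by auto
  define \<sigma> where "\<sigma> = min \<rho>1 (\<rho> / (3 * norm \<tau>))"
  have \<sigma>: "0 < \<sigma>" "\<sigma> \<le> \<rho>1" "2 * norm \<tau> * \<sigma> < \<rho>"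
  proof -
    show "0 < \<sigma>" "\<sigma> \<le> \<rho>1"
      using \<rho>1(1) \<rho> \<tau> by (auto simp: \<sigma>_def)
    have "2 * norm \<tau> * \<sigma> \<le> 2 * norm \<tau> * (\<rho> / (3 * norm \<tau>))"
      by (intro mult_left_mono) (auto simp: \<sigma>_def)
    also have "\<dots> < \<rho>"
      using \<tau> \<rho> by simp
    finally show "2 * norm \<tau> * \<sigma> < \<rho>" .
  qed
  \<comment> \<open>The first bound forces the change of sign between \<open>- \<sigma>\<close> and
    \<open>\<sigma>\<close>; the second leaves room for \<open>T s \<phi> - \<phi>\<close>, whose
    norm is at most \<open>2 * norm \<tau> * \<sigma>\<close>.\<close>
  define \<delta> where "\<delta> = min (norm \<tau> / 2 * \<sigma>) (\<rho> - 2 * norm \<tau> * \<sigma>)"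
  have "\<exists>s. norm (T s v - \<phi>) \<le> \<rho> \<and> (T s v - \<phi>) \<bullet> \<tau> = 0" if v: "norm (v - \<phi>) < \<delta>" for v
  proof -
    define h where "h s = (T s v - \<phi>) \<bullet> \<tau>" for s
    have near: "norm (T s v - T s \<phi>) < \<delta>" for s
      using v by (simp flip: blinfun.diff_right)
    have h: "\<bar>h s - s * (norm \<tau>)\<^sup>2\<bar> < \<sigma> * (norm \<tau>)\<^sup>2" if "\<bar>s\<bar> \<le> \<sigma>" for s
    proof -
      have "h s - s * (norm \<tau>)\<^sup>2 = ((T s v - T s \<phi>) + (T s \<phi> - \<phi> - s *\<^sub>R \<tau>)) \<bullet> \<tau>"
        by (simp add: h_def inner_simps power2_norm_eq_inner)
      also have "\<bar>\<dots>\<bar> \<le> norm ((T s v - T s \<phi>) + (T s \<phi> - \<phi> - s *\<^sub>R \<tau>)) * norm \<tau>"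
        by (rule Cauchy_Schwarz_ineq2)
      also have "\<dots> \<le> (norm (T s v - T s \<phi>) + norm (T s \<phi> - \<phi> - s *\<^sub>R \<tau>)) * norm \<tau>"
        by (intro mult_right_mono norm_triangle_ineq) auto
      also have "\<dots> < (norm \<tau> / 2 * \<sigma> + norm \<tau> / 2 * \<sigma>) * norm \<tau>"
      proof (intro mult_strict_right_mono add_less_le_mono)
        show "norm (T s v - T s \<phi>) < norm \<tau> / 2 * \<sigma>"
          using near[of s] by (simp add: \<delta>_def)
        have "norm (T s \<phi> - \<phi> - s *\<^sub>R \<tau>) \<le> norm \<tau> / 2 * \<bar>s\<bar>"
          using that \<sigma>(2) by (intro \<rho>1(2)) simp
        also have "\<dots> \<le> norm \<tau> / 2 * \<sigma>"
          using that by (intro mult_left_mono) auto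
        finally show "norm (T s \<phi> - \<phi> - s *\<^sub>R \<tau>) \<le> norm \<tau> / 2 * \<sigma>" .
      qed (use \<tau> in auto)
      finally show ?thesis
        by (simp add: power2_eq_square algebra_simps)
    qed
    have "continuous_on {- \<sigma>..\<sigma>} h"
      unfolding h_def by (intro continuous_intros T_continuous)
    moreover have "h (- \<sigma>) \<le> 0" "0 \<le> h \<sigma>"
      using h[of "- \<sigma>"] h[of \<sigma>] \<sigma>(1) by (simp_all add: abs_less_iff)
    ultimately obtain s where s: "- \<sigma> \<le> s" "s \<le> \<sigma>" "h s = 0"
      using IVT'[of h "- \<sigma>" 0 \<sigma>] \<sigma>(1) by auto
    have "norm (T s \<phi> - \<phi> - s *\<^sub>R \<tau>) \<le> norm \<tau> / 2 * \<bar>s\<bar>"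
      using s \<sigma>(2) by (intro \<rho>1(2)) auto
    then have "norm (T s \<phi> - \<phi>) \<le> 2 * norm \<tau> * \<bar>s\<bar>"
      using norm_triangle_ineq[of "T s \<phi> - \<phi> - s *\<^sub>R \<tau>" "s *\<^sub>R \<tau>"] mult_nonneg_nonneg[OF norm_ge_zero[of \<tau>] abs_ge_zero[of s]]
      unfolding diff_add_cancel norm_scaleR mult.commute[of "\<bar>s\<bar>"] mult.assoc times_divide_eq_left
      by linarith
    also have "\<dots> \<le> 2 * norm \<tau> * \<sigma>"
      using s by (intro mult_left_mono) auto
    finally have "norm (T s v - \<phi>) \<le> \<rho>"
      using near[of s] norm_triangle_ineq[of "T s v - T s \<phi>" "T s \<phi> - \<phi>"] by (simp add: \<delta>_def)
    with s(3) show ?thesis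
      unfolding h_def by blast
  qed
  moreover have "0 < \<delta>"
    using \<sigma> \<tau> by (simp add: \<delta>_def)
  ultimately show ?thesis by blast
qed

text \<open>Brouwer's theorem is used instead of the implicit function theorem, so that
  continuity of the curve and its differentiability at one point suffice.\<close>

lemma modulation_2:
  assumes deriv: "((\<lambda>s. T s \<phi>) has_vector_derivative \<tau>) (at 0)"
    and curve: "(\<gamma> has_vector_derivative \<xi>) (at 0)" "\<gamma> 0 = \<phi>"
    and l: "0 < l" "continuous_on {- l..l} \<gamma>"
    and independent: "(\<tau> \<bullet> \<xi>)\<^sup>2 < (\<tau> \<bullet> \<tau>) * (\<xi> \<bullet> \<xi>)" and \<rho>: "0 < \<rho>"
  shows "\<exists>\<delta>>0. \<forall>v. norm (v - \<phi>) < \<delta> \<longrightarrow>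
    (\<exists>s \<theta>. \<bar>\<theta>\<bar> \<le> \<rho> \<and> norm (T s v - \<gamma> \<theta>) \<le> \<rho> \<and>
      (T s v - \<gamma> \<theta>) \<bullet> \<tau> = 0 \<and> (T s v - \<gamma> \<theta>) \<bullet> \<xi> = 0)"
proof -
  define \<Delta> where "\<Delta> = (\<tau> \<bullet> \<tau>) * (\<xi> \<bullet> \<xi>) - (\<tau> \<bullet> \<xi>)\<^sup>2"
  have \<Delta>: "0 < \<Delta>"
    using independent by (simp add: \<Delta>_def)
  \<comment> \<open>\<open>p\<close> and \<open>q\<close> form the basis of the span of
    \<open>\<tau>\<close> and \<open>\<xi>\<close> that is dual to these two vectors.\<close>
  define p where "p = (1 / \<Delta>) *\<^sub>R ((\<xi> \<bullet> \<xi>) *\<^sub>R \<tau> - (\<tau> \<bullet> \<xi>) *\<^sub>R \<xi>)"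
  define q where "q = (1 / \<Delta>) *\<^sub>R ((\<tau> \<bullet> \<tau>) *\<^sub>R \<xi> - (\<tau> \<bullet> \<xi>) *\<^sub>R \<tau>)"
  have \<Delta>_eq: "(\<tau> \<bullet> \<tau>) * (\<xi> \<bullet> \<xi>) - (\<tau> \<bullet> \<xi>) * (\<tau> \<bullet> \<xi>) = \<Delta>"
    by (simp add: \<Delta>_def power2_eq_square)
  have dual: "\<tau> \<bullet> p = 1" "\<xi> \<bullet> p = 0" "\<tau> \<bullet> q = 0" "\<xi> \<bullet> q = 1"
    using \<Delta> \<Delta>_eq by (simp_all add: p_def q_def inner_simps inner_commute[of \<xi> \<tau>] mult.commute)
  have orth: "r \<bullet> \<tau> = 0 \<and> r \<bullet> \<xi> = 0" if "r \<bullet> p = 0" "r \<bullet> q = 0" for r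
  proof -
    have "\<Delta> *\<^sub>R \<tau> = \<Delta> *\<^sub>R ((\<tau> \<bullet> \<tau>) *\<^sub>R p + (\<tau> \<bullet> \<xi>) *\<^sub>R q)" "\<Delta> *\<^sub>R \<xi> = \<Delta> *\<^sub>R ((\<tau> \<bullet> \<xi>) *\<^sub>R p + (\<xi> \<bullet> \<xi>) *\<^sub>R q)"
      using \<Delta> by (simp_all add: p_def q_def scaleR_add_right flip: \<Delta>_eq) (simp_all add: algebra_simps)
    then have "\<tau> = (\<tau> \<bullet> \<tau>) *\<^sub>R p + (\<tau> \<bullet> \<xi>) *\<^sub>R q" "\<xi> = (\<tau> \<bullet> \<xi>) *\<^sub>R p + (\<xi> \<bullet> \<xi>) *\<^sub>R q"
      using \<Delta> by (metis scaleR_cancel_left less_irrefl)+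
    with that show ?thesis
      by (metis add.right_neutral inner_add_right inner_scaleR_right mult_zero_right)
  qed
  define K where "K = norm p + norm q + 1"
  have K: "1 \<le> K" "0 < K" "norm p + norm q \<le> K"
    by (auto simp: K_def add_nonneg_pos)
  obtain \<rho>1 where \<rho>1: "0 < \<rho>1" "\<And>s. \<bar>s\<bar> \<le> \<rho>1 \<Longrightarrow> norm (T s \<phi> - \<phi> - s *\<^sub>R \<tau>) \<le> 1 / (4 * K) * \<bar>s\<bar>"
    using vector_derivative_linear_bound[OF deriv, of "1 / (4 * K)"] K by auto
  obtain \<rho>2 where \<rho>2: "0 < \<rho>2" "\<And>s. \<bar>s\<bar> \<le> \<rho>2 \<Longrightarrow> norm (\<gamma> s - \<phi> - s *\<^sub>R \<xi>) \<le> 1 / (4 * K) * \<bar>s\<bar>"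
    using vector_derivative_linear_bound[OF curve(1), of "1 / (4 * K)"] K curve(2) by auto
  define L where "L = norm \<tau> + norm \<xi> + 2"
  have L: "2 \<le> L" "0 < L"
    by (auto simp: L_def add_nonneg_pos)
  define \<sigma> where "\<sigma> = Min {\<rho>1, \<rho>2, l, \<rho>, \<rho> / (2 * L)}"
  have \<sigma>: "0 < \<sigma>" "\<sigma> \<le> \<rho>1" "\<sigma> \<le> \<rho>2" "\<sigma> \<le> l" "\<sigma> \<le> \<rho>" "\<sigma> * L \<le> \<rho> / 2"
  proof -
    show "0 < \<sigma>" "\<sigma> \<le> \<rho>1" "\<sigma> \<le> \<rho>2" "\<sigma> \<le> l" "\<sigma> \<le> \<rho>"
      using \<rho>1(1) \<rho>2(1) l(1) \<rho> L by (auto simp: \<sigma>_def)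
    have "\<sigma> \<le> \<rho> / (2 * L)"
      by (simp add: \<sigma>_def)
    then show "\<sigma> * L \<le> \<rho> / 2"
      using L by (simp add: field_simps)
  qed
  define \<delta> where "\<delta> = min (\<sigma> / (2 * K)) (\<rho> / 2)"
  have \<delta>: "0 < \<delta>" "\<delta> \<le> \<rho> / 2" "\<delta> * K \<le> \<sigma> / 2"
  proof -
    show "0 < \<delta>" "\<delta> \<le> \<rho> / 2"
      using \<sigma> \<rho> K by (auto simp: \<delta>_def)
    have "\<delta> \<le> \<sigma> / (2 * K)"
      by (simp add: \<delta>_def)
    then show "\<delta> * K \<le> \<sigma> / 2"
      using K by (simp add: field_simps)
  qed
  have "\<exists>s \<theta>. \<bar>\<theta>\<bar> \<le> \<rho> \<and> norm (T s v - \<gamma> \<theta>) \<le> \<rho> \<and>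
      (T s v - \<gamma> \<theta>) \<bullet> \<tau> = 0 \<and> (T s v - \<gamma> \<theta>) \<bullet> \<xi> = 0" if v: "norm (v - \<phi>) < \<delta>" for v
  proof -
    define r where "r z = T (fst z) v - \<gamma> (snd z)" for z :: "real \<times> real"
    \<comment> \<open>To first order \<open>r z\<close> is
      \<open>fst z *\<^sub>R \<tau> - snd z *\<^sub>R \<xi>\<close>. The sign in the second
      component makes \<open>F\<close> close to the identity, so \<open>z - F z\<close> consists of
      error terms only.\<close>
    define F where "F z = (r z \<bullet> p, - (r z \<bullet> q))" for z
    have near: "norm (T s v - T s \<phi>) < \<delta>" for s
      using v by (simp flip: blinfun.diff_right)
    define e where "e z = r z - (fst z *\<^sub>R \<tau> - snd z *\<^sub>R \<xi>)" for z
    have box: "\<bar>fst z\<bar> \<le> \<sigma>" "\<bar>snd z\<bar> \<le> \<sigma>" if "z \<in> cball 0 \<sigma>" for z :: "real \<times> real"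
      using that norm_fst_le[of "fst z" "snd z"] norm_snd_le[of "snd z" "fst z"] by (auto simp: dist_norm)
    have e: "norm (e z) \<le> \<delta> + \<sigma> / (2 * K)" if "z \<in> cball 0 \<sigma>" for z
    proof -
      have "e z = (T (fst z) v - T (fst z) \<phi>) + (T (fst z) \<phi> - \<phi> - fst z *\<^sub>R \<tau>) - (\<gamma> (snd z) - \<phi> - snd z *\<^sub>R \<xi>)"
        by (simp add: e_def r_def)
      also have "norm \<dots> \<le> norm (T (fst z) v - T (fst z) \<phi>) + norm (T (fst z) \<phi> - \<phi> - fst z *\<^sub>R \<tau>)
          + norm (\<gamma> (snd z) - \<phi> - snd z *\<^sub>R \<xi>)"
        by (rule order_trans[OF norm_triangle_ineq4 add_right_mono[OF norm_triangle_ineq]])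
      also have "\<dots> \<le> \<delta> + 1 / (4 * K) * \<bar>fst z\<bar> + 1 / (4 * K) * \<bar>snd z\<bar>"
        using near[of "fst z"] box[OF that] \<sigma> by (intro add_mono \<rho>1(2) \<rho>2(2)) auto
      also have "\<dots> \<le> \<delta> + 1 / (4 * K) * \<sigma> + 1 / (4 * K) * \<sigma>"
        using box[OF that] K by (intro add_mono mult_left_mono) auto
      also have "\<dots> = \<delta> + \<sigma> / (2 * K)"
        using K by (simp add: field_simps)
      finally show ?thesis .
    qed
    have "continuous_on (cball 0 \<sigma>) F"
    proof -
      have "continuous_on (cball 0 \<sigma>) (\<lambda>z. T (fst z) v)"
        by (rule continuous_on_compose2[OF T_continuous[of UNIV]]) (auto intro: continuous_intros)
      moreover have "continuous_on (cball 0 \<sigma>) (\<lambda>z :: real \<times> real. \<gamma> (snd z))"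
      proof (rule continuous_on_compose2[OF l(2) continuous_on_snd[OF continuous_on_id]])
        have "snd z \<in> {- l..l}" if "z \<in> cball 0 \<sigma>" for z :: "real \<times> real"
          using box(2)[OF that] \<sigma>(4) by auto
        then show "snd ` (cball 0 \<sigma> :: (real \<times> real) set) \<subseteq> {- l..l}"
          by blast
      qed
      ultimately have "continuous_on (cball 0 \<sigma>) r"
        unfolding r_def by (rule continuous_on_diff)
      then show ?thesis
        unfolding F_def by (intro continuous_intros)
    qed
    then have "\<exists>z\<in>cball 0 \<sigma>. F z = 0"
    \<comment> \<open>Only the value 0 has to be attained, so it suffices that
      \<open>z - F z\<close> stays in the ball.\<close>
    proof (rule brouwer_surjective_cball[where S = "{0}"])
      fix x z :: "real \<times> real" assume "x \<in> {0}" and z: "z \<in> cball 0 \<sigma>"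
      have "x + (z - F z) = (- (e z \<bullet> p), e z \<bullet> q)"
        using \<open>x \<in> {0}\<close> by (cases z) (simp add: F_def e_def inner_simps dual)
      then have "norm (x + (z - F z)) \<le> \<bar>e z \<bullet> p\<bar> + \<bar>e z \<bullet> q\<bar>"
        using norm_Pair_le[of "- (e z \<bullet> p)" "e z \<bullet> q"] by simp
      also have "\<dots> \<le> norm (e z) * norm p + norm (e z) * norm q"
        by (intro add_mono Cauchy_Schwarz_ineq2)
      also have "\<dots> = norm (e z) * (norm p + norm q)"
        by (simp add: algebra_simps)
      also have "\<dots> \<le> (\<delta> + \<sigma> / (2 * K)) * K"
        using e[OF z] K \<delta>(1) \<sigma>(1) by (intro mult_mono) auto
      also have "\<dots> \<le> \<sigma>"
        using \<delta>(3) K by (simp add: algebra_simps)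
      finally show "x + (z - F z) \<in> cball 0 \<sigma>"
        by simp
    qed (use \<sigma> in auto)
    then obtain z where z: "z \<in> cball 0 \<sigma>" "F z = 0"
      by blast
    have "r z \<bullet> p = 0" "r z \<bullet> q = 0"
      using z(2) by (auto simp: F_def zero_prod_def)
    then have "r z \<bullet> \<tau> = 0 \<and> r z \<bullet> \<xi> = 0"
      by (rule orth)
    moreover have "norm (r z) \<le> \<rho>"
    proof -
      have "norm (r z) = norm (e z + (fst z *\<^sub>R \<tau> - snd z *\<^sub>R \<xi>))"
        by (simp add: e_def)
      also have "\<dots> \<le> norm (e z) + (\<bar>fst z\<bar> * norm \<tau> + \<bar>snd z\<bar> * norm \<xi>)"
        using norm_triangle_ineq[of "e z" "fst z *\<^sub>R \<tau> - snd z *\<^sub>R \<xi>"]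
          norm_triangle_ineq4[of "fst z *\<^sub>R \<tau>" "snd z *\<^sub>R \<xi>"] by simp
      also have "\<dots> \<le> (\<delta> + \<sigma> / (2 * K)) + (\<sigma> * norm \<tau> + \<sigma> * norm \<xi>)"
        using e[OF z(1)] box[OF z(1)] by (intro add_mono mult_right_mono) auto
      also have "\<dots> \<le> \<delta> + (\<sigma> + (\<sigma> * norm \<tau> + \<sigma> * norm \<xi>))"
        using K \<sigma>(1) by (simp add: field_simps mult_le_cancel_left1)
      also have "\<dots> \<le> \<delta> + \<sigma> * L"
        using \<sigma>(1) by (simp add: L_def algebra_simps)
      also have "\<dots> \<le> \<rho>"
        using \<delta>(2) \<sigma>(6) by simp
      finally show ?thesis .
    qed
    moreover have "\<bar>snd z\<bar> \<le> \<rho>"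
      using box(2)[OF z(1)] \<sigma>(5) by simp
    ultimately show ?thesis
      unfolding r_def by blast
  qed
  with \<delta>(1) show ?thesis by blast
qed

end

section \<open>Unitary groups and the Hamiltonian structure\<close>

context unitary
begin

lemma gen_has_vector_derivative:
  assumes "u \<in> gen_dom T"
  shows "((\<lambda>s. T s u) has_vector_derivative gen T u) (at 0)"
  using assms unfolding gen_dom_def gen_def mem_Collect_eq vector_derivative_works .

lemma gen_domI:
  assumes "((\<lambda>s. T s u) has_vector_derivative v) (at 0)"
  shows "u \<in> gen_dom T" and "gen T u = v"
proof -
  show "u \<in> gen_dom T"
    unfolding gen_dom_def mem_Collect_eq using assms by (rule differentiableI_vector)
  show "gen T u = v"
    unfolding gen_def using assms by (rule vector_derivative_at)
qed

lemma T_commute: "T s (T t u) = T t (T s u)"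
  by (metis T_add add.commute)

lemma gen_T:
  assumes "u \<in> gen_dom T"
  shows "T s u \<in> gen_dom T" and "gen T (T s u) = T s (gen T u)"
proof -
  have "((\<lambda>t. T s (T t u)) has_vector_derivative T s (gen T u)) (at 0)"
    using gen_has_vector_derivative[OF assms]
    by (rule bounded_linear.has_vector_derivative[OF blinfun.bounded_linear_right])
  then have "((\<lambda>t. T t (T s u)) has_vector_derivative T s (gen T u)) (at 0)"
    by (subst T_commute)
  then show "T s u \<in> gen_dom T" "gen T (T s u) = T s (gen T u)"
    by (rule gen_domI)+
qed

text \<open>The averages of \<open>T s u\<close> over short time intervals lie in the domain of the generator.\<close>

lemma closure_gen_dom: "closure (gen_dom T) = UNIV"
proof -
  have "u \<in> closure (gen_dom T)" for u
  proof -
    \<comment> \<open>Starting at -3 keeps all points \<open>h + t\<close> with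
      \<open>0 \<le> h \<le> 1\<close> and \<open>\<bar>t\<bar> < 1\<close> interior, so that the
      derivatives are two-sided.\<close>
    define F where "F x = integral {- 3..x} (\<lambda>s. T s u)" for x
    have F: "(F has_vector_derivative T x u) (at x)" if "- 3 < x" "x < 3" for x
    proof -
      have "(F has_vector_derivative T x u) (at x within {- 3..3})"
        unfolding F_def using that by (intro integral_has_vector_derivative T_continuous) auto
      then have "(F has_vector_derivative T x u) (at x within {- 3<..<3})"
        by (rule has_vector_derivative_within_subset) auto
      then show ?thesis
        using that by (simp add: at_within_open[of x "{- 3<..<3}"])
    qed
    have shift: "T t (F h - F 0) = F (h + t) - F t" if t: "t \<in> {- 1<..<1}" and h: "0 \<le> h" "h \<le> 1" for t h
    proof -
      \<comment> \<open>Both parts of \<open>k\<close> have the derivative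
        \<open>T (x + t) u\<close> in \<open>x\<close> and vanish at 0.\<close>
      define k where "k x = T t (F x - F 0) - (F (x + t) - F t)" for x
      have "(k has_vector_derivative 0) (at x within {0..1})" if x: "x \<in> {0..1}" for x
      proof -
        have 1: "((\<lambda>x. T t (F x - F 0)) has_vector_derivative T t (T x u - 0)) (at x)"
          using x by (intro bounded_linear.has_vector_derivative[OF blinfun.bounded_linear_right]
              has_vector_derivative_diff[OF F has_vector_derivative_const]) auto
        have "(F \<circ> (\<lambda>x. x + t) has_vector_derivative 1 *\<^sub>R T (x + t) u) (at x)"
          using x t by (intro vector_diff_chain_at F) (auto intro!: derivative_eq_intros)
        then have "((\<lambda>x. F (x + t) - F t) has_vector_derivative T (x + t) u - 0) (at x)"
          by (intro has_vector_derivative_diff[OF _ has_vector_derivative_const]) (simp add: o_def)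
        from has_vector_derivative_diff[OF 1 this] show ?thesis
          unfolding k_def[abs_def] using T_add[of t x u]
          by (simp add: add.commute has_vector_derivative_at_within)
      qed
      then have "k h = k 0"
        using has_vector_derivative_zero_constant[of "{0..1}" k] h by (metis atLeastAtMost_iff convex_real_interval(5) order_refl zero_le_one)
      then show ?thesis
        by (simp add: k_def blinfun.bilinear_simps)
    qed
    have dom: "(1 / h) *\<^sub>R (F h - F 0) \<in> gen_dom T" if h: "0 < h" "h \<le> 1" for h
    proof -
      have "(F \<circ> (\<lambda>t. h + t) has_vector_derivative 1 *\<^sub>R T (h + 0) u) (at 0)"
        using h by (intro vector_diff_chain_at F) (auto intro!: derivative_eq_intros)
      then have "((\<lambda>t. (1 / h) *\<^sub>R (F (h + t) - F t)) has_vector_derivative (1 / h) *\<^sub>R (T h u - T 0 u)) (at 0)"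
        by (intro bounded_linear.has_vector_derivative[OF bounded_linear_scaleR_right]
            has_vector_derivative_diff F) (simp_all add: o_def)
      then have "((\<lambda>t. T t ((1 / h) *\<^sub>R (F h - F 0))) has_vector_derivative (1 / h) *\<^sub>R (T h u - T 0 u)) (at 0)"
        by (rule has_vector_derivative_transform_within_open[where S = "{- 1<..<1}"])
          (use shift h in \<open>auto simp: blinfun.scaleR_right\<close>)
      then show ?thesis
        by (rule gen_domI)
    qed
    show ?thesis
      unfolding closure_approachable
    proof (intro allI impI)
      fix e :: real assume e: "0 < e"
      have "(F has_vector_derivative u) (at 0)"
        using F[of 0] by simp
      then obtain \<rho> where \<rho>: "0 < \<rho>" "\<And>h. \<bar>h\<bar> \<le> \<rho> \<Longrightarrow> norm (F h - F 0 - h *\<^sub>R u) \<le> e / 2 * \<bar>h\<bar>"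
        using vector_derivative_linear_bound[of F u "e / 2"] e by auto
      define h where "h = min \<rho> 1"
      have h: "0 < h" "h \<le> 1" "h \<le> \<rho>"
        using \<rho>(1) by (auto simp: h_def)
      have "(1 / h) *\<^sub>R (F h - F 0) - u = (1 / h) *\<^sub>R (F h - F 0 - h *\<^sub>R u)"
        using h by (simp add: scaleR_diff_right)
      then have "dist ((1 / h) *\<^sub>R (F h - F 0)) u = (1 / h) * norm (F h - F 0 - h *\<^sub>R u)"
        using h by (simp add: dist_norm)
      also have "\<dots> \<le> (1 / h) * (e / 2 * h)"
        using \<rho>(2)[of h] h by (intro mult_left_mono) auto
      also have "\<dots> < e"
        using h e by simp
      finally show "\<exists>y\<in>gen_dom T. dist y u < e"
        using dom[OF h(1,2)] by blast
    qed
  qed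
  then show ?thesis by blast
qed

end

sublocale hamiltonian_system \<subseteq> unitary T
  by unfold_locales (rule T_unitary_group)

section \<open>Consequences of the commutation of J with the group\<close>

context hamiltonian_system
begin

lemma dense_range_eqI:
  fixes i :: "'a::real_normed_vector \<Rightarrow>\<^sub>L 'b::real_inner"
  assumes "closure (range (blinfun_apply i)) = UNIV" and "\<And>x. h \<bullet> i x = h' \<bullet> i x"
  shows "h = h'"
proof -
  have "closed {k. h \<bullet> k = h' \<bullet> k}"
    by (intro closed_Collect_eq continuous_intros)
  then have "closure (range (blinfun_apply i)) \<subseteq> {k. h \<bullet> k = h' \<bullet> k}"
    using assms(2) by (intro closure_minimal) auto
  then have "h \<bullet> k = h' \<bullet> k" for k
    using assms(1) by auto
  then show ?thesis
    using vector_eq_rdot by blast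
qed

text \<open>Unitarity is assumed in \<open>X\<close>; that the dual extension restricts to
  \<open>T\<close> makes \<open>T s\<close> isometric for the norm of \<open>H\<close> as
  well.\<close>

lemma iX_T_inner: "iX (T s x) \<bullet> iX y = iX x \<bullet> iX (T (- s) y)"
  using arg_cong[OF T_extends[of s x], of "\<lambda>f. f y"] by (simp add: T_dual_def to_dual_def)

lemma J_T_inner: "J (iX (T s x)) \<bullet> iX y = J (iX x) \<bullet> iX (T (- s) y)"
  using arg_cong[OF J_T_commute[of s x], of "\<lambda>f. f y"] by (simp add: T_dual_def to_dual_def)

lemma iX_T_norm: "norm (iX (T s x)) = norm (iX x)"
  unfolding norm_eq_sqrt_inner iX_T_inner by simp

text \<open>The commutation hypothesis only tests against the range of \<open>iX\<close>. Since \<open>T s\<close> is isometric for the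
  norm of \<open>H\<close>, it extends to all of \<open>H\<close>, in particular to the vectors \<open>J (iX y)\<close>.\<close>

lemma J_T_J_inner: "J (iX (T s x)) \<bullet> J (iX y) = J (iX x) \<bullet> J (iX (T (- s) y))"
proof -
  have "J (iX y) \<in> closure (range (blinfun_apply iX))"
    using dense_iX by simp
  then obtain a where a: "\<And>n. a n \<in> range (blinfun_apply iX)" "a \<longlonglongrightarrow> J (iX y)"
    unfolding closure_sequential by blast
  define v where "v n = inv (blinfun_apply iX) (a n)" for n
  have v: "(\<lambda>n. iX (v n)) \<longlonglongrightarrow> J (iX y)"
    unfolding v_def using a by (simp add: f_inv_into_f)
  define w where "w n = iX (T (- s) (v n))" for n
  have w_dist: "dist (w m) (w n) = dist (iX (v m)) (iX (v n))" for m n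
    using iX_T_norm[of "- s" "v m - v n"] unfolding w_def dist_norm blinfun.diff_right .
  have "Cauchy (\<lambda>n. iX (v n))"
    using v convergent_Cauchy convergentI by blast
  then have "Cauchy w"
    unfolding Cauchy_def w_dist .
  then obtain g where g: "w \<longlonglongrightarrow> g"
    using Cauchy_convergent convergent_def by blast
  \<comment> \<open>The limit is identified by testing against the range of \<open>iX\<close>, where
    the commutation hypothesis applies.\<close>
  have "g = J (iX (T (- s) y))"
  proof (rule dense_range_eqI[OF dense_iX])
    fix z
    have "(\<lambda>n. w n \<bullet> iX z) \<longlonglongrightarrow> g \<bullet> iX z"
      by (intro tendsto_intros g)
    moreover have "w n \<bullet> iX z = iX (v n) \<bullet> iX (T s z)" for n
      by (simp add: w_def iX_T_inner)
    moreover have "(\<lambda>n. iX (v n) \<bullet> iX (T s z)) \<longlonglongrightarrow> J (iX y) \<bullet> iX (T s z)"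
      by (intro tendsto_intros v)
    ultimately have "g \<bullet> iX z = J (iX y) \<bullet> iX (T s z)"
      by (simp add: LIMSEQ_unique)
    then show "g \<bullet> iX z = J (iX (T (- s) y)) \<bullet> iX z"
      by (simp add: J_T_inner)
  qed
  have "(\<lambda>n. J (iX x) \<bullet> w n) \<longlonglongrightarrow> J (iX x) \<bullet> g"
    by (intro tendsto_intros g)
  moreover have "J (iX x) \<bullet> w n = J (iX (T s x)) \<bullet> iX (v n)" for n
    by (simp add: w_def J_T_inner)
  moreover have "(\<lambda>n. J (iX (T s x)) \<bullet> iX (v n)) \<longlonglongrightarrow> J (iX (T s x)) \<bullet> J (iX y)"
    by (intro tendsto_intros v)
  ultimately show ?thesis
    unfolding \<open>g = _\<close> by (simp add: LIMSEQ_unique)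
qed

text \<open>The square of \<open>J\<close> maps \<open>X\<close> to itself. Writing the generator as
  this square applied to a vector of \<open>X\<close> makes that vector move with the group.\<close>

lemma JY_JX_T: "JY (JX (T s x)) = T s (JY (JX x))"
proof -
  have "iX (JY (JX (T s x))) = iX (T s (JY (JX x)))"
  proof (rule dense_range_eqI[OF dense_iX])
    fix v
    have "iX (JY (JX (T s x))) \<bullet> iX v = - (J (iX (T s x)) \<bullet> J (iX v))"
      unfolding JY_restricts JX_restricts by (rule J_skew)
    also have "\<dots> = - (J (iX x) \<bullet> J (iX (T (- s) v)))"
      unfolding J_T_J_inner ..
    also have "\<dots> = iX (JY (JX x)) \<bullet> iX (T (- s) v)"
      unfolding JY_restricts JX_restricts by (rule J_skew[symmetric])
    finally show "iX (JY (JX (T s x))) \<bullet> iX v = iX (T s (JY (JX x))) \<bullet> iX v"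
      unfolding iX_T_inner .
  qed
  then show ?thesis
    by (rule injD[OF inj_iX])
qed

text \<open>On the domain of the generator write \<open>gen T x = JY (JX x0)\<close>; then
  \<open>B x\<close> is the functional of \<open>J (iX x0)\<close>, to which the commutation of
  \<open>J\<close> and \<open>T\<close> applies. Density of the domain and continuity of
  \<open>B\<close> give the rest.\<close>

lemma B_T: "B (T s x) v = B x (T (- s) v)"
proof -
  have "B (T s x) v = B x (T (- s) v)" if x: "x \<in> gen_dom T" for x
  proof -
    obtain x0 where x0: "JY (JX x0) = gen T x"
      using bij_JX bij_JY by (metis bij_pointE)
    have inv_JY: "inv (blinfun_apply JY) (JY y) = y" for y
      using bij_JY by (simp add: bij_is_inj)
    have "gen T (T s x) = JY (JX (T s x0))"
      unfolding JY_JX_T x0 by (rule gen_T(2)[OF x])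
    then have "B (T s x) v = iY (JX (T s x0)) \<bullet> iX v"
      by (simp add: B_extends[OF gen_T(1)[OF x]] to_dual_def inv_JY)
    also have "\<dots> = iY (JX x0) \<bullet> iX (T (- s) v)"
      unfolding JX_restricts J_T_inner ..
    also have "\<dots> = B x (T (- s) v)"
      by (simp add: B_extends[OF x] to_dual_def inv_JY flip: x0)
    finally show ?thesis .
  qed
  then have "gen_dom T \<subseteq> {x. B (T s x) v = B x (T (- s) v)}"
    by blast
  moreover have "closed {x. B (T s x) v = B x (T (- s) v)}"
    by (intro closed_Collect_eq continuous_intros)
  ultimately have "closure (gen_dom T) \<subseteq> {x. B (T s x) v = B x (T (- s) v)}"
    by (rule closure_minimal)
  then show ?thesis
    unfolding closure_gen_dom by blast
qed

lemma Q_T: "Q B (T s x) = Q B x"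
  by (simp add: Q_def B_T)

text \<open>As \<open>JY\<close> maps onto \<open>X\<close>, these values determine
  \<open>B u\<close> by pairings in \<open>H\<close> alone.\<close>

lemma B_JY:
  assumes "u \<in> gen_dom T"
  shows "B u (JY y) = - (iX (gen T u) \<bullet> iY y)"
proof -
  define p where "p = inv (blinfun_apply JY) (gen T u)"
  have p: "JY p = gen T u"
    unfolding p_def using bij_JY by (simp add: bij_is_surj surj_f_inv_f)
  have "B u (JY y) = iY p \<bullet> J (iY y)"
    by (simp add: B_extends[OF assms] to_dual_def p_def JY_restricts)
  also have "\<dots> = - (iX (gen T u) \<bullet> iY y)"
    by (simp add: J_skew JY_restricts flip: p)
  finally show ?thesis .
qed

lemma B_nonzero:
  assumes "u \<in> gen_dom T" and "gen T u \<noteq> 0"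
  shows "B u \<noteq> 0"
proof
  assume "B u = 0"
  then have "iX (gen T u) \<bullet> iY y = 0 \<bullet> iY y" for y
    using B_JY[OF assms(1), of y] by simp
  then have "iX (gen T u) = iX 0"
    using dense_range_eqI[OF dense_iY] by (metis blinfun.zero_right)
  then show False
    using injD[OF inj_iX] assms(2) by blast
qed

text \<open>At time 0 the equation in the dual of \<open>Y\<close> is compared with the derivative
  of the orbit. Because \<open>JY\<close> is onto, the resulting identity holds against every vector
  of \<open>X\<close>.\<close>

lemma bound_state_critical:
  assumes bs: "bound_state iX iY JY T E \<nu> u" and u: "u \<in> gen_dom T"
  shows "fderiv E u = \<nu> *\<^sub>R B u"
proof (rule blinfun_eqI)
  fix x
  obtain y where y: "x = JY y"
    using bij_JY by (metis bij_pointE)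
  have "((\<lambda>t. to_dual iY (iX (T (\<nu> * t) u))) has_vector_derivative J_dual JY (fderiv E u)) (at 0)"
    using bs unfolding bound_state_def is_solution_def by (metis UNIV_I T_0 mult_zero_right)
  then have 1: "((\<lambda>t. to_dual iY (iX (T (\<nu> * t) u)) y) has_vector_derivative J_dual JY (fderiv E u) y) (at 0)"
    by (rule bounded_linear.has_vector_derivative[OF blinfun.bounded_linear_left])
  have "((\<lambda>s. T s u) \<circ> (\<lambda>t. \<nu> * t) has_vector_derivative \<nu> *\<^sub>R gen T u) (at 0)"
    using gen_has_vector_derivative[OF u]
    by (intro vector_diff_chain_at) (auto intro!: derivative_eq_intros)
  then have "((\<lambda>t. iX (T (\<nu> * t) u) \<bullet> iY y) has_vector_derivative iX (\<nu> *\<^sub>R gen T u) \<bullet> iY y) (at 0)"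
    unfolding o_def
    by (intro bounded_linear.has_vector_derivative[OF bounded_linear_inner_left]
        bounded_linear.has_vector_derivative[OF blinfun.bounded_linear_right])
  then have "((\<lambda>t. to_dual iY (iX (T (\<nu> * t) u)) y) has_vector_derivative iX (\<nu> *\<^sub>R gen T u) \<bullet> iY y) (at 0)"
    by (simp add: to_dual_def)
  then have "J_dual JY (fderiv E u) y = iX (\<nu> *\<^sub>R gen T u) \<bullet> iY y"
    using 1 vector_derivative_unique_at by blast
  then show "fderiv E u x = (\<nu> *\<^sub>R B u) x"
    by (simp add: J_dual_def y B_JY[OF u] blinfun.bilinear_simps)
qed

lemma Q_has_derivative: "(Q B has_derivative blinfun_apply (B u)) (at u)"
  unfolding Q_def[abs_def]
  by (auto intro!: derivative_eq_intros simp: fun_eq_iff B_symmetric)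

lemma fderiv_S: "fderiv (S E B \<nu>) u = fderiv E u - \<nu> *\<^sub>R B u"
  unfolding S_def[abs_def]
  by (rule fderiv_eqI)
    (auto intro!: derivative_eq_intros C2_has_derivative(1)[OF E_C2] Q_has_derivative
      simp: fun_eq_iff blinfun.bilinear_simps)

lemma S''_eq: "S'' E B \<nu> u = fderiv (fderiv E) u - \<nu> *\<^sub>R B"
  unfolding S''_def fderiv_S[abs_def]
  by (rule fderiv_eqI)
    (auto intro!: derivative_eq_intros C2_has_derivative(2)[OF E_C2]
      simp: fun_eq_iff blinfun.bilinear_simps)

lemma S''_symmetric: "S'' E B \<nu> u x y = S'' E B \<nu> u y x"
  by (simp add: S''_eq blinfun.bilinear_simps C2_symmetric[OF E_C2, of u x y] B_symmetric[of x y])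

end

section \<open>Orbital control by the conserved quantities\<close>

context hamiltonian_system
begin

text \<open>The point \<open>\<gamma> \<theta>\<close> is critical for the action at
  \<open>\<omega> + \<theta>\<close>, so no linear term in \<open>r\<close> survives in the energy
  balance. The charge balance determines \<open>B (\<gamma> 0) r\<close> up to
  \<open>\<eta>\<close>, \<open>g \<theta>\<close> and a small multiple of \<open>norm r\<close>,
  which bounds the penalty in the coercivity.\<close>

lemma energy_estimate:
  fixes \<gamma> :: "real \<Rightarrow> 'x" and \<omega> :: real
  defines "D \<equiv> \<lambda>\<theta>. S E B (\<omega> + \<theta>) (\<gamma> \<theta>) - S E B \<omega> (\<gamma> 0) + \<theta> * Q B (\<gamma> 0)"
    and "g \<equiv> \<lambda>\<theta>. Q B (\<gamma> 0) - Q B (\<gamma> \<theta>)"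
  assumes l: "0 < l" and critical: "\<And>\<theta>. \<bar>\<theta>\<bar> < l \<Longrightarrow> fderiv E (\<gamma> \<theta>) = (\<omega> + \<theta>) *\<^sub>R B (\<gamma> \<theta>)"
    and cont: "isCont \<gamma> 0"
    and c: "0 < c" and C: "0 \<le> C"
    and coercive: "\<And>r. r \<in> V \<Longrightarrow> c * (norm r)\<^sup>2 - C * (B (\<gamma> 0) r)\<^sup>2 \<le> S'' E B \<omega> (\<gamma> 0) r r"
  shows "\<exists>\<rho>>0. \<exists>K\<ge>0. \<forall>\<theta> v \<eta>. \<bar>\<theta>\<bar> \<le> \<rho> \<longrightarrow> norm (v - \<gamma> \<theta>) \<le> \<rho> \<longrightarrow> v - \<gamma> \<theta> \<in> V \<longrightarrow>
    \<bar>E v - E (\<gamma> 0)\<bar> \<le> \<eta> \<longrightarrow> \<bar>Q B v - Q B (\<gamma> 0)\<bar> \<le> \<eta> \<longrightarrow> \<eta> \<le> 1 \<longrightarrow>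
    D \<theta> + c / 8 * (norm (v - \<gamma> \<theta>))\<^sup>2 \<le> K * (\<eta> + (g \<theta>)\<^sup>2)"
proof -
  \<comment> \<open>\<open>m\<close> is the factor of \<open>norm r\<close> tolerated in the charge
    balance; the 3 in the second claim stems from squaring a sum of three terms.\<close>
  define m where "m = min 1 (c / (12 * (C + 1)))"
  have m: "0 < m" "3 * C / 2 * m\<^sup>2 \<le> c / 8"
  proof -
    show "0 < m"
      using c C by (simp add: m_def)
    have "m\<^sup>2 \<le> m"
      using mult_left_mono[of m 1 m] \<open>0 < m\<close> by (simp add: power2_eq_square) (simp add: m_def)
    also have "m \<le> c / (12 * (C + 1))"
      by (simp add: m_def)
    finally have "3 * C / 2 * m\<^sup>2 \<le> 3 * C / 2 * (c / (12 * (C + 1)))"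
      using C by (intro mult_left_mono) auto
    also have "\<dots> \<le> c / 8"
      using c C by (simp add: field_simps)
    finally show "3 * C / 2 * m\<^sup>2 \<le> c / 8" .
  qed
  define b where "b = norm B + 1"
  have b: "0 < b"
    by (simp add: b_def add_nonneg_pos)
  have Bb: "\<bar>B x y\<bar> \<le> b * norm x * norm y" for x y
  proof -
    have "\<bar>B x y\<bar> \<le> norm (B x) * norm y"
      using norm_blinfun[of "B x" y] by simp
    also have "\<dots> \<le> norm B * norm x * norm y"
      by (intro mult_right_mono norm_blinfun) auto
    also have "\<dots> \<le> b * norm x * norm y"
      by (intro mult_right_mono) (auto simp: b_def)
    finally show ?thesis .
  qed
  obtain \<delta> where \<delta>: "0 < \<delta>" and taylor: "\<And>y z. norm (y - \<gamma> 0) < \<delta> \<Longrightarrow> norm (z - \<gamma> 0) < \<delta> \<Longrightarrow>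
      \<bar>E z - E y - fderiv E y (z - y) - fderiv (fderiv E) (\<gamma> 0) (z - y) (z - y) / 2\<bar> \<le> c / 16 * (norm (z - y))\<^sup>2"
    using C2_taylor[OF E_C2, of "c / 16" "\<gamma> 0"] c by auto
  define k where "k = min (\<delta> / 4) (m / (2 * b))"
  have k: "0 < k" "k < \<delta> / 2" "b * k \<le> m / 2"
  proof -
    show "0 < k" "k < \<delta> / 2"
      using \<delta> m(1) b by (auto simp: k_def)
    have "k \<le> m / (2 * b)"
      by (simp add: k_def)
    then show "b * k \<le> m / 2"
      using b by (simp add: field_simps)
  qed
  obtain \<rho>0 where \<rho>0: "0 < \<rho>0" "\<And>\<theta>. \<bar>\<theta>\<bar> < \<rho>0 \<Longrightarrow> norm (\<gamma> \<theta> - \<gamma> 0) < k"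
    using cont k(1) unfolding continuous_at_eps_delta dist_norm by force
  define \<rho> where "\<rho> = Min {\<rho>0 / 2, l / 2, k, c / (8 * b), 1}"
  have \<rho>: "0 < \<rho>" "\<rho> < \<rho>0" "\<rho> < l" "\<rho> \<le> k" "\<rho> * b \<le> c / 8" "\<rho> \<le> 1"
  proof -
    have "\<rho> \<le> \<rho>0 / 2" "\<rho> \<le> l / 2"
      by (simp_all add: \<rho>_def)
    then show "\<rho> < \<rho>0" "\<rho> < l"
      using \<rho>0(1) l by linarith+
    show "0 < \<rho>"
      using \<rho>0(1) l k(1) c b by (simp add: \<rho>_def)
    show "\<rho> \<le> k" "\<rho> \<le> 1"
      by (simp_all add: \<rho>_def)
    have "\<rho> \<le> c / (8 * b)"
      by (simp add: \<rho>_def)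
    then show "\<rho> * b \<le> c / 8"
      using b by (simp add: field_simps)
  qed
  \<comment> \<open>The energy defect contributes 1, the charge defect
    \<open>\<bar>\<omega>\<bar> + 1\<close>, the penalty \<open>2 * C\<close>.\<close>
  define K where "K = 2 + \<bar>\<omega>\<bar> + 2 * C"
  have K: "0 \<le> K"
    using C by (simp add: K_def)
  have "D \<theta> + c / 8 * (norm (v - \<gamma> \<theta>))\<^sup>2 \<le> K * (\<eta> + (g \<theta>)\<^sup>2)"
    if \<theta>: "\<bar>\<theta>\<bar> \<le> \<rho>" and v: "norm (v - \<gamma> \<theta>) \<le> \<rho>" "v - \<gamma> \<theta> \<in> V"
      and \<eta>: "\<bar>E v - E (\<gamma> 0)\<bar> \<le> \<eta>" "\<bar>Q B v - Q B (\<gamma> 0)\<bar> \<le> \<eta>" "\<eta> \<le> 1" for \<theta> v \<eta>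
  proof -
    define r where "r = v - \<gamma> \<theta>"
    define N where "N = (norm r)\<^sup>2"
    have v_eq: "v = \<gamma> \<theta> + r"
      by (simp add: r_def)
    have near: "norm (\<gamma> \<theta> - \<gamma> 0) < k"
      using \<theta> \<rho>(2) by (intro \<rho>0(2)) simp
    have "norm (v - \<gamma> 0) \<le> norm r + norm (\<gamma> \<theta> - \<gamma> 0)"
      using norm_triangle_ineq[of r "\<gamma> \<theta> - \<gamma> 0"] by (simp add: r_def)
    then have "norm (v - \<gamma> 0) < \<delta>"
      using near k(2) v(1) \<rho>(4) by (simp add: r_def)
    then have "\<bar>E v - E (\<gamma> \<theta>) - fderiv E (\<gamma> \<theta>) r - fderiv (fderiv E) (\<gamma> 0) r r / 2\<bar> \<le> c / 16 * N"
      using taylor[of "\<gamma> \<theta>" v] near k \<delta> by (simp add: r_def N_def)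
    moreover have "fderiv E (\<gamma> \<theta>) r = (\<omega> + \<theta>) * B (\<gamma> \<theta>) r"
      using critical[of \<theta>] \<theta> \<rho>(3) by (simp add: blinfun.scaleR_left)
    ultimately have E_v: "E (\<gamma> \<theta>) + (\<omega> + \<theta>) * B (\<gamma> \<theta>) r + fderiv (fderiv E) (\<gamma> 0) r r / 2 - c / 16 * N \<le> E v"
      by linarith
    have Q_v: "Q B v = Q B (\<gamma> \<theta>) + B (\<gamma> \<theta>) r + B r r / 2"
      using B_symmetric[of r "\<gamma> \<theta>"] by (simp add: Q_def v_eq blinfun.bilinear_simps field_simps)
    have A: "S'' E B \<omega> (\<gamma> 0) r r = fderiv (fderiv E) (\<gamma> 0) r r - \<omega> * B r r"
      by (simp add: S''_eq blinfun.bilinear_simps)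
    have D_eq: "D \<theta> = (E (\<gamma> \<theta>) - (\<omega> + \<theta>) * Q B (\<gamma> \<theta>)) - (E (\<gamma> 0) - \<omega> * Q B (\<gamma> 0)) + \<theta> * Q B (\<gamma> 0)"
      by (simp add: D_def S_def)
    have "(\<omega> + \<theta>) * Q B v = (\<omega> + \<theta>) * Q B (\<gamma> \<theta>) + (\<omega> + \<theta>) * B (\<gamma> \<theta>) r + \<omega> * B r r / 2 + \<theta> * B r r / 2"
      unfolding Q_v by (simp add: algebra_simps add_divide_distrib)
    moreover have "(\<omega> + \<theta>) * Q B v - (\<omega> + \<theta>) * Q B (\<gamma> 0) = (\<omega> + \<theta>) * (Q B v - Q B (\<gamma> 0))"
      by (simp add: algebra_simps)
    moreover have "(\<omega> + \<theta>) * Q B (\<gamma> 0) = \<omega> * Q B (\<gamma> 0) + \<theta> * Q B (\<gamma> 0)"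
      by (simp add: algebra_simps)
    ultimately have 1: "D \<theta> \<le> (E v - E (\<gamma> 0)) - (\<omega> + \<theta>) * (Q B v - Q B (\<gamma> 0))
        - S'' E B \<omega> (\<gamma> 0) r r / 2 + c / 16 * N + \<theta> * B r r / 2"
      using E_v unfolding D_eq A by (simp add: diff_divide_distrib)
    have 2: "\<bar>(\<omega> + \<theta>) * (Q B v - Q B (\<gamma> 0))\<bar> \<le> (\<bar>\<omega>\<bar> + 1) * \<eta>"
      unfolding abs_mult using \<theta> \<rho>(6) \<eta>(2) by (intro mult_mono) auto
    have rB: "\<bar>B r r\<bar> \<le> b * N"
      using Bb[of r r] by (simp add: N_def power2_eq_square mult.assoc)
    have "\<bar>\<theta> * B r r\<bar> \<le> \<rho> * (b * N)"
      unfolding abs_mult using \<theta> rB \<rho>(1) by (intro mult_mono) auto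
    also have "\<dots> \<le> c / 8 * N"
      using mult_right_mono[OF \<rho>(5), of N] by (simp add: N_def mult.assoc)
    finally have 3: "\<theta> * B r r / 2 \<le> c / 16 * N"
      by (simp add: abs_le_iff)
    have "B (\<gamma> 0) r = (Q B v - Q B (\<gamma> 0)) + g \<theta> - B r r / 2 - B (\<gamma> \<theta> - \<gamma> 0) r"
      unfolding Q_v by (simp add: g_def blinfun.bilinear_simps)
    moreover have "\<bar>B r r / 2\<bar> \<le> m / 2 * norm r"
    proof -
      have "\<bar>B r r\<bar> \<le> b * k * norm r"
        using Bb[of r r] v(1) \<rho>(4) b
        by (elim order_trans) (intro mult_right_mono mult_left_mono, auto simp: r_def)
      also have "\<dots> \<le> m / 2 * norm r"
        using k(3) by (intro mult_right_mono) auto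
      finally show ?thesis by simp
    qed
    moreover have "\<bar>B (\<gamma> \<theta> - \<gamma> 0) r\<bar> \<le> m / 2 * norm r"
    proof -
      have "\<bar>B (\<gamma> \<theta> - \<gamma> 0) r\<bar> \<le> b * k * norm r"
        using Bb[of "\<gamma> \<theta> - \<gamma> 0" r] near b
        by (elim order_trans) (intro mult_right_mono mult_left_mono, auto)
      also have "\<dots> \<le> m / 2 * norm r"
        using k(3) by (intro mult_right_mono) auto
      finally show ?thesis .
    qed
    ultimately have "\<bar>B (\<gamma> 0) r\<bar> \<le> \<eta> + \<bar>g \<theta>\<bar> + m * norm r"
      using \<eta>(2) by linarith
    then have "(B (\<gamma> 0) r)\<^sup>2 \<le> (\<eta> + \<bar>g \<theta>\<bar> + m * norm r)\<^sup>2"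
      by (metis abs_ge_zero power2_abs power_mono)
    also have "\<dots> \<le> 3 * \<eta>\<^sup>2 + 3 * (g \<theta>)\<^sup>2 + 3 * (m\<^sup>2 * N)"
    proof -
      have "(x + y + z)\<^sup>2 \<le> 3 * x\<^sup>2 + 3 * y\<^sup>2 + 3 * z\<^sup>2" for x y z :: real
        using zero_le_power2[of "x - y"] zero_le_power2[of "y - z"] zero_le_power2[of "x - z"]
        by (simp add: power2_eq_square algebra_simps)
      from this[of \<eta> "\<bar>g \<theta>\<bar>" "m * norm r"] show ?thesis
        by (simp add: N_def power_mult_distrib)
    qed
    finally have "C / 2 * (B (\<gamma> 0) r)\<^sup>2 \<le> C / 2 * (3 * \<eta>\<^sup>2 + 3 * (g \<theta>)\<^sup>2 + 3 * (m\<^sup>2 * N))"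
      using C by (intro mult_left_mono) auto
    also have "\<dots> = 3 * C / 2 * \<eta>\<^sup>2 + 3 * C / 2 * (g \<theta>)\<^sup>2 + 3 * C / 2 * m\<^sup>2 * N"
      by (simp add: algebra_simps)
    also have "\<dots> \<le> 2 * C * \<eta> + 2 * C * (g \<theta>)\<^sup>2 + c / 8 * N"
    proof (intro add_mono)
      have "\<eta>\<^sup>2 \<le> \<eta>"
        using \<eta> by (auto simp: power2_eq_square intro!: mult_left_le)
      then show "3 * C / 2 * \<eta>\<^sup>2 \<le> 2 * C * \<eta>"
        using C \<eta>(1) by (intro mult_mono) auto
      show "3 * C / 2 * (g \<theta>)\<^sup>2 \<le> 2 * C * (g \<theta>)\<^sup>2"
        using C by (intro mult_right_mono) auto
      show "3 * C / 2 * m\<^sup>2 * N \<le> c / 8 * N"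
        using m(2) by (intro mult_right_mono) (auto simp: N_def)
    qed
    finally have 4: "C / 2 * (B (\<gamma> 0) r)\<^sup>2 \<le> 2 * C * \<eta> + 2 * C * (g \<theta>)\<^sup>2 + c / 8 * N" .
    have 5: "c / 2 * N - C / 2 * (B (\<gamma> 0) r)\<^sup>2 \<le> S'' E B \<omega> (\<gamma> 0) r r / 2"
      using coercive[of r] v(2) by (simp add: N_def r_def)
    \<comment> \<open>Of \<open>c / 2 * N\<close>, the penalty takes \<open>c / 8 * N\<close>; the
      Taylor error and the change of the frequency by \<open>\<theta>\<close> take
      \<open>c / 16 * N\<close> each.\<close>
    have "D \<theta> + c / 4 * N \<le> (2 + \<bar>\<omega>\<bar>) * \<eta> + 2 * C * \<eta> + 2 * C * (g \<theta>)\<^sup>2"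
      using 1 2 3 4 5 \<eta>(1) by (simp add: algebra_simps abs_le_iff)
    also have "\<dots> \<le> K * (\<eta> + (g \<theta>)\<^sup>2)"
      by (simp add: K_def algebra_simps)
    finally have "D \<theta> + c / 4 * N \<le> K * (\<eta> + (g \<theta>)\<^sup>2)" .
    moreover have "c / 8 * N \<le> c / 4 * N"
      using c by (intro mult_right_mono) (auto simp: N_def)
    ultimately show ?thesis
      unfolding N_def r_def by linarith
  qed
  with \<rho>(1) K show ?thesis by blast
qed

text \<open>The radius of the tube is fixed before \<open>\<epsilon>\<close>: trapping will use that
  a state in a fixed tube already lies in a thinner one. The set \<open>I\<close> of admissible
  parameters lets one argument serve both cases.\<close>

lemma orbital_control:
  fixes \<gamma> :: "real \<Rightarrow> 'x" and \<omega> :: real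
  defines "D \<equiv> \<lambda>\<theta>. S E B (\<omega> + \<theta>) (\<gamma> \<theta>) - S E B \<omega> (\<gamma> 0) + \<theta> * Q B (\<gamma> 0)"
    and "g \<equiv> \<lambda>\<theta>. Q B (\<gamma> 0) - Q B (\<gamma> \<theta>)"
  assumes l: "0 < l" and critical: "\<And>\<theta>. \<bar>\<theta>\<bar> < l \<Longrightarrow> fderiv E (\<gamma> \<theta>) = (\<omega> + \<theta>) *\<^sub>R B (\<gamma> \<theta>)"
    and cont: "isCont \<gamma> 0"
    and coercive: "\<exists>c>0. \<exists>C\<ge>0. \<forall>r\<in>V. c * (norm r)\<^sup>2 - C * (B (\<gamma> 0) r)\<^sup>2 \<le> S'' E B \<omega> (\<gamma> 0) r r"
    and modulation: "\<And>\<rho>. 0 < \<rho> \<Longrightarrow> \<exists>\<delta>>0. \<forall>v. norm (v - \<gamma> 0) < \<delta> \<longrightarrow>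
      (\<exists>s \<theta>. \<theta> \<in> I \<and> \<bar>\<theta>\<bar> \<le> \<rho> \<and> norm (T s v - \<gamma> \<theta>) \<le> \<rho> \<and> T s v - \<gamma> \<theta> \<in> V)"
    and g_D: "\<And>\<kappa>. 0 < \<kappa> \<Longrightarrow> \<exists>\<rho>>0. \<forall>\<theta>\<in>I. \<bar>\<theta>\<bar> \<le> \<rho> \<longrightarrow> (g \<theta>)\<^sup>2 \<le> \<kappa> * D \<theta>"
    and l': "0 < l'" and D_separates: "\<And>\<epsilon>. 0 < \<epsilon> \<Longrightarrow>
      \<exists>\<eta>>0. \<forall>\<theta>\<in>I. \<bar>\<theta>\<bar> \<le> l' \<longrightarrow> D \<theta> < \<eta> \<longrightarrow> norm (\<gamma> \<theta> - \<gamma> 0) < \<epsilon>"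
  shows "\<exists>\<epsilon>\<^sub>0>0. \<forall>\<epsilon>>0. \<exists>\<eta>>0. \<forall>v. (\<exists>s. norm (v - T s (\<gamma> 0)) < \<epsilon>\<^sub>0) \<longrightarrow>
    \<bar>E v - E (\<gamma> 0)\<bar> \<le> \<eta> \<longrightarrow> \<bar>Q B v - Q B (\<gamma> 0)\<bar> \<le> \<eta> \<longrightarrow> (\<exists>s. norm (v - T s (\<gamma> 0)) < \<epsilon>)"
proof -
  obtain c C where c: "0 < c" and C: "0 \<le> C"
    and cC: "\<And>r. r \<in> V \<Longrightarrow> c * (norm r)\<^sup>2 - C * (B (\<gamma> 0) r)\<^sup>2 \<le> S'' E B \<omega> (\<gamma> 0) r r"
    using coercive by blast
  obtain \<rho>1 K where \<rho>1: "0 < \<rho>1" and K: "0 \<le> K"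
    and estimate: "\<And>\<theta> v \<eta>. \<bar>\<theta>\<bar> \<le> \<rho>1 \<Longrightarrow> norm (v - \<gamma> \<theta>) \<le> \<rho>1 \<Longrightarrow> v - \<gamma> \<theta> \<in> V \<Longrightarrow>
      \<bar>E v - E (\<gamma> 0)\<bar> \<le> \<eta> \<Longrightarrow> \<bar>Q B v - Q B (\<gamma> 0)\<bar> \<le> \<eta> \<Longrightarrow> \<eta> \<le> 1 \<Longrightarrow>
      D \<theta> + c / 8 * (norm (v - \<gamma> \<theta>))\<^sup>2 \<le> K * (\<eta> + (g \<theta>)\<^sup>2)"
    using energy_estimate[OF l critical cont c C cC] unfolding D_def g_def by metis
  \<comment> \<open>With \<open>K * \<kappa> \<le> 1 / 2\<close>, half of \<open>D \<theta>\<close>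
    absorbs \<open>K * (g \<theta>)\<^sup>2\<close>.\<close>
  define \<kappa> where "\<kappa> = 1 / (2 * (K + 1))"
  have \<kappa>: "0 < \<kappa>" "K * \<kappa> \<le> 1 / 2"
    using K by (auto simp: \<kappa>_def field_simps)
  obtain \<rho>2 where \<rho>2: "0 < \<rho>2" "\<And>\<theta>. \<theta> \<in> I \<Longrightarrow> \<bar>\<theta>\<bar> \<le> \<rho>2 \<Longrightarrow> (g \<theta>)\<^sup>2 \<le> \<kappa> * D \<theta>"
    using g_D[OF \<kappa>(1)] by blast
  define \<rho> where "\<rho> = Min {\<rho>1, \<rho>2, l'}"
  have \<rho>: "0 < \<rho>" "\<rho> \<le> \<rho>1" "\<rho> \<le> \<rho>2" "\<rho> \<le> l'"
    using \<rho>1 \<rho>2(1) l' by (auto simp: \<rho>_def)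
  obtain \<delta> where \<delta>: "0 < \<delta>" "\<And>v. norm (v - \<gamma> 0) < \<delta> \<Longrightarrow>
      \<exists>s \<theta>. \<theta> \<in> I \<and> \<bar>\<theta>\<bar> \<le> \<rho> \<and> norm (T s v - \<gamma> \<theta>) \<le> \<rho> \<and> T s v - \<gamma> \<theta> \<in> V"
    using modulation[OF \<rho>(1)] by blast
  have "\<exists>\<eta>>0. \<forall>v. (\<exists>s. norm (v - T s (\<gamma> 0)) < \<delta>) \<longrightarrow>
    \<bar>E v - E (\<gamma> 0)\<bar> \<le> \<eta> \<longrightarrow> \<bar>Q B v - Q B (\<gamma> 0)\<bar> \<le> \<eta> \<longrightarrow> (\<exists>s. norm (v - T s (\<gamma> 0)) < \<epsilon>)"
    if \<epsilon>: "0 < \<epsilon>" for \<epsilon>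
  proof -
    obtain \<eta>1 where \<eta>1: "0 < \<eta>1"
      "\<And>\<theta>. \<theta> \<in> I \<Longrightarrow> \<bar>\<theta>\<bar> \<le> l' \<Longrightarrow> D \<theta> < \<eta>1 \<Longrightarrow> norm (\<gamma> \<theta> - \<gamma> 0) < \<epsilon> / 2"
      using D_separates[of "\<epsilon> / 2"] \<epsilon> by auto
    \<comment> \<open>The second entry makes \<open>D \<theta>\<close> small enough for
      \<open>D_separates\<close>, the third makes \<open>norm (w - \<gamma> \<theta>)\<close> less
      than \<open>\<epsilon> / 2\<close>.\<close>
    define \<eta> where "\<eta> = Min {1, \<eta>1 / (4 * (K + 1)), c * \<epsilon>\<^sup>2 / (64 * (K + 1))}"
    have \<eta>: "0 < \<eta>" "\<eta> \<le> 1" "K * \<eta> < \<eta>1 / 2" "K * \<eta> < c / 8 * (\<epsilon> / 2)\<^sup>2"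
    proof -
      show \<eta>0: "0 < \<eta>" "\<eta> \<le> 1"
        using \<eta>1(1) c \<epsilon> K by (auto simp: \<eta>_def)
      have "\<eta> \<le> \<eta>1 / (4 * (K + 1))" "\<eta> \<le> c * \<epsilon>\<^sup>2 / (64 * (K + 1))"
        by (simp_all add: \<eta>_def)
      then have "(K + 1) * \<eta> \<le> \<eta>1 / 4" "(K + 1) * \<eta> \<le> c * \<epsilon>\<^sup>2 / 64"
        using K by (simp_all add: field_simps)
      moreover have "K * \<eta> \<le> (K + 1) * \<eta>"
        using \<eta>0 by (simp add: algebra_simps)
      moreover have "0 < c * \<epsilon>\<^sup>2"
        using c \<epsilon> by simp
      ultimately show "K * \<eta> < \<eta>1 / 2" "K * \<eta> < c / 8 * (\<epsilon> / 2)\<^sup>2"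
        using \<eta>1(1) by (simp_all add: power_divide)
    qed
    have "\<exists>s. norm (v - T s (\<gamma> 0)) < \<epsilon>"
      if v: "norm (v - T s0 (\<gamma> 0)) < \<delta>" "\<bar>E v - E (\<gamma> 0)\<bar> \<le> \<eta>" "\<bar>Q B v - Q B (\<gamma> 0)\<bar> \<le> \<eta>" for v s0
    proof -
      have "norm (T (- s0) v - \<gamma> 0) < \<delta>"
        using v(1) by (simp add: T_norm_diff)
      then obtain s \<theta> where s\<theta>: "\<theta> \<in> I" "\<bar>\<theta>\<bar> \<le> \<rho>"
        "norm (T s (T (- s0) v) - \<gamma> \<theta>) \<le> \<rho>" "T s (T (- s0) v) - \<gamma> \<theta> \<in> V"
        using \<delta>(2) by blast
      define w where "w = T s (T (- s0) v)"
      have w: "E w = E v" "Q B w = Q B v"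
        by (simp_all add: w_def E_invariant Q_T)
      have "D \<theta> + c / 8 * (norm (w - \<gamma> \<theta>))\<^sup>2 \<le> K * (\<eta> + (g \<theta>)\<^sup>2)"
        using s\<theta> v(2,3) \<rho> \<eta>(2) by (intro estimate) (auto simp: w simp flip: w_def)
      also have "\<dots> \<le> K * (\<eta> + \<kappa> * D \<theta>)"
        using s\<theta>(1,2) \<rho>(3) K by (intro mult_left_mono add_left_mono \<rho>2(2)) auto
      finally have "D \<theta> + c / 8 * (norm (w - \<gamma> \<theta>))\<^sup>2 \<le> K * \<eta> + K * \<kappa> * D \<theta>"
        by (simp add: algebra_simps)
      moreover have D: "0 \<le> D \<theta>"
      proof -
        have "0 \<le> \<kappa> * D \<theta>"
          using \<rho>2(2)[OF s\<theta>(1)] s\<theta>(2) \<rho>(3) by (meson order_trans zero_le_power2)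
        then show ?thesis
          using \<kappa>(1) by (simp add: zero_le_mult_iff)
      qed
      moreover have "K * \<kappa> * D \<theta> \<le> 1 / 2 * D \<theta>"
        using \<kappa>(2) D by (intro mult_right_mono)
      ultimately have *: "D \<theta> / 2 + c / 8 * (norm (w - \<gamma> \<theta>))\<^sup>2 \<le> K * \<eta>"
        by linarith
      moreover have "0 \<le> c / 8 * (norm (w - \<gamma> \<theta>))\<^sup>2"
        using c by simp
      ultimately have "D \<theta> < \<eta>1"
        using \<eta>(3) by linarith
      then have near: "norm (\<gamma> \<theta> - \<gamma> 0) < \<epsilon> / 2"
        using s\<theta>(1,2) \<rho>(4) by (intro \<eta>1(2)) auto
      have "c / 8 * (norm (w - \<gamma> \<theta>))\<^sup>2 < c / 8 * (\<epsilon> / 2)\<^sup>2"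
        using * D \<eta>(4) by linarith
      then have "(norm (w - \<gamma> \<theta>))\<^sup>2 < (\<epsilon> / 2)\<^sup>2"
        using c by simp
      then have "norm (w - \<gamma> \<theta>) < \<epsilon> / 2"
        by (rule power2_less_imp_less) (use \<epsilon> in simp)
      then have "norm (w - \<gamma> 0) < \<epsilon>"
        using near norm_triangle_ineq[of "w - \<gamma> \<theta>" "\<gamma> \<theta> - \<gamma> 0"] by simp
      moreover have "w = T (s - s0) v"
        using T_add[of s "- s0" v] by (simp add: w_def)
      ultimately have "norm (v - T (- (s - s0)) (\<gamma> 0)) < \<epsilon>"
        by (simp only: T_norm_diff)
      then show ?thesis by blast
    qed
    with \<eta>(1) show ?thesis by blast
  qed
  with \<delta>(1) show ?thesis by blast
qed

end

section \<open>Continuation of trapped solutions\<close>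

lemma is_solution_subset:
  assumes "is_solution iX iY JY E I u" and "I' \<subseteq> I"
  shows "is_solution iX iY JY E I' u"
  using assms
  by (auto simp: is_solution_def intro: continuous_on_subset has_vector_derivative_within_subset)

lemma is_solution_cong:
  assumes "is_solution iX iY JY E I u" and "\<And>t. t \<in> I \<Longrightarrow> v t = u t"
  shows "is_solution iX iY JY E I v"
  unfolding is_solution_def
proof (intro conjI ballI)
  show "continuous_on I v" "continuous_on I (\<lambda>t. J_dual JY (fderiv E (v t)))"
    using assms by (simp_all add: is_solution_def cong: continuous_on_cong)
  fix t assume t: "t \<in> I"
  then have "((\<lambda>t. to_dual iY (iX (u t))) has_vector_derivative J_dual JY (fderiv E (u t))) (at t within I)"
    using assms(1) by (simp add: is_solution_def)
  then have "((\<lambda>t. to_dual iY (iX (v t))) has_vector_derivative J_dual JY (fderiv E (u t))) (at t within I)"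
    by (rule has_vector_derivative_transform[OF t, rotated]) (simp add: assms(2))
  then show "((\<lambda>t. to_dual iY (iX (v t))) has_vector_derivative J_dual JY (fderiv E (v t))) (at t within I)"
    by (simp add: assms(2) t)
qed

lemma is_solution_shift:
  assumes "is_solution iX iY JY E {0..h} u"
  shows "is_solution iX iY JY E {r..r + h} (\<lambda>t. u (t - r))"
  unfolding is_solution_def
proof (intro conjI ballI)
  have shift: "continuous_on {r..r + h} (\<lambda>t. t - r)" "(\<lambda>t. t - r) ` {r..r + h} \<subseteq> {0..h}"
    by (auto intro: continuous_intros)
  show "continuous_on {r..r + h} (\<lambda>t. u (t - r))"
    using assms by (intro continuous_on_compose2[OF _ shift]) (simp add: is_solution_def)
  show "continuous_on {r..r + h} (\<lambda>t. J_dual JY (fderiv E (u (t - r))))"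
    using assms
    by (intro continuous_on_compose2[of "{0..h}" "\<lambda>t. J_dual JY (fderiv E (u t))", OF _ shift])
      (simp add: is_solution_def)
  fix t assume t: "t \<in> {r..r + h}"
  have image: "(\<lambda>t. t - r) ` {r..r + h} = {0..h}"
    by (auto simp: image_iff intro!: bexI[of _ "_ + r"])
  have "((\<lambda>t. to_dual iY (iX (u t))) has_vector_derivative J_dual JY (fderiv E (u (t - r))))
      (at (t - r) within (\<lambda>t. t - r) ` {r..r + h})"
    using assms t unfolding image by (simp add: is_solution_def)
  then have "((\<lambda>t. to_dual iY (iX (u t))) \<circ> (\<lambda>t. t - r) has_vector_derivative 1 *\<^sub>R J_dual JY (fderiv E (u (t - r))))
      (at t within {r..r + h})"
    by (intro vector_diff_chain_within) (auto intro!: derivative_eq_intros)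
  then show "((\<lambda>t. to_dual iY (iX (u (t - r)))) has_vector_derivative J_dual JY (fderiv E (u (t - r))))
      (at t within {r..r + h})"
    by (simp add: o_def)
qed

text \<open>At \<open>b\<close> the equation expresses both one-sided derivatives through the common
  state, so they agree.\<close>

lemma is_solution_join:
  assumes u: "is_solution iX iY JY E {a..b} u" and v: "is_solution iX iY JY E {b..c} v"
    and ab: "a \<le> b" "b \<le> c" and join: "u b = v b"
  shows "is_solution iX iY JY E {a..c} (\<lambda>t. if t \<in> {a..b} then u t else v t)" (is "is_solution _ _ _ _ _ ?w")
  unfolding is_solution_def
proof (intro conjI ballI)
  have union: "{a..c} = {a..b} \<union> {b..c}"
    using ab by auto
  have eq: "u t = v t" if "t \<in> {a..b}" "t \<in> {b..c}" for t
    using that join by auto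
  show "continuous_on {a..c} ?w"
    unfolding union using u v eq
    by (intro continuous_on_cases closed_real_atLeastAtMost) (auto simp: is_solution_def)
  have "continuous_on {a..c} (\<lambda>t. if t \<in> {a..b} then J_dual JY (fderiv E (u t)) else J_dual JY (fderiv E (v t)))"
    unfolding union using u v eq
    by (intro continuous_on_cases closed_real_atLeastAtMost) (auto simp: is_solution_def)
  then show "continuous_on {a..c} (\<lambda>t. J_dual JY (fderiv E (?w t)))"
    by (simp only: if_distrib[of "\<lambda>x. J_dual JY (fderiv E x)"])
  fix t assume t: "t \<in> {a..c}"
  let ?U = "\<lambda>t. to_dual iY (iX (u t))" and ?V = "\<lambda>t. to_dual iY (iX (v t))"
  let ?U' = "\<lambda>t. J_dual JY (fderiv E (u t))" and ?V' = "\<lambda>t. J_dual JY (fderiv E (v t))"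
  have cl: "{a..b} \<union> (closure {a..b} \<inter> closure {b..c}) = {a..b}"
    "{b..c} \<union> (closure {a..b} \<inter> closure {b..c}) = {b..c}"
    by auto
  have "((\<lambda>t. if t \<in> {a..b} then ?U t else ?V t) has_vector_derivative
      (if t \<in> {a..b} then ?U' t else ?V' t)) (at t within {a..c})"
  proof (rule has_vector_derivative_If_within_closures[OF _ union])
    show "t \<in> {a..b} \<union> {b..c}"
      using t union by blast
    show "(?U has_vector_derivative ?U' t) (at t within {a..b} \<union> (closure {a..b} \<inter> closure {b..c}))"
      if "t \<in> {a..b} \<union> (closure {a..b} \<inter> closure {b..c})"
      using u that unfolding cl is_solution_def by blast
    show "(?V has_vector_derivative ?V' t) (at t within {b..c} \<union> (closure {a..b} \<inter> closure {b..c}))"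
      if "t \<in> {b..c} \<union> (closure {a..b} \<inter> closure {b..c})"
      using v that unfolding cl is_solution_def by blast
  qed (use eq[of t] in auto)
  then show "((\<lambda>t. to_dual iY (iX (?w t))) has_vector_derivative J_dual JY (fderiv E (?w t))) (at t within {a..c})"
    by (simp only: if_distrib[of "\<lambda>x. to_dual iY (iX x)"] if_distrib[of "\<lambda>x. J_dual JY (fderiv E x)"])
qed

text \<open>All conditions are local, and \<open>{0..<t + 1}\<close> is a neighbourhood of
  \<open>t\<close> in \<open>{0..}\<close>.\<close>

lemma is_solution_unbounded:
  assumes "\<And>b. is_solution iX iY JY E {0..<b} u"
  shows "is_solution iX iY JY E {0..} u"
proof -
  have at_eq: "at t within {0..<t + 1} = at t within {0..}" for t :: real
    by (rule at_within_nhd[of t "{..<t + 1}"]) auto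
  show ?thesis
    unfolding is_solution_def continuous_on_eq_continuous_within
  proof (intro conjI ballI)
    fix t :: real assume "t \<in> {0..}"
    then have "t \<in> {0..<t + 1}" by simp
    then show "continuous (at t within {0..}) u"
      "continuous (at t within {0..}) (\<lambda>t. J_dual JY (fderiv E (u t)))"
      "((\<lambda>t. to_dual iY (iX (u t))) has_vector_derivative J_dual JY (fderiv E (u t))) (at t within {0..})"
      using assms[of "t + 1"] unfolding at_eq[symmetric] is_solution_def continuous_on_eq_continuous_within
      by blast+
  qed
qed

context hamiltonian_system
begin

text \<open>At a time when the distance to the orbit equals \<open>\<epsilon>\<close>, it is below
  \<open>\<epsilon>\<^sub>0\<close>, and the control makes it strictly less than
  \<open>\<epsilon>\<close>; by continuity it can never reach \<open>\<epsilon>\<close>.\<close>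

lemma solution_trapped:
  fixes u :: "real \<Rightarrow> 'x"
  assumes control: "\<And>v. (\<exists>s. norm (v - T s \<phi>) < \<epsilon>\<^sub>0) \<Longrightarrow> \<bar>E v - E \<phi>\<bar> \<le> \<eta> \<Longrightarrow> \<bar>Q B v - Q B \<phi>\<bar> \<le> \<eta> \<Longrightarrow>
      (\<exists>s. norm (v - T s \<phi>) < \<epsilon>)"
    and "\<epsilon> < \<epsilon>\<^sub>0"
    and u: "continuous_on {0..r} u" "norm (u 0 - \<phi>) < \<epsilon>"
    and conserved: "\<And>t. t \<in> {0..r} \<Longrightarrow> \<bar>E (u t) - E \<phi>\<bar> \<le> \<eta> \<and> \<bar>Q B (u t) - Q B \<phi>\<bar> \<le> \<eta>"
    and t: "t \<in> {0..r}"
  shows "\<exists>s. norm (u t - T s \<phi>) < \<epsilon>"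
proof -
  define orb where "orb = range (\<lambda>s. T s \<phi>)"
  have infdist_less: "infdist v orb < e \<longleftrightarrow> (\<exists>s. norm (v - T s \<phi>) < e)" for v e
  proof
    assume "infdist v orb < e"
    then show "\<exists>s. norm (v - T s \<phi>) < e"
      using cInf_lessD[of "(\<lambda>a. dist v a) ` orb" e]
      by (auto simp: infdist_def orb_def dist_norm split: if_splits)
  next
    assume "\<exists>s. norm (v - T s \<phi>) < e"
    then obtain s where "norm (v - T s \<phi>) < e" by blast
    moreover have "infdist v orb \<le> dist v (T s \<phi>)"
      by (rule infdist_le) (simp add: orb_def)
    ultimately show "infdist v orb < e"
      by (simp add: dist_norm)
  qed
  have "infdist (u t) orb < \<epsilon>"
  proof (rule ccontr)
    assume "\<not> infdist (u t) orb < \<epsilon>"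
    moreover have "infdist (u 0) orb < \<epsilon>"
      unfolding infdist_less using u(2) by (intro exI[of _ 0]) simp
    moreover have "continuous_on {0..t} (\<lambda>t. infdist (u t) orb)"
      using t by (intro continuous_on_infdist continuous_on_subset[OF u(1)]) auto
    ultimately obtain t' where t': "0 \<le> t'" "t' \<le> t" "infdist (u t') orb = \<epsilon>"
      using IVT'[of "\<lambda>t. infdist (u t) orb" 0 \<epsilon> t] t by auto
    then have "infdist (u t') orb < \<epsilon>\<^sub>0"
      using \<open>\<epsilon> < \<epsilon>\<^sub>0\<close> by simp
    then have "infdist (u t') orb < \<epsilon>"
      unfolding infdist_less using conserved[of t'] t t' by (intro control) auto
    with t'(3) show False by simp
  qed
  then show ?thesis
    unfolding infdist_less .
qed

text \<open>The group is isometric, so trapping bounds the norm by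
  \<open>norm \<phi> + \<epsilon>'\<close> and the Cauchy problem provides one time step for all
  restarts. The conservation laws belong to the induction because they trap each extended
  solution.\<close>

lemma stable_of_control:
  assumes control: "\<exists>\<epsilon>\<^sub>0>0. \<forall>\<epsilon>>0. \<exists>\<eta>>0. \<forall>v. (\<exists>s. norm (v - T s \<phi>) < \<epsilon>\<^sub>0) \<longrightarrow>
      \<bar>E v - E \<phi>\<bar> \<le> \<eta> \<longrightarrow> \<bar>Q B v - Q B \<phi>\<bar> \<le> \<eta> \<longrightarrow> (\<exists>s. norm (v - T s \<phi>) < \<epsilon>)"
    and cauchy_problem: "\<forall>\<mu>>0. \<exists>r>0. \<forall>u\<^sub>0. norm u\<^sub>0 \<le> \<mu> \<longrightarrow>
        (\<exists>u. is_solution iX iY JY E {0..<r} u \<and> u 0 = u\<^sub>0 \<and>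
          (\<forall>t\<in>{0<..<r}. E (u t) = E u\<^sub>0 \<and> Q B (u t) = Q B u\<^sub>0))"
  shows "bound_state_stable iX iY JY T E B \<phi>"
  unfolding bound_state_stable_def
proof (intro allI impI)
  fix \<epsilon> :: real assume \<epsilon>: "0 < \<epsilon>"
  obtain \<epsilon>\<^sub>0 where \<epsilon>\<^sub>0: "0 < \<epsilon>\<^sub>0" "\<And>\<epsilon>. 0 < \<epsilon> \<Longrightarrow> \<exists>\<eta>>0. \<forall>v. (\<exists>s. norm (v - T s \<phi>) < \<epsilon>\<^sub>0) \<longrightarrow>
      \<bar>E v - E \<phi>\<bar> \<le> \<eta> \<longrightarrow> \<bar>Q B v - Q B \<phi>\<bar> \<le> \<eta> \<longrightarrow> (\<exists>s. norm (v - T s \<phi>) < \<epsilon>)"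
    using control by blast
  \<comment> \<open>Strictly below \<open>\<epsilon>\<close>, because a supremum of values below
    \<open>\<epsilon>'\<close> is only known to be at most \<open>\<epsilon>'\<close>.\<close>
  define \<epsilon>' where "\<epsilon>' = min (\<epsilon> / 2) (\<epsilon>\<^sub>0 / 2)"
  have \<epsilon>': "0 < \<epsilon>'" "\<epsilon>' < \<epsilon>" "\<epsilon>' < \<epsilon>\<^sub>0"
    using \<epsilon> \<epsilon>\<^sub>0(1) by (auto simp: \<epsilon>'_def)
  obtain \<eta> where \<eta>: "0 < \<eta>" "\<And>v. (\<exists>s. norm (v - T s \<phi>) < \<epsilon>\<^sub>0) \<Longrightarrow> \<bar>E v - E \<phi>\<bar> \<le> \<eta> \<Longrightarrow>
      \<bar>Q B v - Q B \<phi>\<bar> \<le> \<eta> \<Longrightarrow> (\<exists>s. norm (v - T s \<phi>) < \<epsilon>')"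
    using \<epsilon>\<^sub>0(2)[OF \<epsilon>'(1)] by blast
  have "isCont E \<phi>" "isCont (Q B) \<phi>"
    using C2_has_derivative(1)[OF E_C2] Q_has_derivative by (blast intro: has_derivative_continuous)+
  then obtain \<delta>1 \<delta>2 where \<delta>1: "0 < \<delta>1" "\<And>v. norm (v - \<phi>) < \<delta>1 \<Longrightarrow> \<bar>E v - E \<phi>\<bar> < \<eta>"
    and \<delta>2: "0 < \<delta>2" "\<And>v. norm (v - \<phi>) < \<delta>2 \<Longrightarrow> \<bar>Q B v - Q B \<phi>\<bar> < \<eta>"
    using \<eta>(1) unfolding continuous_at_eps_delta dist_norm real_norm_def by (elim allE[of _ \<eta>]) blast
  define \<delta> where "\<delta> = Min {\<delta>1, \<delta>2, \<epsilon>'}"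
  have \<delta>: "0 < \<delta>" "\<delta> \<le> \<delta>1" "\<delta> \<le> \<delta>2" "\<delta> \<le> \<epsilon>'"
    using \<delta>1(1) \<delta>2(1) \<epsilon>'(1) by (auto simp: \<delta>_def)
  define \<mu> where "\<mu> = norm \<phi> + \<epsilon>'"
  have "0 < \<mu>"
    using \<epsilon>'(1) by (simp add: \<mu>_def add_nonneg_pos)
  then obtain \<rho> where \<rho>: "0 < \<rho>" "\<And>u\<^sub>0. norm u\<^sub>0 \<le> \<mu> \<Longrightarrow>
      \<exists>u. is_solution iX iY JY E {0..<\<rho>} u \<and> u 0 = u\<^sub>0 \<and>
          (\<forall>t\<in>{0<..<\<rho>}. E (u t) = E u\<^sub>0 \<and> Q B (u t) = Q B u\<^sub>0)"
    using cauchy_problem by blast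
  \<comment> \<open>Local solutions live on half-open intervals; half of the length leaves a closed
    one, whose endpoint is the next initial state.\<close>
  define h where "h = \<rho> / 2"
  have h: "0 < h" "h < \<rho>"
    using \<rho>(1) by (auto simp: h_def)
  have "\<exists>w. is_solution iX iY JY E {0..} w \<and> (\<forall>t\<in>{0..r}. w t = u t) \<and>
        (SUP t\<in>{0<..}. ereal (INF s. norm (w t - T s \<phi>))) < ereal \<epsilon>"
    if u\<^sub>0: "norm (u\<^sub>0 - \<phi>) < \<delta>" and r: "0 < r" and u: "is_solution iX iY JY E {0..r} u" "u 0 = u\<^sub>0"
      and u_conserved: "\<forall>t\<in>{0..r}. E (u t) = E u\<^sub>0 \<and> Q B (u t) = Q B u\<^sub>0" for u\<^sub>0 r u
  proof -
    define P where "P n w \<longleftrightarrow> is_solution iX iY JY E {0..r + real n * h} w \<and>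
      (\<forall>t\<in>{0..r + real n * h}. E (w t) = E u\<^sub>0 \<and> Q B (w t) = Q B u\<^sub>0) \<and> (\<forall>t\<in>{0..r}. w t = u t)" for n w
    have trapped: "\<exists>s. norm (w t - T s \<phi>) < \<epsilon>'" if w: "P n w" and t: "t \<in> {0..r + real n * h}" for n w t
    proof (rule solution_trapped[OF \<eta>(2) \<epsilon>'(3) _ _ _ t])
      show "continuous_on {0..r + real n * h} w"
        using w by (simp add: P_def is_solution_def)
      have "w 0 = u\<^sub>0"
        using w u(2) r by (simp add: P_def)
      then show "norm (w 0 - \<phi>) < \<epsilon>'"
        using u\<^sub>0 \<delta>(4) by simp
      show "\<bar>E (w t) - E \<phi>\<bar> \<le> \<eta> \<and> \<bar>Q B (w t) - Q B \<phi>\<bar> \<le> \<eta>" if "t \<in> {0..r + real n * h}" for t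
        using w that \<delta>1(2)[of u\<^sub>0] \<delta>2(2)[of u\<^sub>0] u\<^sub>0 \<delta> by (simp add: P_def)
    qed
    have "\<exists>f. \<forall>n. P n (f n) \<and> (\<forall>t\<in>{0..r + real n * h}. f (Suc n) t = f n t)"
    proof (rule dependent_nat_choice)
      show "\<exists>w. P 0 w"
        using u u_conserved by (auto simp: P_def)
      fix w n assume w: "P n w"
      define b where "b = r + real n * h"
      have b: "0 \<le> b" "r \<le> b"
        using r h by (auto simp: b_def)
      have b_h: "b + h = r + real (Suc n) * h"
        by (simp add: b_def algebra_simps)
      obtain s where "norm (w b - T s \<phi>) < \<epsilon>'"
        using trapped[OF w, of b] b by (auto simp: b_def)
      then have "norm (w b) \<le> \<mu>"
        using norm_triangle_ineq[of "w b - T s \<phi>" "T s \<phi>"] by (simp add: \<mu>_def)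
      then obtain v where v: "is_solution iX iY JY E {0..<\<rho>} v" "v 0 = w b"
        "\<forall>t\<in>{0<..<\<rho>}. E (v t) = E (w b) \<and> Q B (v t) = Q B (w b)"
        using \<rho>(2) by blast
      have v_conserved: "E (v t) = E u\<^sub>0 \<and> Q B (v t) = Q B u\<^sub>0" if "t \<in> {0..h}" for t
        using v(2,3) w b that h by (cases "t = 0") (auto simp: P_def b_def)
      define w' where "w' t = (if t \<in> {0..b} then w t else v (t - b))" for t
      have "is_solution iX iY JY E {0..b + h} w'"
        unfolding w'_def
      proof (rule is_solution_join)
        show "is_solution iX iY JY E {0..b} w"
          using w by (simp add: P_def b_def)
        have "is_solution iX iY JY E {0..h} v"
          by (rule is_solution_subset[OF v(1)]) (use h in auto)
        then show "is_solution iX iY JY E {b..b + h} (\<lambda>t. v (t - b))"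
          by (rule is_solution_shift)
      qed (use b h v(2) in auto)
      moreover have "E (w' t) = E u\<^sub>0 \<and> Q B (w' t) = Q B u\<^sub>0" if "t \<in> {0..b + h}" for t
        using w v_conserved[of "t - b"] that by (auto simp: w'_def P_def b_def)
      moreover have "w' t = u t" if "t \<in> {0..r}" for t
        using w that b by (auto simp: w'_def P_def)
      ultimately have "P (Suc n) w'"
        unfolding P_def b_h[symmetric] by blast
      moreover have "\<forall>t\<in>{0..r + real n * h}. w' t = w t"
        by (simp add: w'_def b_def)
      ultimately show "\<exists>w'. P (Suc n) w' \<and> (\<forall>t\<in>{0..r + real n * h}. w' t = w t)"
        by blast
    qed
    then obtain f where f: "\<And>n. P n (f n)" "\<And>n t. t \<in> {0..r + real n * h} \<Longrightarrow> f (Suc n) t = f n t"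
      by blast
    have f_mono: "f m t = f n t" if "n \<le> m" "t \<in> {0..r + real n * h}" for m n t
      using that(1)
    proof (induction m rule: dec_induct)
      case (step m)
      have "real n * h \<le> real m * h"
        using step.hyps h by (intro mult_right_mono) auto
      then have "f (Suc m) t = f m t"
        using that(2) by (intro f(2)) auto
      with step.IH show ?case by simp
    qed simp
    define N where "N t = nat \<lceil>t / h\<rceil>" for t
    have N: "t \<in> {0..r + real (N t) * h}" if "0 \<le> t" for t
    proof -
      have "t / h \<le> real (N t)"
        unfolding N_def by (rule real_nat_ceiling_ge)
      then show ?thesis
        using that h r by (simp add: field_simps)
    qed
    \<comment> \<open>By \<open>f_mono\<close> every index whose interval contains \<open>t\<close>
      gives the same value.\<close>
    define w where "w t = f (N t) t" for t
    have w_eq: "w t = f n t" if "t \<in> {0..r + real n * h}" for n t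
      using f_mono[of n "N t" t] f_mono[of "N t" n t] N[of t] that by (auto simp: w_def dest: linear[THEN disjE])
    have "is_solution iX iY JY E {0..} w"
    proof (rule is_solution_unbounded)
      fix b :: real
      have "{0..<b} \<subseteq> {0..r + real (N (max 0 b)) * h}"
        using N[of "max 0 b"] by auto
      then have "is_solution iX iY JY E {0..<b} (f (N (max 0 b)))"
        using f(1)[of "N (max 0 b)"] is_solution_subset by (auto simp: P_def)
      then show "is_solution iX iY JY E {0..<b} w"
        by (rule is_solution_cong) (use \<open>{0..<b} \<subseteq> _\<close> in \<open>auto intro!: w_eq\<close>)
    qed
    moreover have "\<forall>t\<in>{0..r}. w t = u t"
      using w_eq[of _ 0] f(1)[of 0] by (auto simp: P_def)
    moreover have "(SUP t\<in>{0<..}. ereal (INF s. norm (w t - T s \<phi>))) \<le> ereal \<epsilon>'"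
    proof (rule SUP_least)
      fix t :: real assume "t \<in> {0<..}"
      then have t: "t \<in> {0..r + real (N t) * h}"
        by (intro N) simp
      obtain s where "norm (w t - T s \<phi>) < \<epsilon>'"
        using trapped[OF f(1) t] by (auto simp: w_def)
      moreover have "(INF s. norm (w t - T s \<phi>)) \<le> norm (w t - T s \<phi>)"
        by (rule cINF_lower) (auto intro: bdd_belowI[of _ 0])
      ultimately show "ereal (INF s. norm (w t - T s \<phi>)) \<le> ereal \<epsilon>'"
        by simp
    qed
    then have "(SUP t\<in>{0<..}. ereal (INF s. norm (w t - T s \<phi>))) < ereal \<epsilon>"
      by (rule le_less_trans) (use \<epsilon>'(2) in simp)
    ultimately show ?thesis by blast
  qed
  with \<delta>(1) show "\<exists>\<delta>>0. \<forall>u\<^sub>0. norm (u\<^sub>0 - \<phi>) < \<delta> \<longrightarrow>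
      (\<forall>r>0. \<forall>u. is_solution iX iY JY E {0..r} u \<and> u 0 = u\<^sub>0 \<and>
          (\<forall>t\<in>{0..r}. E (u t) = E u\<^sub>0 \<and> Q B (u t) = Q B u\<^sub>0) \<longrightarrow>
        (\<exists>w. is_solution iX iY JY E {0..} w \<and> (\<forall>t\<in>{0..r}. w t = u t) \<and>
          (SUP t\<in>{0<..}. ereal (INF s. norm (w t - T s \<phi>))) < ereal \<epsilon>))"
    by blast
qed

end

section \<open>The family of bound states\<close>

text \<open>Strictness comes from the midpoint, where \<open>f\<close> is strictly below the chord
  but not below the tangent.\<close>

lemma strictly_convex_above_tangent:
  fixes f :: "real \<Rightarrow> real"
  assumes f: "strictly_convex_on U f" and U: "open U" "x \<in> U" "y \<in> U" "x \<noteq> y"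
    and deriv: "(f has_real_derivative f') (at x)"
  shows "f x + (y - x) * f' < f y"
proof -
  have strict: "f ((1 - t) *\<^sub>R a + t *\<^sub>R b) < (1 - t) * f a + t * f b"
    if "a \<in> U" "b \<in> U" "a \<noteq> b" "0 < t" "t < 1" for a b t
    using f that by (simp add: strictly_convex_on_def)
  have "convex_on U f"
    unfolding convex_on_def
  proof (intro conjI ballI allI impI)
    show "convex U"
      using f by (simp add: strictly_convex_on_def)
    fix a b u v :: real assume ab: "a \<in> U" "b \<in> U" "0 \<le> u" "0 \<le> v" "u + v = 1"
    show "f (u *\<^sub>R a + v *\<^sub>R b) \<le> u * f a + v * f b"
    proof (cases "a = b \<or> u = 0 \<or> v = 0")
      case True
      with ab(5) show ?thesis
        by (auto simp flip: scaleR_add_left distrib_right)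
    next
      case False
      with ab have "f ((1 - v) *\<^sub>R a + v *\<^sub>R b) < (1 - v) * f a + v * f b"
        by (intro strict) auto
      moreover have "1 - v = u"
        using ab(5) by simp
      ultimately show ?thesis by simp
    qed
  qed
  define z where "z = (1 - 1 / 2) *\<^sub>R x + (1 / 2) *\<^sub>R y"
  have z: "z = (x + y) / 2"
    by (simp add: z_def)
  have "f z < (1 - 1 / 2) * f x + 1 / 2 * f y"
    unfolding z_def using U by (intro strict) auto
  moreover have "f' * (z - x) \<le> f z - f x"
  proof (rule convex_on_imp_above_tangent[OF \<open>convex_on U f\<close>])
    show "connected U"
      using f by (simp add: strictly_convex_on_def convex_connected)
    show "x \<in> interior U"
      using U by (simp add: interior_open)
    have "convex U"
      using f by (simp add: strictly_convex_on_def)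
    then show "z \<in> U"
      unfolding z_def using U by (intro convexD) auto
    show "(f has_real_derivative f') (at x within U)"
      using deriv by (rule has_field_derivative_at_within)
  qed
  ultimately show ?thesis
    unfolding z by (simp add: field_simps)
qed

theorem theorem2:
  fixes iX :: "'x::{real_inner,banach} \<Rightarrow>\<^sub>L 'h::{real_inner,banach}"
    and iY :: "'y::{real_inner,banach} \<Rightarrow>\<^sub>L 'h"
    and J :: "'h \<Rightarrow> 'h"
    and JX :: "'x \<Rightarrow>\<^sub>L 'y"
    and JY :: "'y \<Rightarrow>\<^sub>L 'x"
    and T :: "real \<Rightarrow> 'x \<Rightarrow>\<^sub>L 'x"
    and E :: "'x \<Rightarrow> real"
    and B :: "'x \<Rightarrow>\<^sub>L ('x \<Rightarrow>\<^sub>L real)"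
    and \<phi> :: "real \<Rightarrow> 'x"
    and d :: "real \<Rightarrow> real"
    and \<omega>\<^sub>1 \<omega>\<^sub>2 \<omega> :: real
  assumes setting: "hamiltonian_system iX iY J JX JY T E B"
    and cauchy_problem:
      "\<forall>\<mu>>0. \<exists>r>0. \<forall>u\<^sub>0. norm u\<^sub>0 \<le> \<mu> \<longrightarrow>
        (\<exists>u. is_solution iX iY JY E {0..<r} u \<and> u 0 = u\<^sub>0 \<and>
          (\<forall>t\<in>{0<..<r}. E (u t) = E u\<^sub>0 \<and> Q B (u t) = Q B u\<^sub>0))"
    and interval: "\<omega>\<^sub>1 < \<omega>\<^sub>2"
    and family_C3: "Ck_curve_on 3 {\<omega>\<^sub>1<..<\<omega>\<^sub>2} \<phi>"
    and family_bound_state: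
      "\<forall>\<nu>\<in>{\<omega>\<^sub>1<..<\<omega>\<^sub>2}. bound_state iX iY JY T E \<nu> (\<phi> \<nu>)"
    and family_domain:
      "\<forall>\<nu>\<in>{\<omega>\<^sub>1<..<\<omega>\<^sub>2}.
        \<phi> \<nu> \<in> gen_dom_pow T 3 \<and>
        vderiv \<phi> \<nu> \<in> gen_dom_pow T 2 \<and>
        vderiv (vderiv \<phi>) \<nu> \<in> gen_dom T"
    and family_Y:
      "\<forall>\<nu>\<in>{\<omega>\<^sub>1<..<\<omega>\<^sub>2}.
        iX (gen T (\<phi> \<nu>)) \<in> range (blinfun_apply iY) \<and>
        iX (vderiv \<phi> \<nu>) \<in> range (blinfun_apply iY) \<and>
        iX (gen T (vderiv \<phi> \<nu>)) \<in> range (blinfun_apply iY) \<and>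
        iX (vderiv (vderiv \<phi>) \<nu>) \<in> range (blinfun_apply iY)"
    and family_nondegenerate:
      "\<forall>\<nu>\<in>{\<omega>\<^sub>1<..<\<omega>\<^sub>2}.
        gen T (\<phi> \<nu>) \<noteq> 0 \<and> vderiv \<phi> \<nu> \<noteq> 0 \<and>
        iX (gen T (\<phi> \<nu>)) \<bullet> iX (vderiv \<phi> \<nu>) = 0"
    and spectrum_kernel:
      "\<forall>\<nu>\<in>{\<omega>\<^sub>1<..<\<omega>\<^sub>2}. {u. S'' E B \<nu> (\<phi> \<nu>) u = 0} = span {gen T (\<phi> \<nu>)}"
    and spectrum_negative:
      "\<forall>\<nu>\<in>{\<omega>\<^sub>1<..<\<omega>\<^sub>2}. \<exists>\<mu>>0.
        spectrum (S'' E B \<nu> (\<phi> \<nu>)) \<inter> {..<0} = {- \<mu>} \<and>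
        (\<exists>\<eta>. \<eta> \<noteq> 0 \<and> eigenspace (S'' E B \<nu> (\<phi> \<nu>)) (- \<mu>) = span {\<eta>})"
    and spectrum_positive:
      "\<forall>\<nu>\<in>{\<omega>\<^sub>1<..<\<omega>\<^sub>2}.
        0 < Inf (ereal ` {s. 0 < s \<and> s \<in> spectrum (S'' E B \<nu> (\<phi> \<nu>))})"
    and d_def: "d = (\<lambda>\<nu>. S E B \<nu> (\<phi> \<nu>))"
    and omega: "\<omega> \<in> {\<omega>\<^sub>1<..<\<omega>\<^sub>2}"
    and d_asymptotics:
      "same_order_at_0
        (\<lambda>l. d (\<omega> + l) - d \<omega> - l * deriv d \<omega>)
        (\<lambda>l. l * (deriv d (\<omega> + l) - deriv d \<omega>))"
    and d_strictly_convex: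
      "\<exists>U. open U \<and> \<omega> \<in> U \<and> U \<subseteq> {\<omega>\<^sub>1<..<\<omega>\<^sub>2} \<and> strictly_convex_on U d"
  shows "bound_state_stable iX iY JY T E B (\<phi> \<omega>)"
proof -
  interpret hamiltonian_system iX iY J JX JY T E B
    by (rule setting)
  let ?I = "{\<omega>\<^sub>1<..<\<omega>\<^sub>2}"

  \<comment> \<open>Derivatives along the family\<close>
  have \<phi>_deriv: "(\<phi> has_vector_derivative vderiv \<phi> \<nu>) (at \<nu>)" if "\<nu> \<in> ?I" for \<nu>
  proof -
    have "\<forall>t\<in>?I. (vderiv ^^ 0) \<phi> differentiable (at t)"
      using family_C3 unfolding Ck_curve_on_def by (metis zero_less_numeral)
    then have "\<phi> differentiable (at \<nu>)"
      using that by simp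
    then show ?thesis
      by (simp add: vderiv_def vector_derivative_works)
  qed
  have \<phi>_dom: "\<phi> \<nu> \<in> gen_dom T" if "\<nu> \<in> ?I" for \<nu>
    using family_domain that by (simp add: numeral_3_eq_3)
  have critical: "fderiv E (\<phi> \<nu>) = \<nu> *\<^sub>R B (\<phi> \<nu>)" if "\<nu> \<in> ?I" for \<nu>
    using bound_state_critical family_bound_state \<phi>_dom that by blast
  have Q_deriv: "((\<lambda>\<nu>. Q B (\<phi> \<nu>)) has_real_derivative B (\<phi> \<nu>) (vderiv \<phi> \<nu>)) (at \<nu>)" if "\<nu> \<in> ?I" for \<nu>
    unfolding has_real_derivative_iff_has_vector_derivative
    using vector_derivative_diff_chain_within[OF \<phi>_deriv[OF that] has_derivative_at_withinI[OF Q_has_derivative]]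
    by (simp add: o_def)
  have E_deriv: "((\<lambda>\<nu>. E (\<phi> \<nu>)) has_real_derivative \<nu> * B (\<phi> \<nu>) (vderiv \<phi> \<nu>)) (at \<nu>)" if "\<nu> \<in> ?I" for \<nu>
    unfolding has_real_derivative_iff_has_vector_derivative
    using vector_derivative_diff_chain_within[OF \<phi>_deriv[OF that]
        has_derivative_at_withinI[OF C2_has_derivative(1)[OF E_C2]]] critical[OF that]
    by (simp add: o_def blinfun.scaleR_left)
  \<comment> \<open>As \<open>\<phi> \<nu>\<close> is critical, only the explicit dependence on
    \<open>\<nu>\<close> contributes.\<close>
  have d_deriv: "(d has_real_derivative - Q B (\<phi> \<nu>)) (at \<nu>)" if "\<nu> \<in> ?I" for \<nu>
    unfolding d_def S_def
    by (rule derivative_eq_intros E_deriv[OF that] Q_deriv[OF that] refl)+ simp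
  have deriv_d: "deriv d \<nu> = - Q B (\<phi> \<nu>)" if "\<nu> \<in> ?I" for \<nu>
    using d_deriv[OF that] by (rule DERIV_imp_deriv)

  \<comment> \<open>Coercivity of the second derivative of the action\<close>
  define u where "u = \<phi> \<omega>"
  define \<tau> where "\<tau> = gen T u"
  define \<xi> where "\<xi> = vderiv \<phi> \<omega>"
  define A where "A = S'' E B \<omega> u"
  have \<tau>: "\<tau> \<noteq> 0"
    using family_nondegenerate omega by (simp add: \<tau>_def u_def)
  have A_sym: "A x y = A y x" for x y
    unfolding A_def by (rule S''_symmetric)
  have kernel: "{x. A x = 0} = span {\<tau>}"
    using spectrum_kernel omega by (simp add: A_def u_def \<tau>_def)
  then have A\<tau>: "A \<tau> = 0"
    using span_base[of \<tau> "{\<tau>}"] by blast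
  have A\<xi>: "A \<xi> = B u"
  proof -
    have "((\<lambda>\<nu>. fderiv E (\<phi> \<nu>)) has_vector_derivative fderiv (fderiv E) u \<xi>) (at \<omega>)"
      using vector_derivative_diff_chain_within[OF \<phi>_deriv[OF omega]
          has_derivative_at_withinI[OF C2_has_derivative(2)[OF E_C2]]]
      by (simp add: o_def u_def \<xi>_def)
    then have 1: "((\<lambda>\<nu>. \<nu> *\<^sub>R B (\<phi> \<nu>)) has_vector_derivative fderiv (fderiv E) u \<xi>) (at \<omega>)"
      by (rule has_vector_derivative_transform_within_open[OF _ open_greaterThanLessThan omega])
        (rule critical)
    have "((\<lambda>\<nu>. B (\<phi> \<nu>)) has_vector_derivative B \<xi>) (at \<omega>)"
      unfolding \<xi>_def using \<phi>_deriv[OF omega]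
      by (rule bounded_linear.has_vector_derivative[OF blinfun.bounded_linear_right])
    then have "((\<lambda>\<nu>. \<nu> *\<^sub>R B (\<phi> \<nu>)) has_vector_derivative \<omega> *\<^sub>R B \<xi> + 1 *\<^sub>R B (\<phi> \<omega>)) (at \<omega>)"
      by (intro has_vector_derivative_scaleR DERIV_ident)
    with 1 have "fderiv (fderiv E) u \<xi> = \<omega> *\<^sub>R B \<xi> + 1 *\<^sub>R B (\<phi> \<omega>)"
      by (rule vector_derivative_unique_at)
    then show ?thesis
      by (simp add: A_def S''_eq blinfun.bilinear_simps u_def)
  qed
  have A\<xi>0: "A \<xi> \<noteq> 0"
    using B_nonzero[of u] \<phi>_dom[OF omega] \<tau> unfolding A\<xi> by (simp add: u_def \<tau>_def)
  obtain \<mu> \<eta> where \<mu>: "0 < \<mu>" "spectrum A \<inter> {..<0} = {- \<mu>}" "eigenspace A (- \<mu>) = span {\<eta>}"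
    using spectrum_negative omega unfolding A_def u_def by blast
  have "0 < Inf (ereal ` {s. 0 < s \<and> s \<in> spectrum A})"
    using spectrum_positive omega by (simp add: A_def u_def)
  then obtain c where c: "0 < c" "\<And>x. x \<bullet> \<eta> = 0 \<Longrightarrow> x \<bullet> \<tau> = 0 \<Longrightarrow> c * (norm x)\<^sup>2 \<le> A x x"
    using coercive_off_eigenvectors[OF A_sym kernel \<mu>] by blast
  have orth: "\<tau> \<bullet> \<eta> = 0"
  proof -
    have "A \<eta> = - \<mu> *\<^sub>R riesz \<eta>"
      using \<mu>(3) span_base[of \<eta> "{\<eta>}"] unfolding eigenspace_def by blast
    then have "A \<tau> \<eta> = - \<mu> * (\<eta> \<bullet> \<tau>)"
      by (simp add: A_sym[of \<tau> \<eta>] blinfun.bilinear_simps)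
    then show ?thesis
      using \<mu>(1) by (simp add: A\<tau> inner_commute)
  qed

  \<comment> \<open>The functions D and g near 0\<close>
  define \<gamma> where "\<gamma> \<theta> = \<phi> (\<omega> + \<theta>)" for \<theta>
  have \<gamma>0: "\<gamma> 0 = u"
    by (simp add: \<gamma>_def u_def)
  define D where "D \<theta> = S E B (\<omega> + \<theta>) (\<gamma> \<theta>) - S E B \<omega> (\<gamma> 0) + \<theta> * Q B (\<gamma> 0)" for \<theta>
  define g where "g \<theta> = Q B (\<gamma> 0) - Q B (\<gamma> \<theta>)" for \<theta>
  obtain U where U: "open U" "\<omega> \<in> U" "U \<subseteq> ?I" "strictly_convex_on U d"
    using d_strictly_convex by blast
  have d_eq: "d \<nu> = S E B \<nu> (\<phi> \<nu>)" for \<nu>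
    by (simp add: d_def)
  have D_eq: "D \<theta> = d (\<omega> + \<theta>) - d \<omega> - \<theta> * deriv d \<omega>" for \<theta>
    using deriv_d[OF omega] by (simp add: D_def d_eq \<gamma>_def)
  have g_eq: "g \<theta> = deriv d (\<omega> + \<theta>) - deriv d \<omega>" if "\<omega> + \<theta> \<in> ?I" for \<theta>
    using deriv_d[OF that] by (simp add: g_def deriv_d[OF omega] \<gamma>_def)
  have D_pos: "0 < D \<theta>" if "\<omega> + \<theta> \<in> U" "\<theta> \<noteq> 0" for \<theta>
    using strictly_convex_above_tangent[OF U(4,1,2) that(1) _ d_deriv[OF omega]] that(2)
    by (simp add: D_eq deriv_d[OF omega])
  obtain l1 where l1: "0 < l1" "\<And>\<theta>. \<bar>\<theta>\<bar> < l1 \<Longrightarrow> \<omega> + \<theta> \<in> U"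
  proof -
    obtain e where e: "0 < e" "ball \<omega> e \<subseteq> U"
      using U(1,2) open_contains_ball by blast
    have "\<omega> + \<theta> \<in> U" if "\<bar>\<theta>\<bar> < e" for \<theta>
      by (rule subsetD[OF e(2)]) (use that in \<open>simp add: dist_norm\<close>)
    with e(1) show thesis by (rule that)
  qed
  obtain c0 l where c0: "0 < c0" and l: "0 < l" "l \<le> l1"
    and D_g: "\<And>\<theta>. \<bar>\<theta>\<bar> < l \<Longrightarrow> \<theta> \<noteq> 0 \<Longrightarrow> 0 < \<theta> * g \<theta> \<and> c0 * (\<theta> * g \<theta>) < D \<theta>"
  proof -
    let ?q = "\<lambda>\<theta>. (d (\<omega> + \<theta>) - d \<omega> - \<theta> * deriv d \<omega>) / (\<theta> * (deriv d (\<omega> + \<theta>) - deriv d \<omega>))"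
    have liminf: "0 < Liminf (at 0) (\<lambda>\<theta>. ereal (?q \<theta>))"
      using d_asymptotics unfolding same_order_at_0_def by (rule conjunct1)
    obtain c0 where "0 < ereal c0" and c0_less: "ereal c0 < Liminf (at 0) (\<lambda>\<theta>. ereal (?q \<theta>))"
      using ereal_dense2[OF liminf] by blast
    then have c0: "0 < c0"
      by simp
    have "\<forall>\<^sub>F \<theta> in at 0. c0 < ?q \<theta>"
      using less_LiminfD[OF c0_less] by (simp only: less_ereal.simps)
    then obtain l2 where l2: "0 < l2" "\<And>\<theta>. \<theta> \<noteq> 0 \<Longrightarrow> \<bar>\<theta>\<bar> < l2 \<Longrightarrow> c0 < ?q \<theta>"
      unfolding eventually_at dist_norm by auto
    have "0 < \<theta> * g \<theta> \<and> c0 * (\<theta> * g \<theta>) < D \<theta>" if "\<bar>\<theta>\<bar> < min l1 l2" "\<theta> \<noteq> 0" for \<theta>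
    proof -
      have \<theta>U: "\<omega> + \<theta> \<in> U"
        using that(1) by (intro l1(2)) simp
      then have q: "c0 < D \<theta> / (\<theta> * g \<theta>)"
        using l2(2)[OF that(2)] that(1) U(3) by (simp add: D_eq g_eq subset_iff)
      \<comment> \<open>A zero denominator would make the quotient 0, so this also excludes
        \<open>g \<theta> = 0\<close>; the sign of the denominator then follows from
        \<open>D_pos\<close>.\<close>
      have "0 < D \<theta> / (\<theta> * g \<theta>)"
        using q c0 by linarith
      then have "0 < \<theta> * g \<theta>"
        using D_pos[OF \<theta>U that(2)] by (simp add: zero_less_divide_iff)
      with q show ?thesis
        by (simp add: pos_less_divide_eq)
    qed
    with c0 l1(1) l2(1) show thesis
      by (intro that[of c0 "min l1 l2"]) auto
  qed
  have in_I: "\<omega> + \<theta> \<in> ?I" if "\<bar>\<theta>\<bar> < l" for \<theta>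
    using that l(2) l1(2) U(3) by (meson less_le_trans subsetD)
  have shift: "((\<lambda>\<theta>. f (\<omega> + \<theta>)) has_vector_derivative f') (at \<theta>)"
    if "(f has_vector_derivative f') (at (\<omega> + \<theta>))" for f :: "real \<Rightarrow> 'z::real_normed_vector" and f' \<theta>
  proof -
    have "(f \<circ> (\<lambda>\<theta>. \<omega> + \<theta>) has_vector_derivative 1 *\<^sub>R f') (at \<theta>)"
      using that by (intro vector_diff_chain_at) (auto intro!: derivative_eq_intros)
    then show ?thesis by (simp add: o_def)
  qed
  have \<gamma>_deriv: "(\<gamma> has_vector_derivative vderiv \<phi> (\<omega> + \<theta>)) (at \<theta>)" if "\<bar>\<theta>\<bar> < l" for \<theta>
    unfolding \<gamma>_def by (intro shift \<phi>_deriv in_I that)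
  have \<gamma>_cont: "isCont \<gamma> \<theta>" if "\<bar>\<theta>\<bar> < l" for \<theta>
    using \<gamma>_deriv[OF that] by (rule has_vector_derivative_continuous)
  have \<gamma>_deriv0: "(\<gamma> has_vector_derivative \<xi>) (at 0)"
    using \<gamma>_deriv[of 0] l(1) by (simp add: \<xi>_def)
  have critical_\<gamma>: "fderiv E (\<gamma> \<theta>) = (\<omega> + \<theta>) *\<^sub>R B (\<gamma> \<theta>)" if "\<bar>\<theta>\<bar> < l" for \<theta>
    unfolding \<gamma>_def by (intro critical in_I that)
  \<comment> \<open>\<open>p\<close> is the second derivative of \<open>d\<close> at
    \<open>\<omega>\<close>, that is, the derivative of \<open>g\<close> at 0.\<close>
  define p where "p = - A \<xi> \<xi>"
  have p_eq: "p = - B u \<xi>"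
    by (simp add: p_def A\<xi>)
  have g_linear: "\<exists>\<rho>>0. \<forall>\<theta>. \<bar>\<theta>\<bar> \<le> \<rho> \<longrightarrow> \<bar>g \<theta> - \<theta> * p\<bar> \<le> \<kappa> * \<bar>\<theta>\<bar>" if "0 < \<kappa>" for \<kappa>
  proof -
    have "((\<lambda>\<theta>. Q B (\<gamma> \<theta>)) has_vector_derivative B (\<phi> \<omega>) (vderiv \<phi> \<omega>)) (at 0)"
      unfolding \<gamma>_def
      by (rule shift) (use Q_deriv[OF omega] in \<open>simp add: has_real_derivative_iff_has_vector_derivative\<close>)
    then have "((\<lambda>\<theta>. Q B (\<gamma> 0) - Q B (\<gamma> \<theta>)) has_vector_derivative 0 - B (\<phi> \<omega>) (vderiv \<phi> \<omega>)) (at 0)"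
      by (rule has_vector_derivative_diff[OF has_vector_derivative_const])
    then have "(g has_vector_derivative p) (at 0)"
      by (simp add: p_eq u_def \<xi>_def g_def[abs_def])
    from vector_derivative_linear_bound[OF this that] show ?thesis
      by (simp add: g_def)
  qed
  \<comment> \<open>A negative slope of \<open>g\<close> at 0 would contradict
    \<open>0 < \<theta> * g \<theta>\<close>.\<close>
  have p: "0 \<le> p"
  proof (rule ccontr)
    assume "\<not> 0 \<le> p"
    then obtain \<rho> where \<rho>: "0 < \<rho>" "\<And>\<theta>. \<bar>\<theta>\<bar> \<le> \<rho> \<Longrightarrow> \<bar>g \<theta> - \<theta> * p\<bar> \<le> - p / 2 * \<bar>\<theta>\<bar>"
      using g_linear[of "- p / 2"] by auto
    define \<theta> where "\<theta> = min \<rho> (l / 2)"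
    have \<theta>: "0 < \<theta>" "\<theta> \<le> \<rho>" "\<theta> < l"
      using \<rho>(1) l(1) by (auto simp: \<theta>_def)
    have "0 < g \<theta>"
      using D_g[of \<theta>] \<theta> by (simp add: zero_less_mult_iff)
    moreover have "g \<theta> \<le> \<theta> * p / 2"
      using \<rho>(2)[of \<theta>] \<theta> by (simp add: abs_le_iff algebra_simps)
    moreover have "\<theta> * p < 0"
      using \<theta>(1) \<open>\<not> 0 \<le> p\<close> by (simp add: mult_less_0_iff)
    ultimately show False by simp
  qed
  have orbit_deriv: "((\<lambda>s. T s u) has_vector_derivative \<tau>) (at 0)"
    unfolding \<tau>_def u_def by (intro gen_has_vector_derivative \<phi>_dom omega)
  have l2: "0 < l / 2" "l / 2 < l"
    using l(1) by auto
  have control: "\<exists>\<epsilon>\<^sub>0>0. \<forall>\<epsilon>>0. \<exists>\<eta>>0. \<forall>v. (\<exists>s. norm (v - T s (\<gamma> 0)) < \<epsilon>\<^sub>0) \<longrightarrow>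
    \<bar>E v - E (\<gamma> 0)\<bar> \<le> \<eta> \<longrightarrow> \<bar>Q B v - Q B (\<gamma> 0)\<bar> \<le> \<eta> \<longrightarrow> (\<exists>s. norm (v - T s (\<gamma> 0)) < \<epsilon>)"
  proof (cases "p = 0")
    case False
    then have A\<xi>\<xi>: "A \<xi> \<xi> < 0"
      using p by (simp add: p_def)
    \<comment> \<open>The family is not followed here: with \<open>I = {0}\<close> the conditions on
      \<open>D\<close> and \<open>g\<close> reduce to \<open>\<theta> = 0\<close>, where both
      vanish, and the choice of \<open>l'\<close> is arbitrary.\<close>
    show ?thesis
    proof (rule orbital_control[OF l(1) critical_\<gamma> \<gamma>_cont, where V = "{r. r \<bullet> \<tau> = 0}" and I = "{0}" and l' = 1])
      show "\<exists>c>0. \<exists>C\<ge>0. \<forall>r\<in>{r. r \<bullet> \<tau> = 0}. c * (norm r)\<^sup>2 - C * (B (\<gamma> 0) r)\<^sup>2 \<le> S'' E B \<omega> (\<gamma> 0) r r"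
        unfolding \<gamma>0 A_def[symmetric] A\<xi>[symmetric]
        by (rule coercive_nondegenerate[OF A_sym c orth A\<tau> \<tau> A\<xi>\<xi>]; assumption)
      show "\<exists>\<delta>>0. \<forall>v. norm (v - \<gamma> 0) < \<delta> \<longrightarrow> (\<exists>s \<theta>. \<theta> \<in> {0} \<and> \<bar>\<theta>\<bar> \<le> \<rho> \<and>
          norm (T s v - \<gamma> \<theta>) \<le> \<rho> \<and> T s v - \<gamma> \<theta> \<in> {r. r \<bullet> \<tau> = 0})" if "0 < \<rho>" for \<rho>
        using modulation_1[OF orbit_deriv \<tau> that] that by (auto simp: \<gamma>0)
    qed (use l in \<open>auto intro: exI[of _ 1]\<close>)
  next
    case True
    then have A\<xi>\<xi>: "A \<xi> \<xi> = 0"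
      by (simp add: p_def)
    show ?thesis
    proof (rule orbital_control[OF l(1) critical_\<gamma> \<gamma>_cont, where V = "{r. r \<bullet> \<tau> = 0 \<and> r \<bullet> \<xi> = 0}" and I = UNIV and l' = "l / 2"])
      show "\<exists>c>0. \<exists>C\<ge>0. \<forall>r\<in>{r. r \<bullet> \<tau> = 0 \<and> r \<bullet> \<xi> = 0}.
          c * (norm r)\<^sup>2 - C * (B (\<gamma> 0) r)\<^sup>2 \<le> S'' E B \<omega> (\<gamma> 0) r r"
        unfolding \<gamma>0 A_def[symmetric] A\<xi>[symmetric]
        by (rule coercive_degenerate[OF A_sym c orth A\<tau> \<tau> A\<xi>0 A\<xi>\<xi>]; assumption)
      \<comment> \<open>The Gram determinant in \<open>X\<close> is positive because
        \<open>A\<close> annihilates \<open>\<tau>\<close> but not \<open>\<xi>\<close>.\<close>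
      have "(\<tau> \<bullet> \<xi>)\<^sup>2 < (\<tau> \<bullet> \<tau>) * (\<xi> \<bullet> \<xi>)"
      proof -
        define b where "b = (\<tau> \<bullet> \<xi>) / (\<tau> \<bullet> \<tau>)"
        have "\<xi> - b *\<^sub>R \<tau> \<noteq> 0"
        proof
          assume "\<xi> - b *\<^sub>R \<tau> = 0"
          then have "A \<xi> = b *\<^sub>R A \<tau>"
            by (simp flip: blinfun.scaleR_right)
          with A\<xi>0 A\<tau> show False by simp
        qed
        then have "0 < (\<tau> \<bullet> \<tau>) * ((\<xi> - b *\<^sub>R \<tau>) \<bullet> (\<xi> - b *\<^sub>R \<tau>))"
          using \<tau> by simp
        also have "\<dots> = (\<tau> \<bullet> \<tau>) * (\<xi> \<bullet> \<xi>) - (\<tau> \<bullet> \<xi>)\<^sup>2"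
          using \<tau> by (simp add: b_def inner_simps inner_commute[of \<xi> \<tau>] power2_eq_square field_simps)
        finally show ?thesis by simp
      qed
      moreover have "continuous_on {- (l / 2)..l / 2} \<gamma>"
        using \<gamma>_cont l2 by (intro continuous_at_imp_continuous_on) auto
      ultimately show "\<exists>\<delta>>0. \<forall>v. norm (v - \<gamma> 0) < \<delta> \<longrightarrow> (\<exists>s \<theta>. \<theta> \<in> UNIV \<and> \<bar>\<theta>\<bar> \<le> \<rho> \<and>
          norm (T s v - \<gamma> \<theta>) \<le> \<rho> \<and> T s v - \<gamma> \<theta> \<in> {r. r \<bullet> \<tau> = 0 \<and> r \<bullet> \<xi> = 0})" if "0 < \<rho>" for \<rho>
        using modulation_2[OF orbit_deriv \<gamma>_deriv0 \<gamma>0 l2(1) _ _ that] by (auto simp: \<gamma>0)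
      show "\<exists>\<rho>>0. \<forall>\<theta>\<in>UNIV. \<bar>\<theta>\<bar> \<le> \<rho> \<longrightarrow> (Q B (\<gamma> 0) - Q B (\<gamma> \<theta>))\<^sup>2 \<le>
          \<kappa> * (S E B (\<omega> + \<theta>) (\<gamma> \<theta>) - S E B \<omega> (\<gamma> 0) + \<theta> * Q B (\<gamma> 0))" if \<kappa>: "0 < \<kappa>" for \<kappa>
        unfolding g_def[symmetric] D_def[symmetric]
      proof -
        \<comment> \<open>The derivative of \<open>g\<close> at 0 is \<open>p = 0\<close>, so
          \<open>g\<close> is below any multiple of \<open>\<theta>\<close>; the factor
          \<open>c0\<close> matches the bound of \<open>D\<close> from below by
          \<open>\<theta> * g \<theta>\<close>.\<close>
        obtain \<rho> where \<rho>: "0 < \<rho>" "\<And>\<theta>. \<bar>\<theta>\<bar> \<le> \<rho> \<Longrightarrow> \<bar>g \<theta>\<bar> \<le> \<kappa> * c0 * \<bar>\<theta>\<bar>"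
          using g_linear[of "\<kappa> * c0"] \<kappa> c0 True by auto
        have "(g \<theta>)\<^sup>2 \<le> \<kappa> * D \<theta>" if \<theta>: "\<bar>\<theta>\<bar> \<le> min \<rho> (l / 2)" for \<theta>
        proof (cases "\<theta> = 0")
          case False
          have *: "0 < \<theta> * g \<theta> \<and> c0 * (\<theta> * g \<theta>) < D \<theta>"
            using \<theta> l2 False by (intro D_g) auto
          have "(g \<theta>)\<^sup>2 = \<bar>g \<theta>\<bar> * \<bar>g \<theta>\<bar>"
            by (simp add: power2_eq_square)
          also have "\<dots> \<le> \<kappa> * c0 * \<bar>\<theta>\<bar> * \<bar>g \<theta>\<bar>"
            using \<rho>(2)[of \<theta>] \<theta> by (intro mult_right_mono) auto
          also have "\<dots> = \<kappa> * (c0 * (\<theta> * g \<theta>))"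
            using * by (simp flip: abs_mult)
          also have "\<dots> \<le> \<kappa> * D \<theta>"
            using * \<kappa> by (intro mult_left_mono) auto
          finally show ?thesis .
        qed (simp add: g_def D_def)
        then show "\<exists>\<rho>>0. \<forall>\<theta>\<in>UNIV. \<bar>\<theta>\<bar> \<le> \<rho> \<longrightarrow> (g \<theta>)\<^sup>2 \<le> \<kappa> * D \<theta>"
          using \<rho>(1) l2(1) by (intro exI[of _ "min \<rho> (l / 2)"]) auto
      qed
      show "\<exists>\<eta>>0. \<forall>\<theta>\<in>UNIV. \<bar>\<theta>\<bar> \<le> l / 2 \<longrightarrow>
          S E B (\<omega> + \<theta>) (\<gamma> \<theta>) - S E B \<omega> (\<gamma> 0) + \<theta> * Q B (\<gamma> 0) < \<eta> \<longrightarrow> norm (\<gamma> \<theta> - \<gamma> 0) < \<epsilon>"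
        if \<epsilon>: "0 < \<epsilon>" for \<epsilon>
        unfolding D_def[symmetric]
      proof -
        obtain \<rho> where \<rho>: "0 < \<rho>" "\<And>\<theta>. \<bar>\<theta>\<bar> < \<rho> \<Longrightarrow> norm (\<gamma> \<theta> - \<gamma> 0) < \<epsilon>"
          using \<gamma>_cont[of 0] l(1) \<epsilon> unfolding continuous_at_eps_delta dist_norm by auto
        \<comment> \<open>On this compact set of parameters away from 0, \<open>D\<close> is
          positive and attains its minimum; if the set is empty, any bound serves.\<close>
        define R where "R = {- (l / 2)..- \<rho>} \<union> {\<rho>..l / 2}"
        have R: "\<bar>\<theta>\<bar> < l \<and> \<theta> \<noteq> 0" if "\<theta> \<in> R" for \<theta>
          using that \<rho>(1) l2 by (auto simp: R_def)
        have R_iff: "\<theta> \<in> R" if "\<bar>\<theta>\<bar> \<le> l / 2" "\<not> \<bar>\<theta>\<bar> < \<rho>" for \<theta>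
          using that unfolding R_def by auto
        have "continuous_on R D"
        proof (rule continuous_at_imp_continuous_on, rule ballI)
          fix \<theta> assume "\<theta> \<in> R"
          then have "(d has_vector_derivative - Q B (\<phi> (\<omega> + \<theta>))) (at (\<omega> + \<theta>))"
            using d_deriv[OF in_I] R by (simp add: has_real_derivative_iff_has_vector_derivative)
          from has_vector_derivative_continuous[OF shift[OF this]]
          show "isCont D \<theta>"
            unfolding D_eq[abs_def] by (intro continuous_intros)
        qed
        moreover have "compact R"
          unfolding R_def by (intro compact_Un compact_Icc)
        ultimately obtain \<eta> where \<eta>: "0 < \<eta>" "\<And>\<theta>. \<theta> \<in> R \<Longrightarrow> \<eta> \<le> D \<theta>"
        proof (cases "R = {}")
          case False
          with \<open>compact R\<close> \<open>continuous_on R D\<close> obtain x where x: "x \<in> R" "\<And>\<theta>. \<theta> \<in> R \<Longrightarrow> D x \<le> D \<theta>"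
            using continuous_attains_inf by metis
          have "0 < c0 * (x * g x)" "c0 * (x * g x) < D x"
            using D_g[of x] R[OF x(1)] c0 by auto
          then have "0 < D x" by (rule less_trans)
          then show ?thesis
            using x(2) by (rule that)
        qed (use that[of 1] in auto)
        have "norm (\<gamma> \<theta> - \<gamma> 0) < \<epsilon>" if "\<bar>\<theta>\<bar> \<le> l / 2" "D \<theta> < \<eta>" for \<theta>
          using \<rho>(2)[of \<theta>] \<eta>(2)[OF R_iff[OF that(1)]] that(2) by force
        with \<eta>(1) show "\<exists>\<eta>>0. \<forall>\<theta>\<in>UNIV. \<bar>\<theta>\<bar> \<le> l / 2 \<longrightarrow> D \<theta> < \<eta> \<longrightarrow> norm (\<gamma> \<theta> - \<gamma> 0) < \<epsilon>"
          by blast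
      qed
    qed (use l l2 in auto)
  qed
  show ?thesis
    using stable_of_control[OF control cauchy_problem] by (simp add: \<gamma>0 u_def)
qed

end
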